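(* Let $m\ge1$, let $X^1,\dots,X^m$ be independent random variables with values in finite sets $\mathcal X_1,\dots,\mathcal X_m$, let $f:\mathcal X_1\times\dots\times\mathcal X_m\to\mathcal Z$ be a function, let $t\ge1$, and let $U^1,\dots,U^t$ be binary random variables, jointly distributed with $X^{1:m}=(X^1,\dots,X^m)$, such that $H(f(X^{1:m})\mid U^{1:t})=0$ and, for every $i\in\{1,\dots,t\}$ with $j=((i-1)\bmod m)+1$, $U^i\to(U^{1:i-1},X^j)\to(X^{1:j-1},X^{j+1:m})$ is a Markov chain. Consider the $t$-round polar-coded broadcast protocol described in the context, with blocklength $N=2^n$. Then, as $N\to\infty$: (1) for every round $i\in\{1,\dots,t\}$, with $j=((i-1)\bmod m)+1$, the rate $|\mathcal I'^i|/N$ of the $i$th broadcast converges to $I(X^j;U^i\mid U^{1:i-1})$; (2) the sink terminal can compute, from the sequences $\bar U^1,\dots,\bar U^t$ that it has formed, a vector that equals $(f(X^1(k),\dots,X^m(k)))_{k=1}^N$ with probability tending to $1$.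
   Context: Polarization notation. $N=2^n$, $n\in\mathbb N$; $[N]=\{1,\dots,N\}$; $\beta\in(0,1/2)$ is fixed and $\delta_N=2^{-N^\beta}$. A bar denotes an $N$-vector, $w^{1:k}=(w^1,\dots,w^k)$, $U^{1:k}=(U^1,\dots,U^k)$. $G_N=B_NF^{\otimes n}$ over $\mathbb F_2$, where $F=\begin{pmatrix}1&0\\1&1\end{pmatrix}$, $\otimes$ is the Kronecker product and $B_N$ is the $N\times N$ bit-reversal permutation matrix. For a binary random variable $T$ and a discrete random variable $V$, $Z(T|V)=2\sum_{v}P_V(v)\sqrt{P_{T|V}(0|v)P_{T|V}(1|v)}$. For a binary $U$ and a discrete $W$ with a given joint law, let $(\bar U,\bar W)$ be $N$ i.i.d. copies of $(U,W)$ and $\bar V=\bar UG_N$; put $\mathcal L_U=\{k\in[N]:Z(V^k|V^{1:k-1})\le\delta_N\}$, $\mathcal L_{U|W}=\{k\in[N]:Z(V^k|V^{1:k-1},\bar W)\le\delta_N\}$, $\mathcal H_{U|W}=\{k\in[N]:Z(V^k|V^{1:k-1},\bar W)\ge1-\delta_N\}$. The superscript $c$ is complement in $[N]$. Ideal distribution. $P$ denotes the law of $(\bar X^1,\dots,\bar X^m,\bar U^1,\dots,\bar U^t,\bar V^1,\dots,\bar V^t)$, where $(\bar X^1,\dots,\bar X^m,\bar U^1,\dots,\bar U^t)$ are $N$ i.i.d. copies of $(X^1,\dots,X^m,U^1,\dots,U^t)$ and $\bar V^i=\bar U^iG_N$; its marginals and conditionals are also denoted $P$ (conditional laws given zero-probability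 events are fixed arbitrarily). Protocol. There are $m$ source terminals and one sink terminal; source terminal $j$ observes $\bar X^j=(X^j(1),\dots,X^j(N))$, where $(\bar X^1,\dots,\bar X^m)$ are $N$ i.i.d. copies of $X^{1:m}$; the sink observes nothing. In round $i=1,\dots,t$ the broadcaster is terminal $j=((i-1)\bmod m)+1$. Put $\mathcal F_r^i=\mathcal L^c_{U^i}\cap\mathcal H_{U^i|(X^j,U^{1:i-1})}$, $\mathcal F_d^i=\mathcal L_{U^i}$, $\mathcal I^i=\mathcal L^c_{U^i}\cap\mathcal H^c_{U^i|(X^j,U^{1:i-1})}$, $\mathcal I'^i=\mathcal I^i\setminus(\mathcal L^c_{U^i}\cap\mathcal L_{U^i|U^{1:i-1}})$ (so $\mathcal I'^1=\mathcal I^1$). The broadcaster generates $\bar v^i$ successively for $k=1,\dots,N$: if $k\in\mathcal F_r^i$, $(v^i)^k$ is a uniform bit; if $k\in\mathcal F_d^i$, it is sampled from $P_{(V^i)^k|(V^i)^{1:k-1}}(\cdot|(v^i)^{1:k-1})$; if $k\in\mathcal I^i$, it is sampled from $P_{(V^i)^k|(V^i)^{1:k-1},\bar X^j,\bar U^1,\dots,\bar U^{i-1}}(\cdot|(v^i)^{1:k-1},\bar x^j,\bar u^1,\dots,\bar u^{i-1})$. It broadcasts the bits $(v^i)^k$, $k\in\mathcal I'^i$, which all terminals receive correctly; the rate of the broadcast is $|\mathcal I'^i|/N$. Every other terminal (including the sink) forms its own version of $\bar v^i$: it copies the received bits for $k\in\mathcal I'^i$; for $k\in\mathcal F_r^i$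 it uses the same uniform bit as the broadcaster (shared randomness); for $k\in\mathcal F_d^i$ it samples from $P_{(V^i)^k|(V^i)^{1:k-1}}(\cdot|(v^i)^{1:k-1})$; for $k\in\mathcal I^i\setminus\mathcal I'^i$ it samples from $P_{(V^i)^k|(V^i)^{1:k-1},\bar U^1,\dots,\bar U^{i-1}}(\cdot|(v^i)^{1:k-1},\bar u^1,\dots,\bar u^{i-1})$, where each terminal uses its own versions of $(v^i)^{1:k-1}$ and of the earlier sequences $\bar u^1,\dots,\bar u^{i-1}$. The private samplings at different terminals use independent randomness, and shared bits are independent of everything else. Each terminal then sets $\bar u^i=\bar v^iG_N$. *)

theory Defs
  imports "HOL-Probability.Probability" "HOL-Library.Z2"
begin

section \<open>Random variables\<close>

text \<open>
  The tuple \<open>(Y\<^sub>i)\<^sub>i\<^sub>\<in>\<^sub>I\<close>, as an extensional function on \<open>I\<close>; thus \<open>U\<^sup>1\<^sup>:\<^sup>i\<^sup>-\<^sup>1\<close> is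
  \<open>tuple {1..<i} U\<close>, a constant for \<open>i = 1\<close>.
\<close>
abbreviation tuple :: "'i set \<Rightarrow> ('i \<Rightarrow> 'w \<Rightarrow> 'a) \<Rightarrow> 'w \<Rightarrow> 'i \<Rightarrow> 'a" where
  "tuple I Y \<equiv> (\<lambda>\<omega>. \<lambda>i\<in>I. Y i \<omega>)"

definition law :: "'w measure \<Rightarrow> ('w \<Rightarrow> 'a) \<Rightarrow> 'a pmf" where
  "law M Y = embed_pmf (\<lambda>y. \<P>(\<omega> in M. Y \<omega> = y))"

lemma pmf_law:
  assumes "prob_space M" and sf: "simple_function M Y"
  shows "pmf (law M Y) y = \<P>(\<omega> in M. Y \<omega> = y)"
proof -
  interpret prob_space M by fact
  have fin: "finite (Y ` space M)" using sf by (rule simple_functionD(1))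
  have sets: "{\<omega> \<in> space M. Y \<omega> = z} \<in> sets M" for z
    using simple_functionD(2)[OF sf, of "{z}"] by (simp add: vimage_def Int_def conj_commute)
  have zero: "{\<omega> \<in> space M. Y \<omega> = z} = {}" if "z \<notin> Y ` space M" for z
    using that by auto
  have "(\<integral>\<^sup>+z. ennreal (\<P>(\<omega> in M. Y \<omega> = z)) \<partial>count_space UNIV)
      = (\<Sum>z\<in>Y ` space M. ennreal (\<P>(\<omega> in M. Y \<omega> = z)))"
    by (rule nn_integral_count_space'[OF fin]) (auto simp: zero simp del: measure_eq_0_null_sets)
  also have "\<dots> = ennreal (\<Sum>z\<in>Y ` space M. prob {\<omega> \<in> space M. Y \<omega> = z})"
    by (rule sum_ennreal) simp
  also have "(\<Sum>z\<in>Y ` space M. prob {\<omega> \<in> space M. Y \<omega> = z})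
      = prob (\<Union>z\<in>Y ` space M. {\<omega> \<in> space M. Y \<omega> = z})"
    by (rule finite_measure_finite_Union[symmetric])
       (use fin sets in \<open>auto simp: disjoint_family_on_def\<close>)
  also have "(\<Union>z\<in>Y ` space M. {\<omega> \<in> space M. Y \<omega> = z}) = space M" by auto
  finally show ?thesis
    unfolding law_def by (intro pmf_embed_pmf) (simp_all add: prob_space)
qed

text \<open>
  \<open>A \<rightarrow> B \<rightarrow> C\<close> is a Markov chain: \<open>A\<close> and \<open>C\<close> are conditionally independent given \<open>B\<close>.
  As \<^const>\<open>cond_prob\<close> is \<open>0\<close> on conditions of probability \<open>0\<close>, only values of \<open>B\<close> of positive
  probability impose a constraint.
\<close>
definition markov_chain ::
    "'w measure \<Rightarrow> ('w \<Rightarrow> 'a) \<Rightarrow> ('w \<Rightarrow> 'b) \<Rightarrow> ('w \<Rightarrow> 'c) \<Rightarrow> bool" where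
  "markov_chain M A B C \<longleftrightarrow> (\<forall>a b c.
     \<P>(\<omega> in M. A \<omega> = a \<and> C \<omega> = c \<bar> B \<omega> = b)
       = \<P>(\<omega> in M. A \<omega> = a \<bar> B \<omega> = b) * \<P>(\<omega> in M. C \<omega> = c \<bar> B \<omega> = b))"

text \<open>\<open>Z(T|V)\<close>, as a function of the joint law of \<open>(T, V)\<close>.\<close>
definition bhattacharyya :: "(bit \<times> 'v) pmf \<Rightarrow> real" where
  "bhattacharyya R = 2 * (\<Sum>\<^sub>\<infinity>v. pmf (map_pmf snd R) v *
     sqrt (\<P>(z in measure_pmf R. fst z = 0 \<bar> snd z = v) *
           \<P>(z in measure_pmf R. fst z = 1 \<bar> snd z = v)))"

text \<open>
  The conditional law \<open>P\<^bsub>T|V\<^esub>(\<cdot>|v)\<close> for \<open>(T, V) \<sim> R\<close>; \<open>d\<close> is the arbitrary choice made at those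
  \<open>v\<close> that have probability \<open>0\<close>.
\<close>
definition cond_law :: "('a \<times> 'v) pmf \<Rightarrow> ('v \<Rightarrow> 'a pmf) \<Rightarrow> 'v \<Rightarrow> 'a pmf" where
  "cond_law R d v =
     (if v \<in> set_pmf (map_pmf snd R) then map_pmf fst (cond_pmf R {z. snd z = v}) else d v)"


section \<open>Polar transform\<close>

text \<open>
  Matrices over \<open>\<bbbF>\<^sub>2\<close> are functions of two indices, with rows, columns and block positions counted
  from \<open>0\<close>: the index set \<open>[N]\<close> is rendered as \<open>{..<N}\<close> and \<open>w\<^sup>1\<^sup>:\<^sup>k\<^sup>-\<^sup>1\<close> becomes
  \<open>restrict w {..<k}\<close>. Rounds and source terminals keep their numbering from \<open>1\<close>.
\<close>

text \<open>Kronecker product, where the second factor is a \<open>q \<times> q\<close> matrix.\<close>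
definition kron :: "nat \<Rightarrow> (nat \<Rightarrow> nat \<Rightarrow> bit) \<Rightarrow> (nat \<Rightarrow> nat \<Rightarrow> bit) \<Rightarrow> nat \<Rightarrow> nat \<Rightarrow> bit" where
  "kron q A B r c = A (r div q) (c div q) * B (r mod q) (c mod q)"

definition F_mat :: "nat \<Rightarrow> nat \<Rightarrow> bit" where
  "F_mat r c = (if r = 0 \<and> c = 1 then 0 else 1)"

primrec F_kron_power :: "nat \<Rightarrow> nat \<Rightarrow> nat \<Rightarrow> bit" where
  "F_kron_power 0 = (\<lambda>r c. 1)"
| "F_kron_power (Suc n) = kron (2 ^ n) F_mat (F_kron_power n)"

text \<open>Reversal of the \<open>n\<close>-digit binary expansion of \<open>k < 2 ^ n\<close>.\<close>
definition bit_reverse :: "nat \<Rightarrow> nat \<Rightarrow> nat" where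
  "bit_reverse n k = (\<Sum>i<n. (k div 2 ^ i mod 2) * 2 ^ (n - 1 - i))"

definition B_mat :: "nat \<Rightarrow> nat \<Rightarrow> nat \<Rightarrow> bit" where
  "B_mat n r c = (if c = bit_reverse n r then 1 else 0)"

definition G_mat :: "nat \<Rightarrow> nat \<Rightarrow> nat \<Rightarrow> bit" where
  "G_mat n r c = (\<Sum>l<2 ^ n. B_mat n r l * F_kron_power n l c)"

text \<open>\<open>u \<mapsto> u G\<^sub>N\<close>\<close>
definition polar :: "nat \<Rightarrow> (nat \<Rightarrow> bit) \<Rightarrow> nat \<Rightarrow> bit" where
  "polar n u = (\<lambda>k\<in>{..<2 ^ n}. \<Sum>l<2 ^ n. u l * G_mat n l k)"

text \<open>\<open>N = 2 ^ n\<close> i.i.d. copies; \<open>undefined\<close> is only the value at positions outside \<open>{..<N}\<close>.\<close>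
definition iid :: "nat \<Rightarrow> 'a pmf \<Rightarrow> (nat \<Rightarrow> 'a) pmf" where
  "iid n p = Pi_pmf {..<2 ^ n} undefined (\<lambda>_. p)"

definition \<delta> :: "real \<Rightarrow> nat \<Rightarrow> real" where
  "\<delta> \<beta> n = 2 powr (- ((2 ^ n) powr \<beta>))"

text \<open>\<open>Z(V\<^sup>k|V\<^sup>1\<^sup>:\<^sup>k\<^sup>-\<^sup>1)\<close>, where \<open>p\<close> is the law of \<open>U\<close>.\<close>
definition polar_Z :: "nat \<Rightarrow> bit pmf \<Rightarrow> nat \<Rightarrow> real" where
  "polar_Z n p k =
     bhattacharyya (map_pmf (\<lambda>u. (polar n u k, restrict (polar n u) {..<k})) (iid n p))"

text \<open>\<open>Z(V\<^sup>k|V\<^sup>1\<^sup>:\<^sup>k\<^sup>-\<^sup>1, W)\<close> with the whole block of \<open>W\<close>, where \<open>p\<close> is the joint law of \<open>(U, W)\<close>.\<close>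
definition polar_cond_Z :: "nat \<Rightarrow> (bit \<times> 'w) pmf \<Rightarrow> nat \<Rightarrow> real" where
  "polar_cond_Z n p k =
     bhattacharyya (map_pmf (\<lambda>s. let v = polar n (\<lambda>l. fst (s l)) in
         (v k, restrict v {..<k}, \<lambda>l\<in>{..<2 ^ n}. snd (s l))) (iid n p))"

definition low_set :: "real \<Rightarrow> nat \<Rightarrow> bit pmf \<Rightarrow> nat set" where
  "low_set \<beta> n p = {k \<in> {..<2 ^ n}. polar_Z n p k \<le> \<delta> \<beta> n}"

definition low_cond_set :: "real \<Rightarrow> nat \<Rightarrow> (bit \<times> 'w) pmf \<Rightarrow> nat set" where
  "low_cond_set \<beta> n p = {k \<in> {..<2 ^ n}. polar_cond_Z n p k \<le> \<delta> \<beta> n}"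

definition high_cond_set :: "real \<Rightarrow> nat \<Rightarrow> (bit \<times> 'w) pmf \<Rightarrow> nat set" where
  "high_cond_set \<beta> n p = {k \<in> {..<2 ^ n}. polar_cond_Z n p k \<ge> 1 - \<delta> \<beta> n}"


section \<open>Ideal distribution\<close>

text \<open>
  Throughout, \<open>Q\<close> is the joint law of one copy of \<open>(X\<^sup>1\<^sup>:\<^sup>m, U\<^sup>1\<^sup>:\<^sup>t)\<close>. The ideal distribution is
  carried by \<open>iid n Q\<close>, on which the blocks are the following random variables.
\<close>
type_synonym 'x source = "(nat \<Rightarrow> 'x) \<times> (nat \<Rightarrow> bit)"

definition X_block :: "nat \<Rightarrow> nat \<Rightarrow> (nat \<Rightarrow> 'x source) \<Rightarrow> nat \<Rightarrow> 'x" where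
  "X_block n j s = (\<lambda>k\<in>{..<2 ^ n}. fst (s k) j)"

definition U_block :: "nat \<Rightarrow> nat \<Rightarrow> (nat \<Rightarrow> 'x source) \<Rightarrow> nat \<Rightarrow> bit" where
  "U_block n i s = (\<lambda>k\<in>{..<2 ^ n}. snd (s k) i)"

definition V_block :: "nat \<Rightarrow> nat \<Rightarrow> (nat \<Rightarrow> 'x source) \<Rightarrow> nat \<Rightarrow> bit" where
  "V_block n i s = polar n (U_block n i s)"

text \<open>
  The conditional laws of \<open>(V\<^sup>i)\<^sup>k\<close> given \<open>(V\<^sup>i)\<^sup>1\<^sup>:\<^sup>k\<^sup>-\<^sup>1\<close>, given in addition the blocks of
  \<open>U\<^sup>1, \<dots>, U\<^sup>i\<^sup>-\<^sup>1\<close>, and given in addition the block of \<open>X\<^sup>j\<close>.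
\<close>
definition P_V :: "nat \<Rightarrow> 'x source pmf \<Rightarrow> nat \<Rightarrow> nat \<Rightarrow>
    ((nat \<Rightarrow> bit) \<Rightarrow> bit pmf) \<Rightarrow> (nat \<Rightarrow> bit) \<Rightarrow> bit pmf" where
  "P_V n Q i k = cond_law (map_pmf (\<lambda>s.
     (V_block n i s k, restrict (V_block n i s) {..<k})) (iid n Q))"

definition P_VU :: "nat \<Rightarrow> 'x source pmf \<Rightarrow> nat \<Rightarrow> nat \<Rightarrow>
    ((nat \<Rightarrow> bit) \<times> (nat \<Rightarrow> nat \<Rightarrow> bit) \<Rightarrow> bit pmf) \<Rightarrow>
    (nat \<Rightarrow> bit) \<times> (nat \<Rightarrow> nat \<Rightarrow> bit) \<Rightarrow> bit pmf" where
  "P_VU n Q i k = cond_law (map_pmf (\<lambda>s.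
     (V_block n i s k, restrict (V_block n i s) {..<k}, tuple {1..<i} (U_block n) s)) (iid n Q))"

definition P_VXU :: "nat \<Rightarrow> 'x source pmf \<Rightarrow> nat \<Rightarrow> nat \<Rightarrow> nat \<Rightarrow>
    ((nat \<Rightarrow> bit) \<times> (nat \<Rightarrow> 'x) \<times> (nat \<Rightarrow> nat \<Rightarrow> bit) \<Rightarrow> bit pmf) \<Rightarrow>
    (nat \<Rightarrow> bit) \<times> (nat \<Rightarrow> 'x) \<times> (nat \<Rightarrow> nat \<Rightarrow> bit) \<Rightarrow> bit pmf" where
  "P_VXU n Q j i k = cond_law (map_pmf (\<lambda>s.
     (V_block n i s k, restrict (V_block n i s) {..<k}, X_block n j s,
      tuple {1..<i} (U_block n) s)) (iid n Q))"


section \<open>Protocol\<close>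

definition broadcaster :: "nat \<Rightarrow> nat \<Rightarrow> nat" where
  "broadcaster m i = (i - 1) mod m + 1"

text \<open>The sink is terminal \<open>0\<close>; the source terminals are \<open>1, \<dots>, m\<close>.\<close>
abbreviation (input) sink :: nat where
  "sink \<equiv> 0"

definition L_U :: "real \<Rightarrow> nat \<Rightarrow> 'x source pmf \<Rightarrow> nat \<Rightarrow> nat set" where
  "L_U \<beta> n Q i = low_set \<beta> n (map_pmf (\<lambda>(x, u). u i) Q)"

definition L_UU :: "real \<Rightarrow> nat \<Rightarrow> 'x source pmf \<Rightarrow> nat \<Rightarrow> nat set" where
  "L_UU \<beta> n Q i = low_cond_set \<beta> n (map_pmf (\<lambda>(x, u). (u i, restrict u {1..<i})) Q)"

definition H_UXU :: "real \<Rightarrow> nat \<Rightarrow> 'x source pmf \<Rightarrow> nat \<Rightarrow> nat \<Rightarrow> nat set" where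
  "H_UXU \<beta> n Q j i =
     high_cond_set \<beta> n (map_pmf (\<lambda>(x, u). (u i, (x j, restrict u {1..<i}))) Q)"

definition F_r :: "real \<Rightarrow> nat \<Rightarrow> nat \<Rightarrow> 'x source pmf \<Rightarrow> nat \<Rightarrow> nat set" where
  "F_r \<beta> n m Q i = ({..<2 ^ n} - L_U \<beta> n Q i) \<inter> H_UXU \<beta> n Q (broadcaster m i) i"

definition F_d :: "real \<Rightarrow> nat \<Rightarrow> 'x source pmf \<Rightarrow> nat \<Rightarrow> nat set" where
  "F_d \<beta> n Q i = L_U \<beta> n Q i"

definition I_set :: "real \<Rightarrow> nat \<Rightarrow> nat \<Rightarrow> 'x source pmf \<Rightarrow> nat \<Rightarrow> nat set" where
  "I_set \<beta> n m Q i =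
     ({..<2 ^ n} - L_U \<beta> n Q i) \<inter> ({..<2 ^ n} - H_UXU \<beta> n Q (broadcaster m i) i)"

definition I'_set :: "real \<Rightarrow> nat \<Rightarrow> nat \<Rightarrow> 'x source pmf \<Rightarrow> nat \<Rightarrow> nat set" where
  "I'_set \<beta> n m Q i =
     I_set \<beta> n m Q i - (({..<2 ^ n} - L_U \<beta> n Q i) \<inter> L_UU \<beta> n Q i)"

definition broadcast_rate :: "real \<Rightarrow> nat \<Rightarrow> nat \<Rightarrow> 'x source pmf \<Rightarrow> nat \<Rightarrow> real" where
  "broadcast_rate \<beta> n m Q i = real (card (I'_set \<beta> n m Q i)) / 2 ^ n"

text \<open>
  Successive generation of the bits \<open>0, \<dots>, K - 1\<close>, where bit \<open>k\<close> is drawn from \<open>\<kappa> k\<close> applied to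
  the bits before it. After \<open>k\<close> steps the result is extensional on \<open>{..<k}\<close>, so it is of the form
  \<open>restrict v {..<k}\<close> on which the conditional laws above expect their argument.
\<close>
primrec generate :: "(nat \<Rightarrow> (nat \<Rightarrow> bit) \<Rightarrow> bit pmf) \<Rightarrow> nat \<Rightarrow> (nat \<Rightarrow> bit) pmf" where
  "generate \<kappa> 0 = return_pmf (\<lambda>_. undefined)"
| "generate \<kappa> (Suc k) = do {
     v \<leftarrow> generate \<kappa> k;
     b \<leftarrow> \<kappa> k v;
     return_pmf (v(k := b))
   }"

text \<open>
  The choices of conditional laws at events of probability \<open>0\<close>, which may depend on the block
  length exponent \<open>n\<close>, the round \<open>i\<close> and the position \<open>k\<close>.
\<close>
record 'x null_choice =
  null_V :: "nat \<Rightarrow> nat \<Rightarrow> nat \<Rightarrow> (nat \<Rightarrow> bit) \<Rightarrow> bit pmf"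
  null_VU :: "nat \<Rightarrow> nat \<Rightarrow> nat \<Rightarrow> (nat \<Rightarrow> bit) \<times> (nat \<Rightarrow> nat \<Rightarrow> bit) \<Rightarrow> bit pmf"
  null_VXU :: "nat \<Rightarrow> nat \<Rightarrow> nat \<Rightarrow>
    (nat \<Rightarrow> bit) \<times> (nat \<Rightarrow> 'x) \<times> (nat \<Rightarrow> nat \<Rightarrow> bit) \<Rightarrow> bit pmf"

text \<open>
  In \<open>broadcaster_step\<close> and \<open>receiver_step\<close>, \<open>u\<close> is the acting terminal's own version of the
  sequences of the earlier rounds and \<open>v\<close> its own version of the earlier bits of this round.
\<close>
definition broadcaster_step :: "real \<Rightarrow> nat \<Rightarrow> nat \<Rightarrow> 'x source pmf \<Rightarrow> 'x null_choice \<Rightarrow> nat \<Rightarrow>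
    (nat \<Rightarrow> 'x) \<Rightarrow> (nat \<Rightarrow> nat \<Rightarrow> bit) \<Rightarrow> nat \<Rightarrow> (nat \<Rightarrow> bit) \<Rightarrow> bit pmf" where
  "broadcaster_step \<beta> n m Q d i x u k v =
     (if k \<in> F_r \<beta> n m Q i then pmf_of_set {0, 1}
      else if k \<in> F_d \<beta> n Q i then P_V n Q i k (null_V d n i k) v
      else P_VXU n Q (broadcaster m i) i k (null_VXU d n i k) (v, x, restrict u {1..<i}))"

text \<open>
  Here \<open>w\<close> is the broadcaster's sequence; a receiver only uses its bits at the broadcast positions
  and the shared uniform bits.
\<close>
definition receiver_step :: "real \<Rightarrow> nat \<Rightarrow> nat \<Rightarrow> 'x source pmf \<Rightarrow> 'x null_choice \<Rightarrow> nat \<Rightarrow>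
    (nat \<Rightarrow> bit) \<Rightarrow> (nat \<Rightarrow> nat \<Rightarrow> bit) \<Rightarrow> nat \<Rightarrow> (nat \<Rightarrow> bit) \<Rightarrow> bit pmf" where
  "receiver_step \<beta> n m Q d i w u k v =
     (if k \<in> I'_set \<beta> n m Q i \<or> k \<in> F_r \<beta> n m Q i then return_pmf (w k)
      else if k \<in> F_d \<beta> n Q i then P_V n Q i k (null_V d n i k) v
      else P_VU n Q i k (null_VU d n i k) (v, restrict u {1..<i}))"

text \<open>
  A state assigns to every terminal \<open>a\<close> and every past round \<open>l\<close> the version \<open>st a l\<close> of the
  sequence \<open>u\<^sup>l\<close> held by \<open>a\<close>. In \<open>play_round\<close>, \<open>x k j\<close> is the symbol \<open>X\<^sup>j(k)\<close>.
\<close>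
type_synonym state = "nat \<Rightarrow> nat \<Rightarrow> nat \<Rightarrow> bit"

definition play_round :: "real \<Rightarrow> nat \<Rightarrow> nat \<Rightarrow> 'x source pmf \<Rightarrow> 'x null_choice \<Rightarrow>
    (nat \<Rightarrow> nat \<Rightarrow> 'x) \<Rightarrow> nat \<Rightarrow> state \<Rightarrow> state pmf" where
  "play_round \<beta> n m Q d x i st = (let j = broadcaster m i in do {
     w \<leftarrow> generate (broadcaster_step \<beta> n m Q d i (\<lambda>k\<in>{..<2 ^ n}. x k j) (st j)) (2 ^ n);
     v \<leftarrow> Pi_pmf {sink..m} undefined (\<lambda>a.
       if a = j then return_pmf w
       else generate (receiver_step \<beta> n m Q d i w (st a)) (2 ^ n));
     return_pmf (\<lambda>a. (st a)(i := polar n (v a)))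
   })"

primrec play :: "real \<Rightarrow> nat \<Rightarrow> nat \<Rightarrow> 'x source pmf \<Rightarrow> 'x null_choice \<Rightarrow>
    (nat \<Rightarrow> nat \<Rightarrow> 'x) \<Rightarrow> nat \<Rightarrow> state pmf" where
  "play \<beta> n m Q d x 0 = return_pmf (\<lambda>_ _. undefined)"
| "play \<beta> n m Q d x (Suc i) = play \<beta> n m Q d x i \<bind> play_round \<beta> n m Q d x (Suc i)"

text \<open>The joint law of the observed sources and of the sequences formed in \<open>t\<close> rounds.\<close>
definition protocol :: "real \<Rightarrow> nat \<Rightarrow> nat \<Rightarrow> nat \<Rightarrow> 'x source pmf \<Rightarrow> 'x null_choice \<Rightarrow>
    ((nat \<Rightarrow> nat \<Rightarrow> 'x) \<times> state) pmf" where
  "protocol \<beta> n m t Q d = do {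
     x \<leftarrow> iid n (map_pmf fst Q);
     st \<leftarrow> play \<beta> n m Q d x t;
     return_pmf (x, st)
   }"

end

theory Submission
  imports Defs "HOL-Real_Asymp.Real_Asymp"
begin

text \<open>
  Polarization: in the tree of polarized laws, \<open>Z\<close> becomes \<open>Z\<^sup>2\<close> at one child and at most
  \<open>2 Z - Z\<^sup>2\<close> at the other, so the mean of \<open>sqrt Z\<close> over a level strictly decreases as long as a
  positive fraction of the nodes is not polarized; the conserved mean of the conditional entropies
  identifies the two limiting fractions. The total variation \<open>T\<close> between the two hypotheses obeys
  the same kind of recursion with the children exchanged, and \<open>1 - Z \<le> T\<close>, so that one statement on
  the speed of polarization serves both ends.

  Protocol: the law of sources and sequences is compared with the ideal one in total variation. The
  bits that the broadcaster draws from a wrong law cost at most \<open>sqrt (2 \<delta>\<^sub>N) + \<delta>\<^sub>N\<close> each, and a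
  receiver's own sample differs from the ideal bit with probability at most \<open>\<delta>\<^sub>N\<close>. Summed over all
  positions, terminals and rounds this vanishes, and under the ideal law \<open>U\<^sup>1\<^sup>:\<^sup>t\<close> determines the
  function value.
\<close>

section \<open>Fast polarization\<close>

text \<open>Why \<open>1 - Z\<close> itself is not iterated: at the child where \<open>Z\<close>
  grows, the bound \<open>2 Z - Z^2\<close> only says that \<open>1 - Z\<close> is at least its own
  square, the wrong direction. \<open>T\<close> squares exactly there and is tied to
  \<open>Z\<close> by \<open>1 - Z \<le> T \<le> sqrt (2 (1 - Z))\<close>. The condition
  \<open>\<beta> < 1 / 2\<close> comes from path statistics: a typical path of \<open>r\<close>
  steps squares about \<open>r / 2\<close> times, and at least \<open>\<beta> * (n + r)\<close>
  squarings are wanted. In the protocol each terminal samples from laws conditioned on what it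
  knows, whereas the sequences must come out jointly distributed with all the sources. The Markov
  hypothesis closes this gap: given the past, the ideal bit has the same law whether one conditions
  on every source or only on that of the broadcaster. Errors of one terminal could also spoil all
  later rounds. To avoid tracking them, each round is analysed as if started from the ideal state,
  in which all terminals hold the same sequences; the errors of the rounds then add up as in a
  hybrid argument.\<close>

lemma sum_pairs_lessThan:
  fixes f :: "nat \<Rightarrow> real"
  shows "(\<Sum>j<2 * n. f j) = (\<Sum>j<n. f (2 * j) + f (2 * j + 1))"
  by (induction n) (simp_all add: algebra_simps)

lemma sum_pow2_Suc:
  fixes f :: "nat \<Rightarrow> real"
  shows "(\<Sum>j<2 ^ Suc n. f j) = (\<Sum>j<2 ^ n. f (2 * j) + f (2 * j + 1))"
  using sum_pairs_lessThan[of f "2 ^ n"] by simp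

lemma card_Markov_inequality:
  fixes f :: "'a \<Rightarrow> real"
  assumes "finite A" "\<And>x. x \<in> A \<Longrightarrow> f x \<ge> 0"
  shows "real (card {x \<in> A. f x \<ge> t}) * t \<le> (\<Sum>x\<in>A. f x)"
proof -
  have "real (card {x \<in> A. f x \<ge> t}) * t = (\<Sum>x\<in>{x \<in> A. f x \<ge> t}. t)" by simp
  also have "\<dots> \<le> (\<Sum>x\<in>{x \<in> A. f x \<ge> t}. f x)" by (rule sum_mono) auto
  also have "\<dots> \<le> (\<Sum>x\<in>A. f x)" by (rule sum_mono2) (use assms in auto)
  finally show ?thesis .
qed

text \<open>
  Along the path that the \<open>r\<close> binary digits of \<open>j\<close> describe in the polarization tree, a step to a
  child of parity \<open>c\<close> squares the parameter and a step to the other child at most doubles it. Hence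
  \<open>2 powr (-a)\<close> becomes at most \<open>2 powr (-(2 ^ D * (a - S)))\<close>, where \<open>D = squarings c r j\<close> and
  \<open>S = penalty c r j\<close>.
\<close>
primrec squarings :: "nat \<Rightarrow> nat \<Rightarrow> nat \<Rightarrow> nat" where
  "squarings c 0 j = 0"
| "squarings c (Suc r) j = squarings c r (j div 2) + (if j mod 2 = c then 1 else 0)"

primrec penalty :: "nat \<Rightarrow> nat \<Rightarrow> nat \<Rightarrow> real" where
  "penalty c 0 j = 0"
| "penalty c (Suc r) j =
     penalty c r (j div 2) + (if j mod 2 = c then 0 else 1 / 2 ^ squarings c r (j div 2))"

lemma penalty_nonneg: "penalty c r j \<ge> 0"
  by (induction r arbitrary: j) auto

text \<open>The digits of \<open>j\<close> are read from the most significant one, so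
  \<open>div 2\<close> peels off the last step of the path. A doubling lowers the exponent
  \<open>2 ^ D * (a - S)\<close> by 1; inside the bracket this is the \<open>1 / 2 ^ D\<close>
  charged by \<open>penalty\<close>, which later squarings scale along with
  \<open>a\<close>.\<close>

lemma squaring_path_bound:
  fixes x :: "nat \<Rightarrow> nat \<Rightarrow> real"
  assumes nonneg: "\<And>n k. x n k \<ge> 0"
    and square: "\<And>n k. k < 2 ^ Suc n \<Longrightarrow> k mod 2 = c \<Longrightarrow> x (Suc n) k \<le> (x n (k div 2))\<^sup>2"
    and double: "\<And>n k. k < 2 ^ Suc n \<Longrightarrow> k mod 2 \<noteq> c \<Longrightarrow> x (Suc n) k \<le> 2 * x n (k div 2)"
    and start: "x n k \<le> 2 powr (-a)" and k: "k < 2 ^ n"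
  shows "j < 2 ^ r \<Longrightarrow>
    x (n + r) (k * 2 ^ r + j) \<le> 2 powr (-(2 ^ squarings c r j * (a - penalty c r j)))"
proof (induction r arbitrary: j)
  case 0
  then show ?case using start by simp
next
  case (Suc r)
  let ?k = "k * 2 ^ Suc r + j"
  let ?D = "squarings c r (j div 2)" and ?S = "penalty c r (j div 2)"
  have div: "?k div 2 = k * 2 ^ r + j div 2" and mod: "?k mod 2 = j mod 2"
    by (simp_all add: div_add1_eq mod_add_eq)
       (auto simp: mult.left_commute mult.assoc[symmetric] intro: mod_add_left_eq[THEN sym, THEN trans])
  have "k + 1 \<le> 2 ^ n" using k by simp
  then have "(k + 1) * 2 ^ Suc r \<le> 2 ^ n * 2 ^ Suc r" by (rule mult_right_mono) simp
  then have bound: "?k < 2 ^ Suc (n + r)" using Suc.prems by (simp add: algebra_simps power_add)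
  have IH: "x (n + r) (?k div 2) \<le> 2 powr (-(2 ^ ?D * (a - ?S)))"
    unfolding div by (rule Suc.IH) (use Suc.prems in auto)
  show ?case
  proof (cases "j mod 2 = c")
    case True
    then have "x (Suc (n + r)) ?k \<le> (x (n + r) (?k div 2))\<^sup>2"
      by (intro square bound) (simp only: mod)
    also have "\<dots> \<le> (2 powr (-(2 ^ ?D * (a - ?S))))\<^sup>2"
      by (intro power_mono IH nonneg)
    also have "\<dots> = 2 powr (-(2 ^ squarings c (Suc r) j * (a - penalty c (Suc r) j)))"
      using True by (simp add: power2_eq_square powr_add[symmetric] mult_ac)
    finally show ?thesis by simp
  next
    case False
    then have "x (Suc (n + r)) ?k \<le> 2 * x (n + r) (?k div 2)"
      by (intro double bound) (simp only: mod, simp)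
    also have "\<dots> \<le> 2 powr 1 * 2 powr (-(2 ^ ?D * (a - ?S)))"
      using IH by simp
    also have "\<dots> = 2 powr (-(2 ^ squarings c (Suc r) j * (a - penalty c (Suc r) j)))"
      using False by (simp only: powr_add[symmetric]) (simp add: algebra_simps)
    finally show ?thesis by simp
  qed
qed

section \<open>Statistics of the digits along a path\<close>

lemma sum_squarings:
  assumes "c < 2"
  shows "(\<Sum>j<2 ^ r. 1 / 2 ^ squarings c r j) = (3 / 2 :: real) ^ r"
proof (induction r)
  case (Suc r)
  have "(\<Sum>j<2 ^ Suc r. 1 / 2 ^ squarings c (Suc r) j :: real) =
      (\<Sum>j<2 ^ r. 3 / 2 * (1 / 2 ^ squarings c r j))"
    unfolding sum_pow2_Suc by (rule sum.cong) (use assms in \<open>auto simp: less_2_cases_iff\<close>)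
  then show ?case using Suc.IH by (simp only: sum_distrib_left[symmetric]) simp
qed simp

text \<open>The mean penalty stays below 2 however long the path is: the doublings charged late are
  almost always preceded by many squarings. Markov's inequality can therefore be applied uniformly
  in \<open>r\<close>.\<close>

lemma sum_penalty:
  assumes "c < 2"
  shows "(\<Sum>j<2 ^ r. penalty c r j) = 2 * (2 ^ r - (3 / 2) ^ r)"
proof (induction r)
  case (Suc r)
  have "(\<Sum>j<2 ^ Suc r. penalty c (Suc r) j) =
      (\<Sum>j<2 ^ r. 2 * penalty c r j + 1 / 2 ^ squarings c r j)"
    unfolding sum_pow2_Suc by (rule sum.cong) (use assms in \<open>auto simp: less_2_cases_iff\<close>)
  also have "\<dots> = 2 * (\<Sum>j<2 ^ r. penalty c r j) + (3 / 2) ^ r"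
    by (simp only: sum.distrib sum_distrib_left[symmetric] sum_squarings[OF assms])
  finally show ?case using Suc.IH by simp
qed simp

text \<open>The variance of a sum of \<open>r\<close> independent signs, in the form that
  Chebyshev's inequality uses.\<close>

lemma sum_squarings_deviation:
  assumes "c < 2"
  shows "(\<Sum>j<2 ^ r. (2 * real (squarings c r j) - r)\<^sup>2) = r * 2 ^ r"
proof (induction r)
  case (Suc r)
  have "(\<Sum>j<2 ^ Suc r. (2 * real (squarings c (Suc r) j) - Suc r)\<^sup>2) =
      (\<Sum>j<2 ^ r. 2 * (2 * real (squarings c r j) - r)\<^sup>2 + 2)"
    unfolding sum_pow2_Suc
    by (rule sum.cong) (use assms in \<open>auto simp: less_2_cases_iff power2_eq_square algebra_simps\<close>)
  also have "\<dots> = 2 * (\<Sum>j<2 ^ r. (2 * real (squarings c r j) - r)\<^sup>2) + 2 * 2 ^ r"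
    by (simp add: sum.distrib sum_distrib_left)
  finally show ?case using Suc.IH by (simp add: algebra_simps)
qed simp

text \<open>More than half of \<open>a\<close>, hence at least 1, survives the penalty, so the
  exponent is at least \<open>2 ^ D \<ge> 2 powr (\<beta> * n) = N powr \<beta>\<close>.\<close>

lemma \<delta>_squarings_bound:
  assumes "S < a / 2" "2 \<le> a" "\<beta> * n \<le> real D"
  shows "2 powr (-(2 ^ D * (a - S))) \<le> \<delta> \<beta> n"
proof -
  have "(2 ^ n) powr \<beta> = (2::real) powr (\<beta> * n)"
    by (simp add: powr_powr powr_realpow[symmetric] mult.commute)
  also have "\<dots> \<le> 2 powr real D" using assms(3) by simp
  also have "\<dots> = 2 ^ D" by (simp add: powr_realpow)
  also have "\<dots> = 2 ^ D * 1" by simp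
  also have "\<dots> \<le> 2 ^ D * (a - S)" by (rule mult_left_mono) (use assms in auto)
  finally show ?thesis by (simp add: \<delta>_def)
qed

section \<open>Fractions of the indices on one level of the tree\<close>

definition fraction :: "nat \<Rightarrow> (nat \<Rightarrow> bool) \<Rightarrow> real" where
  "fraction n P = card {k \<in> {..<2 ^ n}. P k} / 2 ^ n"

lemma fraction_nonneg: "fraction n P \<ge> 0"
  by (simp add: fraction_def)

lemma fraction_mono:
  assumes "\<And>k. k < 2 ^ n \<Longrightarrow> P k \<Longrightarrow> P' k"
  shows "fraction n P \<le> fraction n P'"
  unfolding fraction_def using assms by (intro divide_right_mono of_nat_mono card_mono) auto

lemma fraction_disjoint_add:
  assumes "\<And>k. k < 2 ^ n \<Longrightarrow> P k \<Longrightarrow> P' k \<Longrightarrow> False"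
  shows "fraction n P + fraction n P' = fraction n (\<lambda>k. P k \<or> P' k)"
proof -
  have "card ({k \<in> {..<2 ^ n}. P k} \<union> {k \<in> {..<2 ^ n}. P' k}) =
      card {k \<in> {..<2 ^ n}. P k} + card {k \<in> {..<2 ^ n}. P' k}"
    by (rule card_Un_disjoint) (use assms in auto)
  moreover have "{k \<in> {..<2 ^ n}. P k} \<union> {k \<in> {..<2 ^ n}. P' k} = {k \<in> {..<2 ^ n}. P k \<or> P' k}"
    by auto
  ultimately show ?thesis by (simp add: fraction_def add_divide_distrib)
qed

lemma fraction_True: "fraction n (\<lambda>_. True) = 1"
  by (simp add: fraction_def)

lemma fraction_le_1: "fraction n P \<le> 1"
  using fraction_mono[of n P "\<lambda>_. True"] by (simp add: fraction_True)

lemma fraction_not: "fraction n (\<lambda>k. \<not> P k) = 1 - fraction n P"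
  using fraction_disjoint_add[of n P "\<lambda>k. \<not> P k"] by (simp add: fraction_True)

text \<open>A node that is small at level \<open>n\<close> has few bad descendants \<open>r\<close>
  levels below: penalty at least \<open>a / 2\<close> has frequency at most \<open>4 / a\<close> by
  Markov's inequality. Fewer than \<open>\<beta> * (n + r)\<close> squarings means that
  \<open>2 * D - r\<close> deviates by more than the gap \<open>r - 2 * \<beta> * (n + r)\<close>,
  to which Chebyshev's inequality applies.\<close>

lemma fast_polarization_step:
  fixes x :: "nat \<Rightarrow> nat \<Rightarrow> real"
  assumes nonneg: "\<And>n k. x n k \<ge> 0"
    and c: "c < 2"
    and square: "\<And>n k. k < 2 ^ Suc n \<Longrightarrow> k mod 2 = c \<Longrightarrow> x (Suc n) k \<le> (x n (k div 2))\<^sup>2"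
    and double: "\<And>n k. k < 2 ^ Suc n \<Longrightarrow> k mod 2 \<noteq> c \<Longrightarrow> x (Suc n) k \<le> 2 * x n (k div 2)"
    and a: "a \<ge> 2" and gap: "real r - 2 * \<beta> * (n + r) > 0"
  shows "fraction (n + r) (\<lambda>k. x (n + r) k \<le> \<delta> \<beta> (n + r)) \<ge>
    fraction n (\<lambda>k. x n k \<le> 2 powr (-a)) - 4 / a - r / (real r - 2 * \<beta> * (n + r))\<^sup>2"
proof -
  let ?g = "real r - 2 * \<beta> * (n + r)"
  define A where "A = {k \<in> {..<2 ^ n}. x n k \<le> 2 powr (-a)}"
  define J where "J = {j \<in> {..<2 ^ r}. penalty c r j < a / 2 \<and> \<beta> * (n + r) \<le> squarings c r j}"
  define J1 where "J1 = {j \<in> {..<2 ^ r}. penalty c r j \<ge> a / 2}"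
  define J2 where "J2 = {j \<in> {..<2 ^ r}. (2 * real (squarings c r j) - r)\<^sup>2 \<ge> ?g\<^sup>2}"
  have "real (card J1) * (a / 2) \<le> 2 * (2 ^ r - (3 / 2) ^ r)"
    unfolding J1_def sum_penalty[OF c, symmetric]
    by (rule card_Markov_inequality) (auto simp: penalty_nonneg)
  also have "\<dots> \<le> 2 * 2 ^ r" by simp
  finally have J1: "real (card J1) \<le> 4 / a * 2 ^ r" using a by (simp add: field_simps)
  have "real (card J2) * ?g\<^sup>2 \<le> r * 2 ^ r"
    unfolding J2_def sum_squarings_deviation[OF c, symmetric]
    by (rule card_Markov_inequality) auto
  then have J2: "real (card J2) \<le> r / ?g\<^sup>2 * 2 ^ r" using gap by (simp add: field_simps)
  have "{..<2 ^ r} \<subseteq> J \<union> J1 \<union> J2"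
  proof
    fix j :: nat assume j: "j \<in> {..<2 ^ r}"
    have "?g\<^sup>2 \<le> (2 * real (squarings c r j) - r)\<^sup>2" if "\<not> \<beta> * (n + r) \<le> squarings c r j"
    proof -
      have "?g \<le> r - 2 * real (squarings c r j)" using that by simp
      then have "?g\<^sup>2 \<le> (r - 2 * real (squarings c r j))\<^sup>2" using gap by (intro power_mono) auto
      then show ?thesis by (simp add: power2_commute)
    qed
    with j show "j \<in> J \<union> J1 \<union> J2" by (auto simp: J_def J1_def J2_def)
  qed
  then have "2 ^ r \<le> card (J \<union> J1 \<union> J2)"
    using card_mono[of "J \<union> J1 \<union> J2" "{..<2 ^ r}"] by (simp add: J_def J1_def J2_def)
  also have "\<dots> \<le> card J + card J1 + card J2"
    by (meson add_le_mono1 card_Un_le order_trans)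
  finally have "real (2 ^ r) \<le> real (card J + card J1 + card J2)" by (simp only: of_nat_le_iff)
  then have J: "real (card J) / 2 ^ r \<ge> 1 - 4 / a - r / ?g\<^sup>2"
    using J1 J2 by (simp add: field_simps)
  let ?h = "\<lambda>(k, j). k * 2 ^ r + j :: nat"
  let ?B = "{k \<in> {..<2 ^ (n + r)}. x (n + r) k \<le> \<delta> \<beta> (n + r)}"
  \<comment> \<open>Distinct pairs of a small ancestor and a good path lead to distinct descendants,
    so the two fractions multiply.\<close>
  have "inj_on ?h (A \<times> J)"
  proof (rule inj_onI, clarify)
    fix k j k' j' assume "j \<in> J" "j' \<in> J" and eq: "k * 2 ^ r + j = k' * 2 ^ r + j'"
    then have lt: "j < 2 ^ r" "j' < 2 ^ r" by (auto simp: J_def)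
    have "k = (k * 2 ^ r + j) div 2 ^ r" "k' = (k' * 2 ^ r + j') div 2 ^ r" using lt by simp_all
    then have "k = k'" using eq by simp
    with eq show "k = k' \<and> j = j'" by simp
  qed
  then have "card A * card J = card (?h ` (A \<times> J))"
    by (simp add: card_image card_cartesian_product)
  also have "\<dots> \<le> card ?B"
  proof (rule card_mono, simp, clarify)
    fix k j assume k: "k \<in> A" and j: "j \<in> J"
    have "k + 1 \<le> 2 ^ n" using k by (simp add: A_def)
    then have "(k + 1) * 2 ^ r \<le> 2 ^ n * 2 ^ r" by (rule mult_right_mono) simp
    then have "k * 2 ^ r + j < 2 ^ (n + r)" using j by (simp add: J_def algebra_simps power_add)
    moreover have "x (n + r) (k * 2 ^ r + j) \<le>
        2 powr (-(2 ^ squarings c r j * (a - penalty c r j)))"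
      by (rule squaring_path_bound[where x = x, OF nonneg square double])
         (use k j in \<open>auto simp: A_def J_def\<close>)
    moreover have "\<dots> \<le> \<delta> \<beta> (n + r)"
      by (rule \<delta>_squarings_bound) (use j a in \<open>auto simp: J_def\<close>)
    ultimately show "k * 2 ^ r + j \<in> {..<2 ^ (n + r)} \<and>
        x (n + r) (k * 2 ^ r + j) \<le> \<delta> \<beta> (n + r)" by simp
  qed
  finally have "real (card A * card J) \<le> real (card ?B)" by (simp only: of_nat_le_iff)
  then have "fraction n (\<lambda>k. x n k \<le> 2 powr (-a)) * (real (card J) / 2 ^ r) \<le>
      fraction (n + r) (\<lambda>k. x (n + r) k \<le> \<delta> \<beta> (n + r))"
    unfolding fraction_def A_def[symmetric] by (simp add: power_add divide_right_mono)
  moreover have "fraction n (\<lambda>k. x n k \<le> 2 powr (-a)) * (real (card J) / 2 ^ r) \<ge>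
      fraction n (\<lambda>k. x n k \<le> 2 powr (-a)) * (1 - 4 / a - r / ?g\<^sup>2)"
    by (rule mult_left_mono[OF J fraction_nonneg])
  moreover have "fraction n (\<lambda>k. x n k \<le> 2 powr (-a)) * (4 / a + r / ?g\<^sup>2) \<le> 1 * (4 / a + r / ?g\<^sup>2)"
    by (rule mult_right_mono[OF fraction_le_1]) (use a in auto)
  ultimately show ?thesis by (simp add: algebra_simps)
qed

text \<open>The starting level \<open>n\<close> is chosen once from slow polarization and only the
  number \<open>r\<close> of further steps grows. Since \<open>\<beta> < 1 / 2\<close>, the gap is
  then eventually linear in \<open>r\<close>.\<close>

theorem fast_polarization:
  fixes x :: "nat \<Rightarrow> nat \<Rightarrow> real"
  assumes nonneg: "\<And>n k. x n k \<ge> 0"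
    and c: "c < 2"
    and square: "\<And>n k. k < 2 ^ Suc n \<Longrightarrow> k mod 2 = c \<Longrightarrow> x (Suc n) k \<le> (x n (k div 2))\<^sup>2"
    and double: "\<And>n k. k < 2 ^ Suc n \<Longrightarrow> k mod 2 \<noteq> c \<Longrightarrow> x (Suc n) k \<le> 2 * x n (k div 2)"
    and \<beta>: "0 < \<beta>" "\<beta> < 1 / 2"
    and slow: "\<And>\<epsilon> \<eta>. \<epsilon> > 0 \<Longrightarrow> \<eta> > 0 \<Longrightarrow>
      eventually (\<lambda>n. fraction n (\<lambda>k. x n k \<le> \<epsilon>) \<ge> L - \<eta>) sequentially"
    and \<eta>: "\<eta> > 0"
  shows "eventually (\<lambda>n. fraction n (\<lambda>k. x n k \<le> \<delta> \<beta> n) \<ge> L - \<eta>) sequentially"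
proof -
  \<comment> \<open>This makes \<open>4 / a \<le> \<eta> / 3\<close>, one of three losses of that
    size: the others are that of slow polarization at level \<open>n\<close> and the Chebyshev
    term.\<close>
  define a where "a = max 2 (12 / \<eta>)"
  have a: "a \<ge> 2" "4 / a \<le> \<eta> / 3" using \<eta> by (auto simp: a_def field_simps max_def)
  obtain n where n: "fraction n (\<lambda>k. x n k \<le> 2 powr (-a)) \<ge> L - \<eta> / 3"
    using slow[of "2 powr (-a)" "\<eta> / 3"] \<eta> by (auto simp: eventually_sequentially)
  define \<kappa> where "\<kappa> = 1 - 2 * \<beta>"
  have \<kappa>: "\<kappa> > 0" using \<beta> by (simp add: \<kappa>_def)
  \<comment> \<open>The first bound makes the gap at least \<open>\<kappa> * r / 2\<close>; the
    second then brings the Chebyshev term \<open>4 / (\<kappa>^2 * r)\<close> below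
    \<open>\<eta> / 3\<close>.\<close>
  obtain R :: nat where R: "real R > max (4 * \<beta> * n / \<kappa>) (12 / (\<kappa>\<^sup>2 * \<eta>))"
    using reals_Archimedean2 by blast
  have "fraction (n + r) (\<lambda>k. x (n + r) k \<le> \<delta> \<beta> (n + r)) \<ge> L - \<eta>" if r: "r \<ge> R" for r
  proof -
    let ?g = "real r - 2 * \<beta> * (n + r)"
    have r1: "real r > 4 * \<beta> * n / \<kappa>" "real r > 12 / (\<kappa>\<^sup>2 * \<eta>)" using R r by auto
    have r0: "real r > 0" by (rule le_less_trans[OF _ r1(2)]) (use \<eta> in simp)
    have "\<kappa> * r > 4 * \<beta> * n" using r1(1) \<kappa> by (simp add: field_simps)
    moreover have "?g = \<kappa> * r - 2 * \<beta> * n" by (simp add: \<kappa>_def algebra_simps)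
    ultimately have g: "?g \<ge> \<kappa> * r / 2" by simp
    have g0: "\<kappa> * r / 2 > 0" using \<kappa> r0 by simp
    have "r / ?g\<^sup>2 \<le> r / (\<kappa> * r / 2)\<^sup>2"
      using g g0 by (intro divide_left_mono power_mono mult_pos_pos zero_less_power) auto
    also have "\<dots> = 4 / (\<kappa>\<^sup>2 * r)" using r0 \<kappa> by (simp add: power2_eq_square field_simps)
    also have "\<dots> \<le> \<eta> / 3" using r1(2) r0 \<kappa> \<eta> by (simp add: field_simps)
    finally have "r / ?g\<^sup>2 \<le> \<eta> / 3" .
    moreover have "?g > 0" using g g0 by linarith
    ultimately show ?thesis
      using fast_polarization_step[where x = x and n = n and r = r and a = a and \<beta> = \<beta>,
          OF nonneg c square double a(1)] n a(2) by fastforce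
  qed
  then have "fraction n' (\<lambda>k. x n' k \<le> \<delta> \<beta> n') \<ge> L - \<eta>" if "n' \<ge> n + R" for n'
    using that by (metis add_leD1 le_add_diff_inverse nat_add_left_cancel_le)
  then show ?thesis unfolding eventually_sequentially by blast
qed

section \<open>Functionals of a joint law of a bit and an observation\<close>

text \<open>These two rules turn sums of bits into \<^const>\<open>of_bool\<close> of Boolean combinations.\<close>
declare add_bit_eq_xor [simp del] mult_bit_eq_and [simp del]

lemma UNIV_bit: "(UNIV :: bit set) = {0, 1}"
  by (rule UNIV_eq_I) (metis bit.exhaust insertCI)

instance bit :: finite
  by standard (simp add: UNIV_bit)

lemma bit_add_cancel [simp]: "(a::bit) + b + b = a" "b + (b + a) = a" "b + (a + b) = a"
  by (cases a; cases b; simp)+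

text \<open>
  \<open>Z\<close>, the mean of \<open>\<bar>P\<^bsub>T|V\<^esub>(0|v) - P\<^bsub>T|V\<^esub>(1|v)\<bar>\<close> and \<open>H(T|V)\<close> are all of this form with a function
  \<open>\<phi>\<close> that is positively homogeneous of degree 1.
\<close>
definition obs_sum :: "(real \<Rightarrow> real \<Rightarrow> real) \<Rightarrow> (bit \<times> 'v) pmf \<Rightarrow> real" where
  "obs_sum \<phi> R = (\<Sum>v\<in>snd ` set_pmf R. \<phi> (pmf R (0, v)) (pmf R (1, v)))"

lemma obs_sum_superset:
  assumes "finite V" "snd ` set_pmf R \<subseteq> V" "\<phi> 0 0 = 0"
  shows "obs_sum \<phi> R = (\<Sum>v\<in>V. \<phi> (pmf R (0, v)) (pmf R (1, v)))"
  unfolding obs_sum_def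
proof (rule sum.mono_neutral_left[OF assms(1,2)], rule ballI)
  fix v assume "v \<in> V - snd ` set_pmf R"
  then have "(t, v) \<notin> set_pmf R" for t by force
  then show "\<phi> (pmf R (0, v)) (pmf R (1, v)) = 0" using assms(3) by (simp add: set_pmf_iff)
qed

text \<open>An observation matters only up to injective recoding on its support. This lets past bits
  and side information be rearranged freely, both in the polar recursion and in passing to the laws
  of the protocol.\<close>

lemma obs_sum_relabel:
  assumes inj: "inj_on f (snd ` set_pmf R)" and \<phi>: "\<phi> 0 0 = 0"
  shows "obs_sum \<phi> (map_pmf (\<lambda>(t, v). (t, f v)) R) = obs_sum \<phi> R"
proof -
  let ?g = "\<lambda>(t, v). (t, f v)"
  have injg: "inj_on ?g (set_pmf R)" using inj by (force simp: inj_on_def)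
  have pmf: "pmf (map_pmf ?g R) (t, f v) = pmf R (t, v)" if "v \<in> snd ` set_pmf R" for t v
  proof (cases "(t, v) \<in> set_pmf R")
    case True
    then show ?thesis using pmf_map_inj[OF injg True] by simp
  next
    case False
    have "(t, f v) \<notin> ?g ` set_pmf R"
    proof
      assume "(t, f v) \<in> ?g ` set_pmf R"
      then obtain v' where "(t, v') \<in> set_pmf R" "f v' = f v" by force
      with inj that have "(t, v) \<in> set_pmf R" by (metis imageI inj_onD snd_conv)
      with False show False by simp
    qed
    with False show ?thesis by (metis pmf_eq_0_set_pmf set_map_pmf)
  qed
  have "snd ` set_pmf (map_pmf ?g R) = f ` snd ` set_pmf R" by (force simp: image_image)
  then show ?thesis
    unfolding obs_sum_def by (simp add: sum.reindex[OF inj] pmf)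
qed

lemma pmf_snd_bit: "pmf (map_pmf snd R) v = pmf R (0, v) + pmf R (1::bit, v)"
proof -
  have "snd -` {v} = {(0::bit, v), (1, v)}" using UNIV_bit by auto
  then show ?thesis by (simp add: pmf_map measure_measure_pmf_finite)
qed

lemma obs_sum_mass:
  assumes "finite (set_pmf R)"
  shows "obs_sum (+) R = 1"
proof -
  have "obs_sum (+) R = (\<Sum>v\<in>set_pmf (map_pmf snd R). pmf (map_pmf snd R) v)"
    by (simp add: obs_sum_def pmf_snd_bit)
  also have "\<dots> = 1" by (rule sum_pmf_eq_1) (use assms in auto)
  finally show ?thesis .
qed

lemma obs_sum_mono:
  assumes "\<And>a b. a \<ge> 0 \<Longrightarrow> b \<ge> 0 \<Longrightarrow> \<phi> a b \<le> \<psi> a b"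
  shows "obs_sum \<phi> R \<le> obs_sum \<psi> R"
  unfolding obs_sum_def by (rule sum_mono) (simp add: assms)

lemma obs_sum_linear:
  "obs_sum (\<lambda>a b. x * \<phi> a b + y * \<psi> a b) R = x * obs_sum \<phi> R + y * obs_sum \<psi> R"
  by (simp add: obs_sum_def sum.distrib sum_distrib_left)

section \<open>The three functionals: Bhattacharyya parameter, total variation, entropy\<close>

definition Z_fun :: "real \<Rightarrow> real \<Rightarrow> real" where
  "Z_fun a b = 2 * sqrt (a * b)"

definition T_fun :: "real \<Rightarrow> real \<Rightarrow> real" where
  "T_fun a b = \<bar>a - b\<bar>"

definition \<eta>_fun :: "real \<Rightarrow> real" where
  "\<eta>_fun x = - x * log 2 x"

text \<open>Equals \<open>(a + b)\<close> times the binary entropy of \<open>a / (a + b)\<close>: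
  the share of \<open>H(T|V)\<close> that a value of \<open>V\<close> with joint masses
  \<open>a\<close> and \<open>b\<close> contributes.\<close>

definition H_fun :: "real \<Rightarrow> real \<Rightarrow> real" where
  "H_fun a b = \<eta>_fun a + \<eta>_fun b - \<eta>_fun (a + b)"

lemma obs_fun_0 [simp]: "Z_fun 0 0 = 0" "T_fun 0 0 = 0" "H_fun 0 0 = 0"
  by (simp_all add: Z_fun_def T_fun_def H_fun_def \<eta>_fun_def)

lemma bhattacharyya_eq_obs_sum:
  assumes fin: "finite (set_pmf R)"
  shows "bhattacharyya R = obs_sum Z_fun R"
proof -
  let ?S = "snd ` set_pmf R"
  have P: "\<P>(z in measure_pmf R. fst z = t \<bar> snd z = v) = pmf R (t, v) / pmf (map_pmf snd R) v"
    for t v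
  proof -
    have "{z. fst z = t \<and> snd z = v} = {(t, v)}" by auto
    then show ?thesis by (simp add: cond_prob_def measure_pmf_single pmf_map vimage_def)
  qed
  let ?f = "\<lambda>v. pmf (map_pmf snd R) v *
     sqrt (\<P>(z in measure_pmf R. fst z = 0 \<bar> snd z = v) * \<P>(z in measure_pmf R. fst z = 1 \<bar> snd z = v))"
  have f: "?f v = sqrt (pmf R (0, v) * pmf R (1, v))" if "v \<in> ?S" for v
  proof -
    have "pmf (map_pmf snd R) v > 0" using that by (simp add: pmf_positive_iff)
    then show ?thesis
      unfolding P by (simp add: real_sqrt_divide real_sqrt_mult)
  qed
  have "infsum ?f UNIV = infsum ?f ?S"
  proof (rule infsum_cong_neutral)
    fix v assume "v \<in> UNIV - ?S"
    then have "pmf (map_pmf snd R) v = 0" by (simp add: pmf_eq_0_set_pmf)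
    then show "?f v = 0" by simp
  qed auto
  also have "\<dots> = (\<Sum>v\<in>?S. sqrt (pmf R (0, v) * pmf R (1, v)))"
    using fin f by (simp add: infsum_finite)
  finally show ?thesis
    by (simp add: bhattacharyya_def obs_sum_def Z_fun_def sum_distrib_left)
qed

text \<open>Cauchy-Schwarz within each fibre of \<open>f\<close>: forgetting part of the observation
  can only raise \<open>Z\<close>. The nesting and disjointness of the index sets rest on
  this.\<close>

lemma obs_sum_coarsen_Z:
  assumes fin: "finite (set_pmf R)"
  shows "obs_sum Z_fun R \<le> obs_sum Z_fun (map_pmf (\<lambda>(t, v). (t, f v)) R)"
proof -
  let ?V = "snd ` set_pmf R" and ?R = "map_pmf (\<lambda>(t, v). (t, f v)) R"
  have pmf: "pmf ?R (t, w) = (\<Sum>v\<in>{v \<in> ?V. f v = w}. pmf R (t, v))" for t w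
  proof -
    have "pmf ?R (t, w) = measure_pmf.prob R ((\<lambda>(t, v). (t, f v)) -` {(t, w)} \<inter> set_pmf R)"
      by (simp add: pmf_map measure_Int_set_pmf)
    also have "\<dots> = measure_pmf.prob R (Pair t ` {v \<in> ?V. f v = w} \<inter> set_pmf R)"
      by (rule arg_cong[where f = "measure_pmf.prob R"]) force
    also have "\<dots> = (\<Sum>v\<in>{v \<in> ?V. f v = w}. pmf R (t, v))"
      using fin by (simp add: measure_Int_set_pmf measure_measure_pmf_finite sum.reindex inj_on_def)
    finally show ?thesis .
  qed
  have "obs_sum Z_fun R =
      (\<Sum>w\<in>f ` ?V. \<Sum>v\<in>{v \<in> ?V. f v = w}. Z_fun (pmf R (0, v)) (pmf R (1, v)))"
    unfolding obs_sum_def using fin by (intro sum.image_gen) simp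
  also have "\<dots> \<le> (\<Sum>w\<in>f ` ?V. Z_fun (pmf ?R (0, w)) (pmf ?R (1, w)))"
  proof (rule sum_mono)
    fix w
    let ?F = "{v \<in> ?V. f v = w}"
    have "(\<Sum>v\<in>?F. \<bar>sqrt (pmf R (0, v))\<bar> * \<bar>sqrt (pmf R (1, v))\<bar>) \<le>
        L2_set (\<lambda>v. sqrt (pmf R (0, v))) ?F * L2_set (\<lambda>v. sqrt (pmf R (1, v))) ?F"
      by (rule L2_set_mult_ineq)
    also have "\<dots> = sqrt (pmf ?R (0, w) * pmf ?R (1, w))"
      by (simp add: L2_set_def pmf real_sqrt_mult)
    finally show "(\<Sum>v\<in>?F. Z_fun (pmf R (0, v)) (pmf R (1, v))) \<le> Z_fun (pmf ?R (0, w)) (pmf ?R (1, w))"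
      by (simp add: Z_fun_def real_sqrt_mult sum_distrib_left[symmetric])
  qed
  also have "f ` ?V = snd ` set_pmf ?R" by (force simp: image_image)
  finally show ?thesis by (simp only: obs_sum_def)
qed

lemma Z_fun_nonneg: "a \<ge> 0 \<Longrightarrow> b \<ge> 0 \<Longrightarrow> Z_fun a b \<ge> 0"
  by (simp add: Z_fun_def)

lemma Z_fun_square: "a \<ge> 0 \<Longrightarrow> b \<ge> 0 \<Longrightarrow> (Z_fun a b)\<^sup>2 = 4 * (a * b)"
  by (simp add: Z_fun_def power_mult_distrib)

lemma Z_fun_le: "a \<ge> 0 \<Longrightarrow> b \<ge> 0 \<Longrightarrow> Z_fun a b \<le> a + b"
  using arith_geo_mean_sqrt[of a b] by (simp add: Z_fun_def)

text \<open>The geometric mean dominates the minimum, and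
  \<open>a + b - 2 * min a b = \<bar>a - b\<bar>\<close>.\<close>

lemma Z_T_fun: "a \<ge> 0 \<Longrightarrow> b \<ge> 0 \<Longrightarrow> a + b - Z_fun a b \<le> T_fun a b"
proof -
  assume ab: "a \<ge> 0" "b \<ge> 0"
  have "min a b \<le> sqrt (a * b)"
    using ab by (intro real_le_rsqrt) (auto simp: power2_eq_square min_def mult_mono)
  then show ?thesis by (auto simp: Z_fun_def T_fun_def min_def split: if_splits)
qed

lemma Z_nonneg: "obs_sum Z_fun R \<ge> 0"
  unfolding obs_sum_def by (intro sum_nonneg Z_fun_nonneg) auto

lemma Z_le_1: "finite (set_pmf R) \<Longrightarrow> obs_sum Z_fun R \<le> 1"
  using obs_sum_mono[of Z_fun "(+)" R] obs_sum_mass[of R] Z_fun_le by simp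

lemma T_nonneg: "obs_sum T_fun R \<ge> 0"
  unfolding obs_sum_def T_fun_def by (intro sum_nonneg) auto

lemma one_minus_Z_le_T:
  assumes "finite (set_pmf R)"
  shows "1 - obs_sum Z_fun R \<le> obs_sum T_fun R"
  using obs_sum_mono[of "\<lambda>a b. 1 * (a + b) + (-1) * Z_fun a b" T_fun R] Z_T_fun obs_sum_mass[OF assms]
  unfolding obs_sum_linear by simp

text \<open>Factor \<open>(a - b)^2 = (a + b - Z) * (a + b + Z)\<close> and apply Cauchy-Schwarz to
  the square roots of the factors, which sum to \<open>1 - Z\<close> and
  \<open>1 + Z \<le> 2\<close>.\<close>

lemma T_le_sqrt_Z:
  assumes fin: "finite (set_pmf R)"
  shows "obs_sum T_fun R \<le> sqrt (2 * (1 - obs_sum Z_fun R))"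
proof -
  let ?V = "snd ` set_pmf R" and ?a = "\<lambda>v. pmf R (0, v)" and ?b = "\<lambda>v. pmf R (1, v)"
  let ?p = "\<lambda>v. ?a v + ?b v - Z_fun (?a v) (?b v)" and ?q = "\<lambda>v. ?a v + ?b v + Z_fun (?a v) (?b v)"
  have p: "?p v \<ge> 0" and q: "?q v \<ge> 0" for v using Z_fun_le[of "?a v" "?b v"] Z_fun_nonneg[of "?a v" "?b v"] by auto
  have "T_fun (?a v) (?b v) = sqrt (?p v) * sqrt (?q v)" for v
  proof -
    have "?p v * ?q v = (?a v + ?b v)\<^sup>2 - (Z_fun (?a v) (?b v))\<^sup>2" by (simp add: power2_eq_square algebra_simps)
    also have "\<dots> = (?a v - ?b v)\<^sup>2" by (simp add: Z_fun_square) (simp add: power2_eq_square algebra_simps)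
    finally have "?p v * ?q v = (?a v - ?b v)\<^sup>2" .
    then have "sqrt (?p v * ?q v) = \<bar>?a v - ?b v\<bar>" by simp
    then show ?thesis by (simp only: T_fun_def real_sqrt_mult)
  qed
  then have "obs_sum T_fun R = (\<Sum>v\<in>?V. \<bar>sqrt (?p v)\<bar> * \<bar>sqrt (?q v)\<bar>)"
    using p q by (simp add: obs_sum_def)
  also have "\<dots> \<le> L2_set (\<lambda>v. sqrt (?p v)) ?V * L2_set (\<lambda>v. sqrt (?q v)) ?V"
    by (rule L2_set_mult_ineq)
  also have "\<dots> = sqrt ((\<Sum>v\<in>?V. ?p v) * (\<Sum>v\<in>?V. ?q v))"
    using p q by (simp add: L2_set_def real_sqrt_mult)
  also have "(\<Sum>v\<in>?V. ?p v) = 1 - obs_sum Z_fun R"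
    using obs_sum_mass[OF fin] by (simp add: obs_sum_def sum.distrib sum_subtractf)
  also have "(\<Sum>v\<in>?V. ?q v) = 1 + obs_sum Z_fun R"
    using obs_sum_mass[OF fin] by (simp add: obs_sum_def sum.distrib)
  also have "sqrt ((1 - obs_sum Z_fun R) * (1 + obs_sum Z_fun R)) \<le> sqrt ((1 - obs_sum Z_fun R) * 2)"
    using Z_le_1[OF fin] by (intro real_sqrt_le_mono mult_left_mono) auto
  finally show ?thesis by (simp add: mult.commute)
qed

section \<open>Entropy compared with the Bhattacharyya parameter\<close>

lemma H_fun_eq:
  assumes "a > 0" "b > 0"
  shows "H_fun a b = (a * ln ((a + b) / a) + b * ln ((a + b) / b)) / ln 2"
  using assms by (simp add: H_fun_def \<eta>_fun_def log_def ln_div field_simps)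

lemma H_fun_zero: "H_fun 0 b = 0" "H_fun a 0 = 0"
  by (simp_all add: H_fun_def \<eta>_fun_def)

lemma H_fun_nonneg:
  assumes "a \<ge> 0" "b \<ge> 0"
  shows "H_fun a b \<ge> 0"
proof (cases "a = 0 \<or> b = 0")
  case False
  then have "a > 0" "b > 0" using assms by auto
  then show ?thesis unfolding H_fun_eq[OF \<open>a > 0\<close> \<open>b > 0\<close>]
    by (intro divide_nonneg_pos add_nonneg_nonneg mult_nonneg_nonneg ln_ge_zero) auto
qed (auto simp: H_fun_zero)

lemma H_fun_le_mass:
  assumes "a \<ge> 0" "b \<ge> 0"
  shows "H_fun a b \<le> a + b"
proof (cases "a = 0 \<or> b = 0")
  case False
  then have ab: "a > 0" "b > 0" using assms by auto
  \<comment> \<open>The tangent of the logarithm at the balanced point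
    \<open>x = (a + b) / 2\<close>, where the bound is attained.\<close>
  have *: "x * ln ((a + b) / x) \<le> x * ln 2 + (a + b) / 2 - x" if "x > 0" for x
  proof -
    have "(a + b) / x = 2 * ((a + b) / (2 * x))" using that by (simp add: field_simps)
    then have "ln ((a + b) / x) = ln 2 + ln ((a + b) / (2 * x))"
      using that ab by (metis add_pos_pos divide_pos_pos ln_mult_pos mult_pos_pos zero_less_numeral)
    also have "\<dots> \<le> ln 2 + ((a + b) / (2 * x) - 1)"
      using that ab by (intro add_left_mono ln_le_minus_one) auto
    finally have "x * ln ((a + b) / x) \<le> x * (ln 2 + ((a + b) / (2 * x) - 1))"
      using that by (intro mult_left_mono) auto
    also have "\<dots> = x * ln 2 + (a + b) / 2 - x" using that by (simp add: field_simps)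
    finally show ?thesis .
  qed
  show ?thesis using *[OF ab(1)] *[OF ab(2)] unfolding H_fun_eq[OF ab]
    by (simp add: field_simps)
qed (use assms in \<open>auto simp: H_fun_zero\<close>)

text \<open>Writing the logarithm as twice that of a square root before using
  \<open>ln y \<le> y - 1\<close> is what produces \<open>sqrt (x * y)\<close>; each of the two
  terms is then at most \<open>Z\<close>.\<close>

lemma H_fun_le_Z:
  assumes "a \<ge> 0" "b \<ge> 0"
  shows "H_fun a b \<le> 2 / ln 2 * Z_fun a b"
proof (cases "a = 0 \<or> b = 0")
  case False
  then have ab: "a > 0" "b > 0" using assms by auto
  have *: "x * ln ((x + y) / x) \<le> Z_fun x y" if "x > 0" "y > 0" for x y
  proof -
    have "ln ((x + y) / x) = 2 * ln (sqrt ((x + y) / x))"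
      using that by (simp add: ln_sqrt)
    also have "\<dots> \<le> 2 * (sqrt ((x + y) / x) - 1)"
      using that by (intro mult_left_mono ln_le_minus_one) auto
    finally have "x * ln ((x + y) / x) \<le> x * (2 * (sqrt ((x + y) / x) - 1))"
      using that by (intro mult_left_mono) auto
    also have "\<dots> = 2 * (sqrt x * sqrt x) * (sqrt (x + y) / sqrt x - 1)"
      using that by (simp add: real_sqrt_divide)
    also have "\<dots> = 2 * sqrt x * (sqrt (x + y) - sqrt x)"
      using that by (simp add: field_simps del: real_sqrt_mult_self)
    also have "\<dots> \<le> 2 * sqrt x * sqrt y"
      using that sqrt_add_le_add_sqrt[of x y] by (intro mult_left_mono) auto
    finally show ?thesis by (simp add: Z_fun_def real_sqrt_mult)
  qed
  have "Z_fun b a = Z_fun a b" by (simp add: Z_fun_def mult.commute)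
  then have "a * ln ((a + b) / a) + b * ln ((a + b) / b) \<le> 2 * Z_fun a b"
    using *[OF ab] *[OF ab(2,1)] by (simp add: add.commute)
  then have "(a * ln ((a + b) / a) + b * ln ((a + b) / b)) / ln 2 \<le> 2 * Z_fun a b / ln 2"
    by (rule divide_right_mono) simp
  then show ?thesis unfolding H_fun_eq[OF ab] by simp
qed (auto simp: H_fun_zero Z_fun_def)

text \<open>Near the balanced point: the tangent bound, now from below, leaves a remainder
  \<open>(a - b)^2 / (a + b)\<close>, and \<open>(a - b)^2 = (a + b - Z) * (a + b + Z)\<close>
  bounds it by twice \<open>a + b - Z\<close>. Hence \<open>Z\<close> near 1 forces the entropy near
  1.\<close>

lemma H_fun_ge_Z:
  assumes "a \<ge> 0" "b \<ge> 0"
  shows "H_fun a b \<ge> a + b - 2 / ln 2 * (a + b - Z_fun a b)"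
proof (cases "a = 0 \<or> b = 0")
  case True
  have "a + b \<le> 2 / ln 2 * (a + b)"
    using ln_2_less_1 assms mult_right_mono[of 1 "2 / ln 2 :: real" "a + b"] by simp
  then show ?thesis using True by (auto simp: H_fun_zero Z_fun_def)
next
  case False
  then have ab: "a > 0" "b > 0" using assms by auto
  have *: "x * ln ((a + b) / x) \<ge> x * ln 2 - x * (2 * x / (a + b) - 1)" if "x > 0" for x
  proof -
    have "ln ((a + b) / x) = ln 2 - ln (2 * x / (a + b))"
      using that ab by (simp add: ln_div ln_mult_pos)
    also have "\<dots> \<ge> ln 2 - (2 * x / (a + b) - 1)"
      using that ab by (intro diff_left_mono ln_le_minus_one) auto
    finally have "x * (ln 2 - (2 * x / (a + b) - 1)) \<le> x * ln ((a + b) / x)"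
      using that by (intro mult_left_mono) auto
    then show ?thesis by (simp add: algebra_simps)
  qed
  have "a * (2 * a / (a + b) - 1) + b * (2 * b / (a + b) - 1) =
      (2 * a * a + 2 * b * b) / (a + b) - (a + b)"
    by (simp add: algebra_simps add_divide_distrib)
  also have "\<dots> = (2 * a * a + 2 * b * b - (a + b) * (a + b)) / (a + b)"
    using ab by (simp add: diff_divide_distrib)
  also have "2 * a * a + 2 * b * b - (a + b) * (a + b) = (a - b)\<^sup>2"
    by (simp add: power2_eq_square algebra_simps)
  also have "\<dots> / (a + b) \<le> (a + b - Z_fun a b) * (2 * (a + b)) / (a + b)"
  proof (rule divide_right_mono)
    have "(a - b)\<^sup>2 = (a + b)\<^sup>2 - (Z_fun a b)\<^sup>2"
      using ab by (simp add: Z_fun_square) (simp add: power2_eq_square algebra_simps)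
    also have "\<dots> = (a + b - Z_fun a b) * (a + b + Z_fun a b)"
      by (simp add: power2_eq_square algebra_simps)
    also have "\<dots> \<le> (a + b - Z_fun a b) * (2 * (a + b))"
      using ab Z_fun_le[of a b] by (intro mult_left_mono) auto
    finally show "(a - b)\<^sup>2 \<le> (a + b - Z_fun a b) * (2 * (a + b))" .
  qed (use ab in simp)
  also have "\<dots> = 2 * (a + b - Z_fun a b)"
    by (subst nonzero_divide_eq_eq) (use ab in \<open>auto simp: algebra_simps\<close>)
  finally have "a * (2 * a / (a + b) - 1) + b * (2 * b / (a + b) - 1) \<le> 2 * (a + b - Z_fun a b)" .
  with *[OF ab(1)] *[OF ab(2)]
  have "(a + b) * ln 2 - 2 * (a + b - Z_fun a b) \<le> a * ln ((a + b) / a) + b * ln ((a + b) / b)"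
    by (simp add: algebra_simps)
  then have "((a + b) * ln 2 - 2 * (a + b - Z_fun a b)) / ln 2 \<le>
      (a * ln ((a + b) / a) + b * ln ((a + b) / b)) / ln 2"
    by (rule divide_right_mono) simp
  then show ?thesis unfolding H_fun_eq[OF ab] by (simp add: diff_divide_distrib)
qed

lemma H_bounds:
  assumes "finite (set_pmf R)"
  shows "0 \<le> obs_sum H_fun R" "obs_sum H_fun R \<le> 1"
    "obs_sum H_fun R \<le> 2 / ln 2 * obs_sum Z_fun R"
    "obs_sum H_fun R \<ge> 1 - 2 / ln 2 * (1 - obs_sum Z_fun R)"
proof -
  show "0 \<le> obs_sum H_fun R"
    unfolding obs_sum_def by (intro sum_nonneg H_fun_nonneg) auto
  show "obs_sum H_fun R \<le> 1"
    using obs_sum_mono[of H_fun "(+)" R] H_fun_le_mass obs_sum_mass[OF assms] by simp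
  show "obs_sum H_fun R \<le> 2 / ln 2 * obs_sum Z_fun R"
    using obs_sum_mono[of H_fun "\<lambda>a b. 2 / ln 2 * Z_fun a b + 0 * Z_fun a b" R] H_fun_le_Z
    unfolding obs_sum_linear by simp
  have "obs_sum (\<lambda>a b. (1 - 2 / ln 2) * (a + b) + 2 / ln 2 * Z_fun a b) R \<le> obs_sum H_fun R"
    by (rule obs_sum_mono) (use H_fun_ge_Z in \<open>simp add: algebra_simps diff_divide_distrib\<close>)
  then show "obs_sum H_fun R \<ge> 1 - 2 / ln 2 * (1 - obs_sum Z_fun R)"
    unfolding obs_sum_linear obs_sum_mass[OF assms] by (simp add: algebra_simps diff_divide_distrib)
qed

section \<open>The two elementary polar transforms\<close>

text \<open>Arikan's pair of synthetic sources. For two independent copies, \<open>minus_law\<close>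
  is \<open>T1 + T2\<close> observed through \<open>(V1, V2)\<close>, and \<open>plus_law\<close> is
  \<open>T2\<close> observed through \<open>(V1, V2)\<close> with \<open>T1 + T2\<close> already
  known.\<close>

definition minus_law :: "(bit \<times> 'v) pmf \<Rightarrow> (bit \<times> 'v \<times> 'v) pmf" where
  "minus_law R = map_pmf (\<lambda>((t1, v1), (t2, v2)). (t1 + t2, (v1, v2))) (pair_pmf R R)"

definition plus_law :: "(bit \<times> 'v) pmf \<Rightarrow> (bit \<times> bit \<times> 'v \<times> 'v) pmf" where
  "plus_law R = map_pmf (\<lambda>((t1, v1), (t2, v2)). (t2, (t1 + t2, (v1, v2)))) (pair_pmf R R)"

lemma pmf_minus_law:
  "pmf (minus_law R) (t, (v1, v2)) = pmf R (0, v1) * pmf R (t, v2) + pmf R (1, v1) * pmf R (1 + t, v2)"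
proof -
  have "(\<lambda>((t1, v1), (t2, v2)). (t1 + t2, (v1, v2))) -` {(t, (v1, v2))} =
      {((0, v1), (t, v2)), ((1, v1), (1 + t, v2))}"
    by auto
  then show ?thesis
    by (simp add: minus_law_def pmf_map measure_measure_pmf_finite pmf_pair)
qed

lemma pmf_plus_law:
  "pmf (plus_law R) (t, (s, (v1, v2))) = pmf R (s + t, v1) * pmf R (t, v2)"
proof -
  have "(\<lambda>((t1, v1), (t2, v2)). (t2, (t1 + t2, (v1, v2)))) -` {(t, (s, (v1, v2)))} =
      {((s + t, v1), (t, v2))}"
    by auto
  then show ?thesis
    by (simp add: plus_law_def pmf_map measure_measure_pmf_finite pmf_pair)
qed

context
  fixes R :: "(bit \<times> 'v) pmf"
  assumes fin: "finite (set_pmf R)"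
begin

private abbreviation "V \<equiv> snd ` set_pmf R"
private abbreviation "a \<equiv> \<lambda>v. pmf R (0, v)"
private abbreviation "b \<equiv> \<lambda>v. pmf R (1, v)"

lemma obs_sum_minus_law:
  assumes "\<phi> 0 0 = 0"
  shows "obs_sum \<phi> (minus_law R) =
    (\<Sum>v1\<in>V. \<Sum>v2\<in>V. \<phi> (a v1 * a v2 + b v1 * b v2) (a v1 * b v2 + b v1 * a v2))"
proof -
  have "obs_sum \<phi> (minus_law R) =
      (\<Sum>v\<in>V \<times> V. \<phi> (pmf (minus_law R) (0, v)) (pmf (minus_law R) (1, v)))"
    by (rule obs_sum_superset) (use fin assms in \<open>force simp: minus_law_def\<close>)+
  then show ?thesis by (simp add: sum.cartesian_product' pmf_minus_law)
qed

lemma obs_sum_plus_law: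
  assumes "\<phi> 0 0 = 0"
  shows "obs_sum \<phi> (plus_law R) =
    (\<Sum>v1\<in>V. \<Sum>v2\<in>V. \<phi> (a v1 * a v2) (b v1 * b v2) + \<phi> (b v1 * a v2) (a v1 * b v2))"
proof -
  have "obs_sum \<phi> (plus_law R) =
      (\<Sum>v\<in>{0, 1} \<times> (V \<times> V). \<phi> (pmf (plus_law R) (0, v)) (pmf (plus_law R) (1, v)))"
    by (rule obs_sum_superset) (use fin assms UNIV_bit in \<open>force simp: plus_law_def\<close>)+
  then show ?thesis by (simp add: sum.cartesian_product' pmf_plus_law sum.distrib)
qed

private lemma sum_product_linear:
  fixes f g :: "'v \<Rightarrow> real"
  shows "(\<Sum>v1\<in>V. \<Sum>v2\<in>V. f v1 * g v2) = (\<Sum>v\<in>V. f v) * (\<Sum>v\<in>V. g v)"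
  by (simp add: sum_product)

private lemma mass: "(\<Sum>v\<in>V. a v + b v) = 1"
  using obs_sum_mass[OF fin] by (simp add: obs_sum_def)

lemma Z_minus_law:
  "obs_sum Z_fun (minus_law R) \<le> 2 * obs_sum Z_fun R - (obs_sum Z_fun R)\<^sup>2"
proof -
  let ?z = "\<lambda>v. Z_fun (a v) (b v)" 
  define c where "c = (\<lambda>v. a v + b v)"
  have mass_c: "(\<Sum>v\<in>V. c v) = 1" using mass by (simp add: c_def)
  \<comment> \<open>With masses \<open>c = a + b\<close>, the square of the right side exceeds that
    of the left by exactly \<open>2 * z1 * z2 * (c1 - z1) * (c2 - z2)\<close>, which is nonnegative
    because \<open>z \<le> c\<close>. Normalizing \<open>c\<close> to 1 gives the familiar
    \<open>z1 + z2 - z1 * z2\<close>.\<close>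
  have pointwise: "Z_fun (a1 * a2 + b1 * b2) (a1 * b2 + b1 * a2) \<le>
      Z_fun a1 b1 * (a2 + b2) + (a1 + b1) * Z_fun a2 b2 - Z_fun a1 b1 * Z_fun a2 b2"
    if nn: "a1 \<ge> 0" "b1 \<ge> 0" "a2 \<ge> 0" "b2 \<ge> 0" for a1 b1 a2 b2
  proof (rule power2_le_imp_le)
    let ?z1 = "Z_fun a1 b1" and ?z2 = "Z_fun a2 b2" and ?c1 = "a1 + b1" and ?c2 = "a2 + b2"
    have z: "0 \<le> ?z1" "0 \<le> ?z2" "?z1 \<le> ?c1" "?z2 \<le> ?c2"
      using nn by (simp_all add: Z_fun_nonneg Z_fun_le)
    have sq: "?z1\<^sup>2 = 4 * (a1 * b1)" "?z2\<^sup>2 = 4 * (a2 * b2)" using nn by (simp_all add: Z_fun_square)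
    have "(Z_fun (a1 * a2 + b1 * b2) (a1 * b2 + b1 * a2))\<^sup>2 =
        4 * ((a1 * a2 + b1 * b2) * (a1 * b2 + b1 * a2))"
      using nn by (intro Z_fun_square) auto
    also have "\<dots> = ?z1\<^sup>2 * ?c2\<^sup>2 + ?c1\<^sup>2 * ?z2\<^sup>2 - ?z1\<^sup>2 * ?z2\<^sup>2"
      unfolding sq by (simp add: power2_eq_square algebra_simps)
    also have "\<dots> \<le> ?z1\<^sup>2 * ?c2\<^sup>2 + ?c1\<^sup>2 * ?z2\<^sup>2 - ?z1\<^sup>2 * ?z2\<^sup>2 + 2 * ?z1 * ?z2 * ((?c1 - ?z1) * (?c2 - ?z2))"
      using z by simp
    also have "\<dots> = (?z1 * ?c2 + ?c1 * ?z2 - ?z1 * ?z2)\<^sup>2"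
      by (simp add: power2_eq_square algebra_simps)
    finally show "(Z_fun (a1 * a2 + b1 * b2) (a1 * b2 + b1 * a2))\<^sup>2 \<le>
      (?z1 * ?c2 + ?c1 * ?z2 - ?z1 * ?z2)\<^sup>2" .
    have "?z1 * ?c2 + ?c1 * ?z2 - ?z1 * ?z2 = ?z1 * (?c2 - ?z2) + ?c1 * ?z2"
      by (simp add: algebra_simps)
    also have "\<dots> \<ge> 0" using z nn by simp
    finally show "0 \<le> ?z1 * ?c2 + ?c1 * ?z2 - ?z1 * ?z2" .
  qed
  have "obs_sum Z_fun (minus_law R) \<le>
      (\<Sum>v1\<in>V. \<Sum>v2\<in>V. ?z v1 * c v2 + c v1 * ?z v2 - ?z v1 * ?z v2)"
    unfolding c_def by (subst obs_sum_minus_law, simp) (intro sum_mono pointwise; simp)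
  also have "\<dots> = 2 * (\<Sum>v\<in>V. ?z v) - (\<Sum>v\<in>V. ?z v)\<^sup>2"
    by (simp add: sum.distrib sum_subtractf sum_product_linear mass_c power2_eq_square)
  finally show ?thesis by (simp only: obs_sum_def)
qed

lemma Z_plus_law: "obs_sum Z_fun (plus_law R) = (obs_sum Z_fun R)\<^sup>2"
proof -
  let ?z = "\<lambda>v. Z_fun (a v) (b v)"
  have "Z_fun (a v1 * a v2) (b v1 * b v2) + Z_fun (b v1 * a v2) (a v1 * b v2) = ?z v1 * ?z v2"
    for v1 v2 by (simp add: Z_fun_def real_sqrt_mult)
  then have "obs_sum Z_fun (plus_law R) = (\<Sum>v1\<in>V. \<Sum>v2\<in>V. ?z v1 * ?z v2)"
    by (simp add: obs_sum_plus_law)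
  then show ?thesis by (simp add: sum_product_linear obs_sum_def power2_eq_square)
qed

lemma T_minus_law: "obs_sum T_fun (minus_law R) = (obs_sum T_fun R)\<^sup>2"
proof -
  let ?t = "\<lambda>v. T_fun (a v) (b v)"
  have "T_fun (a v1 * a v2 + b v1 * b v2) (a v1 * b v2 + b v1 * a v2) = ?t v1 * ?t v2" for v1 v2
    unfolding T_fun_def abs_mult[symmetric] by (simp add: algebra_simps)
  then have "obs_sum T_fun (minus_law R) = (\<Sum>v1\<in>V. \<Sum>v2\<in>V. ?t v1 * ?t v2)"
    by (simp add: obs_sum_minus_law)
  then show ?thesis by (simp add: sum_product_linear obs_sum_def power2_eq_square)
qed

lemma T_plus_law: "obs_sum T_fun (plus_law R) \<le> 2 * obs_sum T_fun R"
proof -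
  let ?t = "\<lambda>v. T_fun (a v) (b v)" 
  define c where "c = (\<lambda>v. a v + b v)"
  have mass_c: "(\<Sum>v\<in>V. c v) = 1" using mass by (simp add: c_def)
  have pointwise: "T_fun (a1 * a2) (b1 * b2) + T_fun (b1 * a2) (a1 * b2) \<le>
      T_fun a1 b1 * (a2 + b2) + (a1 + b1) * T_fun a2 b2"
    if nn: "a1 \<ge> 0" "b1 \<ge> 0" "a2 \<ge> 0" "b2 \<ge> 0" for a1 b1 a2 b2
  proof -
    have "2 * (a1 * a2 - b1 * b2) = (a1 - b1) * (a2 + b2) + (a1 + b1) * (a2 - b2)"
      "2 * (b1 * a2 - a1 * b2) = - ((a1 - b1) * (a2 + b2)) + (a1 + b1) * (a2 - b2)"
      by (simp_all add: algebra_simps)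
    moreover have "\<bar>(a1 - b1) * (a2 + b2)\<bar> = \<bar>a1 - b1\<bar> * (a2 + b2)"
      "\<bar>(a1 + b1) * (a2 - b2)\<bar> = (a1 + b1) * \<bar>a2 - b2\<bar>" using nn by (simp_all add: abs_mult)
    \<comment> \<open>Here \<open>\<bar>x\<bar> + \<bar>y\<bar>\<close> is the larger of
      \<open>\<bar>p\<bar>\<close> and \<open>\<bar>q\<bar>\<close>.\<close>
    moreover have "\<bar>x\<bar> + \<bar>y\<bar> \<le> \<bar>p\<bar> + \<bar>q\<bar>" if "2 * x = p + q" "2 * y = - p + q" for x y p q :: real
      using that by linarith
    ultimately show ?thesis unfolding T_fun_def by metis
  qed
  have "obs_sum T_fun (plus_law R) \<le> (\<Sum>v1\<in>V. \<Sum>v2\<in>V. ?t v1 * c v2 + c v1 * ?t v2)"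
    unfolding c_def by (subst obs_sum_plus_law, simp) (intro sum_mono pointwise; simp)
  also have "\<dots> = 2 * (\<Sum>v\<in>V. ?t v)"
    by (simp add: sum.distrib sum_product_linear mass_c)
  finally show ?thesis by (simp only: obs_sum_def)
qed

text \<open>The chain rule for \<open>H(T1, T2 | V1, V2)\<close>. Pointwise, the masses of the sums
  in \<open>minus_law\<close> are the totals in \<open>plus_law\<close>, so their \<eta>-terms
  cancel and only products remain.\<close>

lemma H_minus_plus_law:
  "obs_sum H_fun (minus_law R) + obs_sum H_fun (plus_law R) = 2 * obs_sum H_fun R"
proof -
  let ?h = "\<lambda>v. H_fun (a v) (b v)" 
  define c where "c = (\<lambda>v. a v + b v)"
  have mass_c: "(\<Sum>v\<in>V. c v) = 1" using mass by (simp add: c_def)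
  have \<eta>: "\<eta>_fun (x * y) = x * \<eta>_fun y + y * \<eta>_fun x" if "x \<ge> 0" "y \<ge> 0" for x y
    using that by (cases "x = 0 \<or> y = 0") (auto simp: \<eta>_fun_def log_mult_pos algebra_simps)
  have pointwise: "H_fun (a1 * a2 + b1 * b2) (a1 * b2 + b1 * a2) +
      (H_fun (a1 * a2) (b1 * b2) + H_fun (b1 * a2) (a1 * b2)) =
      H_fun a1 b1 * (a2 + b2) + (a1 + b1) * H_fun a2 b2"
    if nn: "a1 \<ge> 0" "b1 \<ge> 0" "a2 \<ge> 0" "b2 \<ge> 0" for a1 b1 a2 b2
  proof -
    have "a1 * a2 + b1 * b2 + (a1 * b2 + b1 * a2) = (a1 + b1) * (a2 + b2)"
      by (simp add: algebra_simps)
    then have "H_fun (a1 * a2 + b1 * b2) (a1 * b2 + b1 * a2) +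
      (H_fun (a1 * a2) (b1 * b2) + H_fun (b1 * a2) (a1 * b2)) =
      \<eta>_fun (a1 * a2) + \<eta>_fun (b1 * b2) + \<eta>_fun (b1 * a2) + \<eta>_fun (a1 * b2)
        - \<eta>_fun ((a1 + b1) * (a2 + b2))"
      by (simp add: H_fun_def add.commute)
    also have "\<dots> = H_fun a1 b1 * (a2 + b2) + (a1 + b1) * H_fun a2 b2"
      using nn by (simp add: \<eta> H_fun_def) (simp add: algebra_simps)
    finally show ?thesis .
  qed
  have "obs_sum H_fun (minus_law R) + obs_sum H_fun (plus_law R) =
      (\<Sum>v1\<in>V. \<Sum>v2\<in>V. ?h v1 * c v2 + c v1 * ?h v2)"
    unfolding c_def
    by (simp only: obs_sum_minus_law obs_sum_plus_law obs_fun_0 sum.distrib[symmetric] pointwise pmf_nonneg)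
  also have "\<dots> = 2 * (\<Sum>v\<in>V. ?h v)"
    by (simp add: sum.distrib sum_product_linear mass_c)
  finally show ?thesis by (simp only: obs_sum_def)
qed

end

section \<open>Recursive structure of the polar transform\<close>

lemma sum_lessThan_add:
  fixes f :: "nat \<Rightarrow> 'a :: comm_monoid_add"
  shows "(\<Sum>l<a + b. f l) = (\<Sum>l<a. f l) + (\<Sum>l<b. f (a + l))"
  by (induction b) (simp_all add: add.assoc)

lemma sum_lessThan_double:
  fixes f :: "nat \<Rightarrow> 'a :: comm_monoid_add"
  shows "(\<Sum>l<2 * n. f l) = (\<Sum>l<n. f (2 * l)) + (\<Sum>l<n. f (2 * l + 1))"
  by (induction n) (simp_all add: ac_simps)

lemma bit_reverse_Suc: "bit_reverse (Suc n) k = (k mod 2) * 2 ^ n + bit_reverse n (k div 2)"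
proof -
  have "n - Suc i = n - 1 - i" for i by simp
  then show ?thesis
    unfolding bit_reverse_def sum.lessThan_Suc_shift by (simp add: div_mult2_eq)
qed

lemma bit_reverse_less: "bit_reverse n k < 2 ^ n"
proof (induction n arbitrary: k)
  case (Suc n)
  show ?case using Suc[of "k div 2"] by (cases "even k") (auto simp: bit_reverse_Suc odd_iff_mod_2_eq_one)
qed (simp add: bit_reverse_def)

lemma G_mat_eq: "G_mat n r c = F_kron_power n (bit_reverse n r) c"
proof -
  have "G_mat n r c =
      (\<Sum>l<2 ^ n. if l = bit_reverse n r then F_kron_power n l c else 0)"
    unfolding G_mat_def B_mat_def by (rule sum.cong) auto
  then show ?thesis by (simp add: bit_reverse_less)
qed

text \<open>Bit reversal turns the last digit of the row into the leading one, on which the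
  outermost Kronecker factor acts.\<close>

lemma G_mat_Suc_low_row:
  assumes "h < 2" "k < 2 ^ n"
  shows "G_mat (Suc n) (2 * l + h) (e * 2 ^ n + k) = F_mat h e * G_mat n l k"
proof -
  have "(2 * l + h) mod 2 = h" "(2 * l + h) div 2 = l" using assms by auto
  then show ?thesis
    using assms bit_reverse_less[of n l]
    by (simp add: G_mat_eq bit_reverse_Suc kron_def)
qed

lemma half_decompose:
  fixes k :: nat
  assumes "k < 2 ^ Suc n"
  obtains e k' where "e < 2" "k' < 2 ^ n" "k = e * 2 ^ n + k'"
proof
  show "k div 2 ^ n < 2" using assms by (simp add: less_mult_imp_div_less)
  show "k mod 2 ^ n < 2 ^ n" by simp
  show "k = k div 2 ^ n * 2 ^ n + k mod 2 ^ n" by (rule div_mult_mod_eq[symmetric])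
qed

lemma parity_decompose:
  fixes k :: nat
  assumes "k < 2 ^ Suc n"
  obtains e k' where "e < 2" "k' < 2 ^ n" "k = 2 * k' + e"
proof
  show "k mod 2 < 2" by simp
  show "k div 2 < 2 ^ n" using assms by auto
  show "k = 2 * (k div 2) + k mod 2" by (rule mult_div_mod_eq[symmetric])
qed

text \<open>The same recursion with the digit positions exchanged, which expresses that bit reversal
  commutes with the Kronecker power. It is this form that makes \<open>2 * k\<close> and
  \<open>2 * k + 1\<close> the children of index \<open>k\<close> when a block is split into its two
  halves.\<close>

lemma G_mat_Suc_high_row:
  assumes "h < 2" "e < 2" "l < 2 ^ n" "k < 2 ^ n"
  shows "G_mat (Suc n) (h * 2 ^ n + l) (2 * k + e) = F_mat h e * G_mat n l k"
  using assms
proof (induction n arbitrary: l k)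
  case 0
  then show ?case using G_mat_Suc_low_row[of h 0 0 0 e] by simp
next
  case (Suc n)
  obtain h' l' where l: "h' < 2" "l' < 2 ^ n" "l = 2 * l' + h'"
    using Suc.prems(3) by (rule parity_decompose)
  obtain e' k' where k: "e' < 2" "k' < 2 ^ n" "k = e' * 2 ^ n + k'"
    using Suc.prems(4) by (rule half_decompose)
  have row: "h * 2 ^ Suc n + l = 2 * (h * 2 ^ n + l') + h'"
    and col: "2 * k + e = e' * 2 ^ Suc n + (2 * k' + e)" using l k by simp_all
  have "G_mat (Suc (Suc n)) (h * 2 ^ Suc n + l) (2 * k + e) =
      F_mat h' e' * G_mat (Suc n) (h * 2 ^ n + l') (2 * k' + e)"
    unfolding row col using l k Suc.prems by (intro G_mat_Suc_low_row) auto
  also have "\<dots> = F_mat h' e' * (F_mat h e * G_mat n l' k')"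
    by (subst Suc.IH) (use Suc.prems l k in auto)
  also have "\<dots> = F_mat h e * G_mat (Suc n) l k"
    using G_mat_Suc_low_row[OF l(1) k(2), of l' e'] by (simp add: l(3) k(3) mult.left_commute)
  finally show ?case .
qed

lemma F_mat_entries [simp]: "F_mat 0 0 = 1" "F_mat 0 (Suc 0) = 0" "F_mat (Suc 0) c = 1"
  by (simp_all add: F_mat_def)

lemma polar_apply: "k < 2 ^ n \<Longrightarrow> polar n u k = (\<Sum>l<2 ^ n. u l * G_mat n l k)"
  by (simp add: polar_def)

lemma polar_cong: "(\<And>l. l < 2 ^ n \<Longrightarrow> u l = u' l) \<Longrightarrow> polar n u = polar n u'"
  unfolding polar_def by (intro ext restrict_ext sum.cong) auto

lemma polar_extensional [simp]: "polar n u \<in> extensional {..<2 ^ n}"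
  by (simp add: polar_def)

lemma polar_0: "polar 0 u = (\<lambda>k\<in>{..<1}. u 0)"
  unfolding polar_def by (intro ext restrict_ext) (auto simp: G_mat_eq)

lemma polar_Suc:
  assumes "k < 2 ^ n"
  shows "polar (Suc n) u (2 * k) = polar n u k + polar n (\<lambda>l. u (2 ^ n + l)) k"
    and "polar (Suc n) u (2 * k + 1) = polar n (\<lambda>l. u (2 ^ n + l)) k"
proof -
  have split: "polar (Suc n) u (2 * k + e) = (\<Sum>l<2 ^ n. u l * (F_mat 0 e * G_mat n l k)) +
      (\<Sum>l<2 ^ n. u (2 ^ n + l) * (F_mat 1 e * G_mat n l k))" if "e < 2" for e
  proof -
    have "polar (Suc n) u (2 * k + e) =
        (\<Sum>l<2 ^ n + 2 ^ n. u l * G_mat (Suc n) l (2 * k + e))"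
      using assms that by (simp add: polar_apply mult_2)
    also have "\<dots> = (\<Sum>l<2 ^ n. u l * G_mat (Suc n) l (2 * k + e)) +
        (\<Sum>l<2 ^ n. u (2 ^ n + l) * G_mat (Suc n) (2 ^ n + l) (2 * k + e))"
      by (rule sum_lessThan_add)
    finally show ?thesis
      using assms that G_mat_Suc_high_row[of 0 e _ n k] G_mat_Suc_high_row[of 1 e _ n k] by simp
  qed
  show "polar (Suc n) u (2 * k) = polar n u k + polar n (\<lambda>l. u (2 ^ n + l)) k"
    using split[of 0] assms by (simp add: polar_apply)
  show "polar (Suc n) u (2 * k + 1) = polar n (\<lambda>l. u (2 ^ n + l)) k"
    using split[of 1] assms by (simp add: polar_apply)
qed

lemma polar_Suc_halves:
  assumes "k < 2 ^ n"
  shows "polar (Suc n) u k = polar n (\<lambda>l. u (2 * l) + u (2 * l + 1)) k"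
    and "polar (Suc n) u (2 ^ n + k) = polar n (\<lambda>l. u (2 * l + 1)) k"
proof -
  have split: "polar (Suc n) u (e * 2 ^ n + k) = (\<Sum>l<2 ^ n. u (2 * l) * (F_mat 0 e * G_mat n l k)) +
      (\<Sum>l<2 ^ n. u (2 * l + 1) * (F_mat 1 e * G_mat n l k))" if "e < 2" for e
  proof -
    have "e * 2 ^ n + k < 2 ^ Suc n" using that assms by (auto simp: less_2_cases_iff)
    then have "polar (Suc n) u (e * 2 ^ n + k) =
        (\<Sum>l<2 * 2 ^ n. u l * G_mat (Suc n) l (e * 2 ^ n + k))"
      by (simp add: polar_apply)
    also have "\<dots> = (\<Sum>l<2 ^ n. u (2 * l) * G_mat (Suc n) (2 * l) (e * 2 ^ n + k)) +
        (\<Sum>l<2 ^ n. u (2 * l + 1) * G_mat (Suc n) (2 * l + 1) (e * 2 ^ n + k))"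
      by (rule sum_lessThan_double)
    finally show ?thesis
      using assms G_mat_Suc_low_row[of 0 k n _ e] G_mat_Suc_low_row[of 1 k n _ e] by simp
  qed
  show "polar (Suc n) u k = polar n (\<lambda>l. u (2 * l) + u (2 * l + 1)) k"
    using split[of 0] assms by (simp add: polar_apply distrib_right sum.distrib)
  show "polar (Suc n) u (2 ^ n + k) = polar n (\<lambda>l. u (2 * l + 1)) k"
    using split[of 1] assms by (simp add: polar_apply)
qed

text \<open>The two recursions fit together: the outer transform combines adjacent outputs, and
  adjacent outputs of the inner one are sums over the two halves of \<open>u\<close>, where the
  second half cancels in characteristic 2.\<close>

lemma polar_polar_apply: "k < 2 ^ n \<Longrightarrow> polar n (polar n u) k = u k"
proof (induction n arbitrary: u k)
  case 0
  then show ?case by (simp add: polar_0)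
next
  case (Suc n)
  let ?v = "polar (Suc n) u"
  obtain e k' where k: "e < 2" "k' < 2 ^ n" "k = e * 2 ^ n + k'"
    using Suc.prems by (rule half_decompose)
  have "?v (2 * l) + ?v (2 * l + 1) = polar n u l" "?v (2 * l + 1) = polar n (\<lambda>l. u (2 ^ n + l)) l"
    if "l < 2 ^ n" for l
    using polar_Suc[OF that, of u] by simp_all
  then have "polar n (\<lambda>l. ?v (2 * l) + ?v (2 * l + 1)) = polar n (polar n u)"
    "polar n (\<lambda>l. ?v (2 * l + 1)) = polar n (polar n (\<lambda>l. u (2 ^ n + l)))"
    by (intro polar_cong; simp)+
  then show ?case
    using k polar_Suc_halves[OF k(2), of ?v] Suc.IH[OF k(2)] by (auto simp: less_2_cases_iff)
qed

lemma polar_polar: "u \<in> extensional {..<2 ^ n} \<Longrightarrow> polar n (polar n u) = u"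
  by (rule extensionalityI[of _ "{..<2 ^ n}"]) (auto simp: polar_polar_apply)

section \<open>Recursive structure of the polarized laws\<close>

lemma finite_set_iid: "finite (set_pmf p) \<Longrightarrow> finite (set_pmf (iid n p))"
  by (auto simp: iid_def set_Pi_pmf intro!: finite_PiE_dflt)

definition join :: "nat \<Rightarrow> (nat \<Rightarrow> 'a) \<Rightarrow> (nat \<Rightarrow> 'a) \<Rightarrow> nat \<Rightarrow> 'a" where
  "join n s1 s2 = (\<lambda>l. if l < 2 ^ n then s1 l else s2 (l - 2 ^ n))"

lemma iid_Suc: "iid (Suc n) p = map_pmf (\<lambda>(s1, s2). join n s1 s2) (pair_pmf (iid n p) (iid n p))"
proof -
  let ?A = "{..<2 ^ n} :: nat set" and ?B = "{2 ^ n..<2 * 2 ^ n} :: nat set"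
  \<comment> \<open>Positions of the first half are sent to \<open>2 ^ n\<close>, which lies outside
    the block, so that the shifted copy takes the default value \<open>undefined\<close>
    there.\<close>
  let ?h = "\<lambda>l. if l < 2 ^ n then 2 ^ n else l - 2 ^ n :: nat"
  have "bij_betw ?h ?B ?A"
    by (rule bij_betw_byWitness[where f' = "\<lambda>l. 2 ^ n + l"]) auto
  then have shift: "Pi_pmf ?B undefined (\<lambda>_. p) = map_pmf (\<lambda>g. g \<circ> ?h) (iid n p)"
    unfolding iid_def by (intro Pi_pmf_bij_betw) auto
  have "iid (Suc n) p = Pi_pmf (?A \<union> ?B) undefined (\<lambda>_. p)"
    unfolding iid_def by (rule arg_cong[where f = "\<lambda>A. Pi_pmf A undefined (\<lambda>_. p)"]) auto
  also have "\<dots> = map_pmf (\<lambda>(f, g) x. if x \<in> ?A then f x else g x)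
      (pair_pmf (iid n p) (map_pmf (\<lambda>g. g \<circ> ?h) (iid n p)))"
    unfolding shift[symmetric] by (subst Pi_pmf_union) (auto simp: iid_def)
  also have "\<dots> = map_pmf (\<lambda>(s1, s2). join n s1 s2) (pair_pmf (iid n p) (iid n p))"
    by (simp add: pair_map_pmf2 pmf.map_comp)
       (intro map_pmf_cong refl, auto simp: join_def fun_eq_iff)
  finally show ?thesis .
qed

definition polar_law :: "nat \<Rightarrow> (bit \<times> 'w) pmf \<Rightarrow> nat \<Rightarrow> (bit \<times> (nat \<Rightarrow> bit) \<times> (nat \<Rightarrow> 'w)) pmf" where
  "polar_law n p k = map_pmf (\<lambda>s. let v = polar n (\<lambda>l. fst (s l)) in
     (v k, restrict v {..<k}, \<lambda>l\<in>{..<2 ^ n}. snd (s l))) (iid n p)"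

lemma finite_set_polar_law: "finite (set_pmf p) \<Longrightarrow> finite (set_pmf (polar_law n p k))"
  by (simp add: polar_law_def finite_set_iid)

text \<open>How the observation at index \<open>2 * k\<close> of the double block arises from the
  observations at index \<open>k\<close> of its halves: the earlier bits come in pairs (sum, second
  bit), and the side information is concatenated.\<close>

definition interleave :: "nat \<Rightarrow> nat \<Rightarrow>
    ((nat \<Rightarrow> bit) \<times> (nat \<Rightarrow> 'w)) \<times> ((nat \<Rightarrow> bit) \<times> (nat \<Rightarrow> 'w)) \<Rightarrow> (nat \<Rightarrow> bit) \<times> (nat \<Rightarrow> 'w)" where
  "interleave n k = (\<lambda>((r1, w1), (r2, w2)).
     (\<lambda>i\<in>{..<2 * k}. if even i then r1 (i div 2) + r2 (i div 2) else r2 (i div 2),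
      \<lambda>l\<in>{..<2 ^ Suc n}. join n w1 w2 l))"

text \<open>Odd positions reveal the second past, and adding it to the even positions reveals the
  first. Extensionality fixes the values beyond the index ranges.\<close>

lemma inj_on_interleave:
  fixes n k :: nat
  defines "S \<equiv> extensional {..<k} \<times> extensional {..<2 ^ n}"
  shows "inj_on (interleave n k) (S \<times> S)"
proof (rule inj_onI, clarsimp simp: S_def interleave_def)
  fix r1 r2 r1' r2' :: "nat \<Rightarrow> bit" and w1 w2 w1' w2' :: "nat \<Rightarrow> 'b"
  assume ext: "r1 \<in> extensional {..<k}" "r2 \<in> extensional {..<k}" "r1' \<in> extensional {..<k}"
    "r2' \<in> extensional {..<k}" "w1 \<in> extensional {..<2 ^ n}" "w2 \<in> extensional {..<2 ^ n}"
    "w1' \<in> extensional {..<2 ^ n}" "w2' \<in> extensional {..<2 ^ n}"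
  assume r: "(\<lambda>i\<in>{..<2 * k}. if even i then r1 (i div 2) + r2 (i div 2) else r2 (i div 2)) =
      (\<lambda>i\<in>{..<2 * k}. if even i then r1' (i div 2) + r2' (i div 2) else r2' (i div 2))"
    and w: "restrict (join n w1 w2) {..<2 * 2 ^ n} = restrict (join n w1' w2') {..<2 * 2 ^ n}"
  have r2: "r2 i = r2' i" if "i < k" for i
    using fun_cong[OF r, of "2 * i + 1"] that by simp
  have r1: "r1 i = r1' i" if "i < k" for i
  proof -
    have "r1 i + r2 i = r1' i + r2 i" using fun_cong[OF r, of "2 * i"] that r2 by simp
    then show ?thesis by (metis bit_add_cancel(1))
  qed
  have w1: "w1 l = w1' l" if "l < 2 ^ n" for l
    using fun_cong[OF w, of l] that by (simp add: join_def)
  have w2: "w2 l = w2' l" if "l < 2 ^ n" for l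
    using fun_cong[OF w, of "2 ^ n + l"] that by (simp add: join_def)
  show "r1 = r1' \<and> w1 = w1' \<and> r2 = r2' \<and> w2 = w2'"
    using ext r1 r2 w1 w2 by (meson extensionalityI lessThan_iff)
qed

lemma set_polar_law_extensional:
  "snd ` set_pmf (polar_law n p k) \<subseteq> extensional {..<k} \<times> extensional {..<2 ^ n}"
  by (auto simp: polar_law_def Let_def)

lemma polar_join:
  fixes s1 s2 :: "nat \<Rightarrow> bit \<times> 'w"
  assumes "k < 2 ^ n"
  defines "u \<equiv> \<lambda>l. fst (join n s1 s2 l)"
    and "v1 \<equiv> polar n (\<lambda>l. fst (s1 l))" and "v2 \<equiv> polar n (\<lambda>l. fst (s2 l))"
  shows "polar (Suc n) u (2 * k) = v1 k + v2 k" "polar (Suc n) u (2 * k + 1) = v2 k"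
proof -
  have "polar n u = v1" "polar n (\<lambda>l. u (2 ^ n + l)) = v2"
    unfolding v1_def v2_def u_def by (rule polar_cong; simp add: join_def)+
  then show "polar (Suc n) u (2 * k) = v1 k + v2 k" "polar (Suc n) u (2 * k + 1) = v2 k"
    using polar_Suc[OF assms(1), of u] by simp_all
qed

lemma polar_join_observation:
  fixes s1 s2 :: "nat \<Rightarrow> bit \<times> 'w"
  assumes "k < 2 ^ n"
  shows "(restrict (polar (Suc n) (\<lambda>l. fst (join n s1 s2 l))) {..<2 * k},
      \<lambda>l\<in>{..<2 ^ Suc n}. snd (join n s1 s2 l)) =
    interleave n k
      ((restrict (polar n (\<lambda>l. fst (s1 l))) {..<k}, \<lambda>l\<in>{..<2 ^ n}. snd (s1 l)),
       (restrict (polar n (\<lambda>l. fst (s2 l))) {..<k}, \<lambda>l\<in>{..<2 ^ n}. snd (s2 l)))"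
proof -
  have "polar (Suc n) (\<lambda>l. fst (join n s1 s2 l)) i =
      (if even i then polar n (\<lambda>l. fst (s1 l)) (i div 2) + polar n (\<lambda>l. fst (s2 l)) (i div 2)
       else polar n (\<lambda>l. fst (s2 l)) (i div 2))" if "i < 2 * k" for i
    using that assms polar_join[of "i div 2" n s1 s2] by (cases "even i") auto
  then show ?thesis
    unfolding interleave_def by (auto simp: fun_eq_iff join_def)
qed

lemma polar_law_even:
  assumes "k < 2 ^ n"
  shows "polar_law (Suc n) p (2 * k) =
    map_pmf (\<lambda>(t, v). (t, interleave n k v)) (minus_law (polar_law n p k))"
  unfolding minus_law_def polar_law_def iid_Suc pair_map_pmf1 pair_map_pmf2 pmf.map_comp
  by (rule map_pmf_cong[OF refl])
     (simp add: Let_def case_prod_beta polar_join[OF assms] polar_join_observation[OF assms] del: power_Suc)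

lemma restrict_lessThan_Suc: "restrict v {..<Suc j} = (restrict v {..<j})(j := v j)"
  by (auto simp: fun_eq_iff less_Suc_eq)

lemma polar_law_odd:
  assumes "k < 2 ^ n"
  shows "polar_law (Suc n) p (2 * k + 1) =
    map_pmf (\<lambda>(t, v). (t, (\<lambda>(s, v). ((fst (interleave n k v))(2 * k := s), snd (interleave n k v))) v))
      (plus_law (polar_law n p k))"
proof -
  have obs: "restrict (polar (Suc n) (\<lambda>l. fst (join n s1 s2 l))) {..<2 * k} =
      fst (interleave n k
      ((restrict (polar n (\<lambda>l. fst (s1 l))) {..<k}, \<lambda>l\<in>{..<2 ^ n}. snd (s1 l)),
       (restrict (polar n (\<lambda>l. fst (s2 l))) {..<k}, \<lambda>l\<in>{..<2 ^ n}. snd (s2 l))))"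
    "(\<lambda>l\<in>{..<2 ^ Suc n}. snd (join n s1 s2 l)) =
      snd (interleave n k
      ((restrict (polar n (\<lambda>l. fst (s1 l))) {..<k}, \<lambda>l\<in>{..<2 ^ n}. snd (s1 l)),
       (restrict (polar n (\<lambda>l. fst (s2 l))) {..<k}, \<lambda>l\<in>{..<2 ^ n}. snd (s2 l))))"
    for s1 s2 :: "nat \<Rightarrow> bit \<times> 'a"
    unfolding polar_join_observation[OF assms, symmetric] by simp_all
  have upd: "restrict (polar (Suc n) (\<lambda>l. fst (join n s1 s2 l))) {..<2 * k + 1} =
      (fst (interleave n k
      ((restrict (polar n (\<lambda>l. fst (s1 l))) {..<k}, \<lambda>l\<in>{..<2 ^ n}. snd (s1 l)),
       (restrict (polar n (\<lambda>l. fst (s2 l))) {..<k}, \<lambda>l\<in>{..<2 ^ n}. snd (s2 l)))))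
      (2 * k := polar n (\<lambda>l. fst (s1 l)) k + polar n (\<lambda>l. fst (s2 l)) k)"
    for s1 s2 :: "nat \<Rightarrow> bit \<times> 'a"
    unfolding obs(1)[symmetric] polar_join(1)[OF assms, symmetric] Suc_eq_plus1[symmetric]
    by (rule restrict_lessThan_Suc)
  show ?thesis
    unfolding plus_law_def polar_law_def iid_Suc pair_map_pmf1 pair_map_pmf2 pmf.map_comp
    by (rule map_pmf_cong[OF refl])
       (clarify, simp only: o_def Let_def case_prod_conv fst_conv snd_conv apfst_conv apsnd_conv upd obs(2)
          polar_join[OF assms])
qed

lemma obs_sum_polar_law_even:
  assumes "k < 2 ^ n" "\<phi> 0 0 = 0"
  shows "obs_sum \<phi> (polar_law (Suc n) p (2 * k)) = obs_sum \<phi> (minus_law (polar_law n p k))"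
  unfolding polar_law_even[OF assms(1)]
proof (rule obs_sum_relabel[where \<phi> = \<phi>, OF _ assms(2)])
  show "inj_on (interleave n k) (snd ` set_pmf (minus_law (polar_law n p k)))"
    by (rule inj_on_subset[OF inj_on_interleave])
       (use set_polar_law_extensional[of n p k] in \<open>force simp: minus_law_def\<close>)
qed

lemma obs_sum_polar_law_odd:
  assumes "k < 2 ^ n" "\<phi> 0 0 = 0"
  shows "obs_sum \<phi> (polar_law (Suc n) p (2 * k + 1)) = obs_sum \<phi> (plus_law (polar_law n p k))"
  unfolding polar_law_odd[OF assms(1)]
proof (rule obs_sum_relabel[where \<phi> = \<phi>, OF _ assms(2)])
  let ?f = "\<lambda>(s, v). ((fst (interleave n k v))(2 * k := s), snd (interleave n k v))"
  let ?S = "extensional {..<k} \<times> extensional {..<2 ^ n} :: ((nat \<Rightarrow> bit) \<times> (nat \<Rightarrow> 'a)) set"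
  have "inj_on ?f (UNIV \<times> (?S \<times> ?S))"
  proof (rule inj_onI, clarify, goal_cases)
    case (1 s r1 w1 r2 w2 s' r1' w1' r2' w2')
    let ?v = "((r1, w1), (r2, w2))" and ?v' = "((r1', w1'), (r2', w2'))"
    have upd: "(fst (interleave n k ?v))(2 * k := s) = (fst (interleave n k ?v'))(2 * k := s')"
      and snd: "snd (interleave n k ?v) = snd (interleave n k ?v')" using 1 by simp_all
    have s: "s = s'" using fun_cong[OF upd, of "2 * k"] by simp
    \<comment> \<open>Position \<open>2 * k\<close> is still blank in the interleaved past, so
      overwriting it with the new bit \<open>s\<close> can be undone.\<close>
    have "fst (interleave n k v) (2 * k) = undefined" for v :: "((nat \<Rightarrow> bit) \<times> (nat \<Rightarrow> 'a)) \<times> ((nat \<Rightarrow> bit) \<times> (nat \<Rightarrow> 'a))"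
      by (simp add: interleave_def case_prod_beta)
    then have "fst (interleave n k ?v) = fst (interleave n k ?v')"
      using upd by (metis fun_upd_triv fun_upd_upd)
    then have "interleave n k ?v = interleave n k ?v'" using snd by (simp add: prod_eq_iff)
    then have "?v = ?v'"
      by (rule inj_onD[OF inj_on_interleave]) (use 1 in auto)
    then show ?case using s by simp
  qed
  then show "inj_on ?f (snd ` set_pmf (plus_law (polar_law n p k)))"
    by (rule inj_on_subset)
       (use set_polar_law_extensional[of n p k] in \<open>force simp: plus_law_def\<close>)
qed

lemma polar_cond_Z_eq: "finite (set_pmf p) \<Longrightarrow> polar_cond_Z n p k = obs_sum Z_fun (polar_law n p k)"
  by (simp add: polar_cond_Z_def polar_law_def[symmetric] bhattacharyya_eq_obs_sum finite_set_polar_law)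

lemma obs_sum_polar_law_0:
  assumes "\<phi> 0 0 = 0"
  shows "obs_sum \<phi> (polar_law 0 p 0) = obs_sum \<phi> p"
proof -
  let ?f = "\<lambda>w. (\<lambda>_. undefined, \<lambda>l\<in>{..<1}. w) :: (nat \<Rightarrow> bit) \<times> (nat \<Rightarrow> 'a)"
  have "iid 0 p = map_pmf (\<lambda>z l. if l = 0 then z else undefined) p"
    by (simp add: iid_def lessThan_Suc Pi_pmf_singleton)
  then have "polar_law 0 p 0 = map_pmf (\<lambda>(t, w). (t, ?f w)) p"
    unfolding polar_law_def
    by (simp add: pmf.map_comp) (intro map_pmf_cong refl, auto simp: polar_0 fun_eq_iff)
  moreover have "inj_on ?f (snd ` set_pmf p)"
    by (rule inj_onI) (metis lessThan_iff prod.inject restrict_apply' zero_less_one)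
  ultimately show ?thesis by (simp only: obs_sum_relabel assms)
qed

section \<open>Source polarization\<close>

lemma parity_child:
  fixes k :: nat
  assumes "k < 2 ^ Suc n"
  shows "k div 2 < 2 ^ n" "k mod 2 = 0 \<Longrightarrow> k = 2 * (k div 2)" "k mod 2 = Suc 0 \<Longrightarrow> k = 2 * (k div 2) + 1"
proof -
  show "k div 2 < 2 ^ n" using assms by auto
qed presburger+

text \<open>With \<open>y = sqrt z\<close> and \<open>q = sqrt (2 - z)\<close> the left side is
  \<open>y * (q + y)\<close>. Since \<open>q^2 + y^2 = 2\<close> and
  \<open>(q * y)^2 = 1 - (1 - z)^2\<close>, the factor \<open>q + y\<close> falls short of 2 by at
  least \<open>(1 - z)^2 / 4\<close>.\<close>

lemma sqrt_potential_drop: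
  assumes "0 \<le> z" "z \<le> 1"
  shows "sqrt (2 * z - z\<^sup>2) + sqrt (z\<^sup>2) \<le> 2 * sqrt z - sqrt z * (1 - z)\<^sup>2 / 4"
proof -
  define y where "y = sqrt z"
  define q where "q = sqrt (2 - z)"
  define w where "w = (1 - z)\<^sup>2"
  have y: "0 \<le> y" "y * y = z" and q: "0 \<le> q" "q * q = 2 - z" using assms by (simp_all add: y_def q_def)
  have w: "0 \<le> w" "w \<le> 1" using assms by (simp_all add: w_def power_le_one)
  have *: "q * y \<le> 1 - w / 2"
  proof (rule power2_le_imp_le)
    have "(q * y)\<^sup>2 = (q * q) * (y * y)" by (simp add: power2_eq_square)
    also have "\<dots> = 1 - w" unfolding q y by (simp add: w_def power2_eq_square algebra_simps)
    also have "\<dots> \<le> (1 - w / 2)\<^sup>2" by (simp add: power2_eq_square algebra_simps)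
    finally show "(q * y)\<^sup>2 \<le> (1 - w / 2)\<^sup>2" .
  qed (use w in simp)
  have "q + y \<le> 2 - w / 4"
  proof (rule power2_le_imp_le)
    have "(q + y)\<^sup>2 = q * q + y * y + 2 * (q * y)" by (simp add: power2_eq_square algebra_simps)
    also have "\<dots> \<le> 4 - w" using * q y by simp
    also have "\<dots> \<le> (2 - w / 4)\<^sup>2" by (simp add: power2_eq_square algebra_simps)
    finally show "(q + y)\<^sup>2 \<le> (2 - w / 4)\<^sup>2" .
  qed (use w in simp)
  then have "y * (q + y) \<le> y * (2 - w / 4)" using y by (intro mult_left_mono)
  moreover have "sqrt (2 * z - z\<^sup>2) = y * q"
    unfolding y_def q_def real_sqrt_mult[symmetric] by (simp add: algebra_simps power2_eq_square)
  moreover have "sqrt (z\<^sup>2) = y * y" using assms y by simp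
  ultimately show ?thesis by (simp add: y_def[symmetric] w_def[symmetric] algebra_simps)
qed

lemma \<delta>_pos: "\<delta> \<beta> n > 0"
  by (simp add: \<delta>_def)

lemma \<delta>_less_half:
  assumes "\<beta> > 0" "n \<ge> 1"
  shows "\<delta> \<beta> n < 1 / 2"
proof -
  have "(1::real) < 2 ^ n" using assms(2) by simp
  then have "(2 ^ n) powr \<beta> > (1::real)" using gr_one_powr assms(1) by blast
  then have "2 powr (- ((2 ^ n) powr \<beta>)) < (2::real) powr (-1)" by (intro powr_less_mono) auto
  then show ?thesis by (simp add: \<delta>_def powr_minus_divide)
qed

context
  fixes p :: "(bit \<times> 'w) pmf"
  assumes fin: "finite (set_pmf p)"
begin

private abbreviation "z n k \<equiv> obs_sum Z_fun (polar_law n p k)"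
private abbreviation "t n k \<equiv> obs_sum T_fun (polar_law n p k)"
private abbreviation "h n k \<equiv> obs_sum H_fun (polar_law n p k)"

private lemmas finite_law = finite_set_polar_law[OF fin]

lemma Z_polar_law_even: "k < 2 ^ n \<Longrightarrow> z (Suc n) (2 * k) \<le> 2 * z n k - (z n k)\<^sup>2"
  by (simp add: obs_sum_polar_law_even Z_minus_law finite_law)

lemma Z_polar_law_odd: "k < 2 ^ n \<Longrightarrow> z (Suc n) (2 * k + 1) = (z n k)\<^sup>2"
  using obs_sum_polar_law_odd[of k n Z_fun p] by (simp add: Z_plus_law finite_law)

lemma T_polar_law_even: "k < 2 ^ n \<Longrightarrow> t (Suc n) (2 * k) = (t n k)\<^sup>2"
  by (simp add: obs_sum_polar_law_even T_minus_law finite_law)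

lemma T_polar_law_odd: "k < 2 ^ n \<Longrightarrow> t (Suc n) (2 * k + 1) \<le> 2 * t n k"
  using obs_sum_polar_law_odd[of k n T_fun p] by (simp add: T_plus_law finite_law)

lemma H_polar_law: "k < 2 ^ n \<Longrightarrow> h (Suc n) (2 * k) + h (Suc n) (2 * k + 1) = 2 * h n k"
  using obs_sum_polar_law_odd[of k n H_fun p]
  by (simp add: obs_sum_polar_law_even H_minus_plus_law finite_law)

lemma sum_H_polar_law: "(\<Sum>k<2 ^ n. h n k) = 2 ^ n * obs_sum H_fun p"
proof (induction n)
  case 0
  then show ?case by (simp add: obs_sum_polar_law_0)
next
  case (Suc n)
  have "(\<Sum>k<2 ^ Suc n. h (Suc n) k) = (\<Sum>k<2 ^ n. 2 * h n k)"
    unfolding sum_pow2_Suc by (rule sum.cong) (use H_polar_law in auto)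
  then show ?case using Suc.IH by (simp add: sum_distrib_left[symmetric])
qed

private lemma z_bounds: "0 \<le> z n k" "z n k \<le> 1"
  by (simp_all add: Z_nonneg Z_le_1 finite_law)

lemma fraction_unpolarized_tendsto_0:
  assumes \<epsilon>: "0 < \<epsilon>"
  shows "(\<lambda>n. fraction n (\<lambda>k. \<epsilon> \<le> z n k \<and> z n k \<le> 1 - \<epsilon>)) \<longlonglongrightarrow> 0"
proof -
  define S where "S n = (\<Sum>k<2 ^ n. sqrt (z n k)) / 2 ^ n" for n
  let ?M = "\<lambda>n k. \<epsilon> \<le> z n k \<and> z n k \<le> 1 - \<epsilon>"
  \<comment> \<open>For an unpolarized node \<open>sqrt z \<ge> z \<ge> \<epsilon>\<close> and
    \<open>(1 - z)^2 \<ge> \<epsilon>^2\<close>, so its two children together lose at least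
    \<open>\<epsilon> * \<epsilon>^2 / 4 = 2 * \<kappa>\<close>.\<close>
  define \<kappa> where "\<kappa> = \<epsilon> * \<epsilon>\<^sup>2 / 8"
  have \<kappa>: "\<kappa> > 0" using \<epsilon> by (simp add: \<kappa>_def)
  have step: "\<kappa> * fraction n (?M n) \<le> S n - S (Suc n)" for n
  proof -
    have drop: "sqrt (z (Suc n) (2 * k)) + sqrt (z (Suc n) (2 * k + 1)) \<le>
        2 * sqrt (z n k) - 2 * (if ?M n k then \<kappa> else 0)" if "k < 2 ^ n" for k
    proof -
      have "sqrt (z (Suc n) (2 * k)) + sqrt (z (Suc n) (2 * k + 1)) \<le>
          sqrt (2 * z n k - (z n k)\<^sup>2) + sqrt ((z n k)\<^sup>2)"
        unfolding Z_polar_law_odd[OF that]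
        by (intro add_right_mono real_sqrt_le_mono Z_polar_law_even that)
      also have "\<dots> \<le> 2 * sqrt (z n k) - sqrt (z n k) * (1 - z n k)\<^sup>2 / 4"
        by (rule sqrt_potential_drop) (rule z_bounds)+
      finally have "sqrt (z (Suc n) (2 * k)) + sqrt (z (Suc n) (2 * k + 1)) \<le>
          2 * sqrt (z n k) - sqrt (z n k) * (1 - z n k)\<^sup>2 / 4" .
      moreover have "sqrt (z n k) * (1 - z n k)\<^sup>2 / 4 \<ge> 2 * (if ?M n k then \<kappa> else 0)"
      proof (cases "?M n k")
        case True
        have "z n k * z n k \<le> z n k * 1" using z_bounds[of n k] by (intro mult_left_mono)
        then have "z n k \<le> sqrt (z n k)"
          by (intro real_le_rsqrt) (simp add: power2_eq_square)
        then have "\<epsilon> \<le> sqrt (z n k)" using True by simp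
        moreover have "\<epsilon>\<^sup>2 \<le> (1 - z n k)\<^sup>2" using True \<epsilon> by (intro power_mono) auto
        ultimately have "\<epsilon> * \<epsilon>\<^sup>2 \<le> sqrt (z n k) * (1 - z n k)\<^sup>2"
          using \<epsilon> z_bounds[of n k] by (intro mult_mono) auto
        then show ?thesis using True by (simp add: \<kappa>_def)
      qed (use z_bounds[of n k] in auto)
      ultimately show ?thesis by linarith
    qed
    have "(\<Sum>k<2 ^ Suc n. sqrt (z (Suc n) k)) \<le>
        (\<Sum>k<2 ^ n. 2 * sqrt (z n k) - 2 * (if ?M n k then \<kappa> else 0))"
      unfolding sum_pow2_Suc by (rule sum_mono) (use drop in auto)
    also have "\<dots> = 2 * (\<Sum>k<2 ^ n. sqrt (z n k)) - 2 * (\<kappa> * card {k \<in> {..<2 ^ n}. ?M n k})"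
      by (simp add: sum_subtractf sum_distrib_left[symmetric] sum.If_cases Int_def)
    finally show ?thesis by (simp add: S_def fraction_def field_simps)
  qed
  have S: "0 \<le> S n" "S n \<le> 1" for n
  proof -
    show "0 \<le> S n" unfolding S_def using z_bounds by (intro divide_nonneg_pos sum_nonneg) auto
    have "(\<Sum>k<2 ^ n. sqrt (z n k)) \<le> (\<Sum>k<(2::nat) ^ n. 1)"
      by (rule sum_mono) (use z_bounds in auto)
    then show "S n \<le> 1" by (simp add: S_def field_simps)
  qed
  have "summable (\<lambda>n. \<kappa> * fraction n (?M n))"
  proof (rule summableI_nonneg_bounded)
    show "0 \<le> \<kappa> * fraction n (?M n)" for n using \<kappa> fraction_nonneg by simp
    have "(\<Sum>i<n. \<kappa> * fraction i (?M i)) \<le> S 0 - S n" for n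
    proof (induction n)
      case (Suc n)
      then show ?case using step[of n] by simp
    qed simp
    then show "(\<Sum>i<n. \<kappa> * fraction i (?M i)) \<le> 1" for n using S(1)[of n] S(2)[of 0] by (smt (verit))
  qed
  then have "(\<lambda>n. \<kappa> * fraction n (?M n)) \<longlonglongrightarrow> 0" by (rule summable_LIMSEQ_zero)
  then have "(\<lambda>n. inverse \<kappa> * (\<kappa> * fraction n (?M n))) \<longlonglongrightarrow> inverse \<kappa> * 0" by (rule tendsto_mult_left)
  then show ?thesis using \<kappa> by (simp add: mult.assoc[symmetric])
qed

text \<open>Up to \<open>C * \<epsilon>\<close>, and up to 1 at unpolarized nodes, the entropy of a
  node is the indicator of \<open>Z\<close> being near 1. As the entropies of a level have the fixed
  mean \<open>H(U|W)\<close>, both polarized fractions are pinned down.\<close>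

lemma average_H_bounds:
  fixes \<epsilon> :: real
  assumes \<epsilon>: "0 < \<epsilon>" "\<epsilon> < 1 / 2"
  defines "C \<equiv> 2 / ln 2 :: real"
  defines "a \<equiv> \<lambda>n. fraction n (\<lambda>k. z n k < \<epsilon>)" and "b \<equiv> \<lambda>n. fraction n (\<lambda>k. z n k > 1 - \<epsilon>)"
    and "m \<equiv> \<lambda>n. fraction n (\<lambda>k. \<epsilon> \<le> z n k \<and> z n k \<le> 1 - \<epsilon>)"
  shows "b n \<ge> obs_sum H_fun p - C * \<epsilon> - m n" "a n \<ge> 1 - obs_sum H_fun p - C * \<epsilon> - m n"
proof -
  let ?H = "obs_sum H_fun p"
  have C: "C > 0" by (simp add: C_def)
  have "m n + b n = fraction n (\<lambda>k. \<not> z n k < \<epsilon>)"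
    unfolding m_def b_def
    by (subst fraction_disjoint_add) (use \<epsilon> in \<open>auto intro!: arg_cong[where f = "fraction n"]\<close>)
  then have total: "a n + (m n + b n) = 1" by (simp add: a_def fraction_not)
  have avg: "?H = (\<Sum>k<2 ^ n. h n k) / 2 ^ n" by (simp add: sum_H_polar_law)
  have ind: "(\<Sum>k<2 ^ n. if P k then x else 0) / 2 ^ n = x * fraction n P" for x :: real and P
    by (simp add: sum.If_cases Int_def fraction_def)
  have "h n k \<le> C * \<epsilon> + (if z n k > 1 - \<epsilon> then 1 else 0) + (if \<epsilon> \<le> z n k \<and> z n k \<le> 1 - \<epsilon> then 1 else 0)"
    for k
  proof (cases "z n k < \<epsilon>")
    case True
    have "h n k \<le> C * z n k" unfolding C_def by (rule H_bounds) (rule finite_law)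
    also have "\<dots> \<le> C * \<epsilon>" using True C by simp
    finally show ?thesis using True \<epsilon> by simp
  next
    case False
    have "h n k \<le> 1" by (rule H_bounds) (rule finite_law)
    moreover have "0 \<le> C * \<epsilon>" using C \<epsilon> by simp
    ultimately show ?thesis using False by auto
  qed
  then have "(\<Sum>k<2 ^ n. h n k) \<le> (\<Sum>k<2 ^ n. C * \<epsilon> + (if z n k > 1 - \<epsilon> then 1 else 0) +
      (if \<epsilon> \<le> z n k \<and> z n k \<le> 1 - \<epsilon> then 1 else 0))" by (intro sum_mono)
  then have "?H \<le> (\<Sum>k<2 ^ n. C * \<epsilon> + (if z n k > 1 - \<epsilon> then 1 else 0) +
      (if \<epsilon> \<le> z n k \<and> z n k \<le> 1 - \<epsilon> then 1 else 0)) / 2 ^ n"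
    unfolding avg by (rule divide_right_mono) simp
  also have "\<dots> = C * \<epsilon> + b n + m n"
    unfolding sum.distrib add_divide_distrib ind by (simp add: b_def m_def)
  finally show "b n \<ge> ?H - C * \<epsilon> - m n" by simp
  have "h n k \<ge> (if z n k > 1 - \<epsilon> then 1 else 0) - C * \<epsilon>" for k
  proof (cases "z n k > 1 - \<epsilon>")
    case True
    have "C * (1 - z n k) \<le> C * \<epsilon>" using True C by (intro mult_left_mono) auto
    moreover have "h n k \<ge> 1 - C * (1 - z n k)" unfolding C_def by (rule H_bounds) (rule finite_law)
    ultimately show ?thesis using True by simp
  next
    case False
    have "h n k \<ge> 0" by (rule H_bounds) (rule finite_law)
    moreover have "0 \<le> C * \<epsilon>" using C \<epsilon> by simp
    ultimately show ?thesis using False by simp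
  qed
  then have "(\<Sum>k<2 ^ n. (if z n k > 1 - \<epsilon> then 1 else 0) - C * \<epsilon>) \<le> (\<Sum>k<2 ^ n. h n k)"
    by (intro sum_mono)
  then have "(\<Sum>k<2 ^ n. (if z n k > 1 - \<epsilon> then 1 else 0) - C * \<epsilon>) / 2 ^ n \<le> ?H"
    unfolding avg by (rule divide_right_mono) simp
  also have "(\<Sum>k<2 ^ n. (if z n k > 1 - \<epsilon> then 1 else 0) - C * \<epsilon>) / 2 ^ n = b n - C * \<epsilon>"
    unfolding sum_subtractf diff_divide_distrib ind by (simp add: b_def)
  finally show "a n \<ge> 1 - ?H - C * \<epsilon> - m n" using total by simp
qed

lemma slow_polarization:
  assumes \<epsilon>: "0 < \<epsilon>" and \<eta>: "0 < \<eta>"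
  shows "eventually (\<lambda>n. fraction n (\<lambda>k. z n k \<le> \<epsilon>) \<ge> 1 - obs_sum H_fun p - \<eta>) sequentially"
    and "eventually (\<lambda>n. fraction n (\<lambda>k. z n k \<ge> 1 - \<epsilon>) \<ge> obs_sum H_fun p - \<eta>) sequentially"
proof -
  define C :: real where "C = 2 / ln 2"
  have C: "C > 0" by (simp add: C_def)
  \<comment> \<open>A threshold sharper than the requested one, below \<open>1 / 2\<close> so that
    the two ends are disjoint, and with \<open>C * \<epsilon>' \<le> \<eta> / 2\<close> to leave the
    other half of \<eta> for the unpolarized nodes.\<close>
  define \<epsilon>' where "\<epsilon>' = min (min \<epsilon> (1 / 4)) (\<eta> / (2 * C))"
  have \<epsilon>': "0 < \<epsilon>'" "\<epsilon>' < 1 / 2" "\<epsilon>' \<le> \<epsilon>" using \<epsilon> \<eta> C by (auto simp: \<epsilon>'_def)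
  have "\<epsilon>' \<le> \<eta> / (2 * C)" by (simp add: \<epsilon>'_def)
  then have C\<epsilon>: "C * \<epsilon>' \<le> \<eta> / 2" using C by (simp add: field_simps)
  have m: "eventually (\<lambda>n. fraction n (\<lambda>k. \<epsilon>' \<le> z n k \<and> z n k \<le> 1 - \<epsilon>') < \<eta> / 2) sequentially"
    by (rule order_tendstoD(2)[OF fraction_unpolarized_tendsto_0[OF \<epsilon>'(1)]]) (use \<eta> in simp)
  show "eventually (\<lambda>n. fraction n (\<lambda>k. z n k \<le> \<epsilon>) \<ge> 1 - obs_sum H_fun p - \<eta>) sequentially"
    using m
  proof eventually_elim
    case (elim n)
    have "fraction n (\<lambda>k. z n k < \<epsilon>') \<le> fraction n (\<lambda>k. z n k \<le> \<epsilon>)"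
      by (rule fraction_mono) (use \<epsilon>' in auto)
    then show ?case
      using average_H_bounds(2)[OF \<epsilon>'(1,2), of n] C\<epsilon> elim by (simp add: C_def)
  qed
  show "eventually (\<lambda>n. fraction n (\<lambda>k. z n k \<ge> 1 - \<epsilon>) \<ge> obs_sum H_fun p - \<eta>) sequentially"
    using m
  proof eventually_elim
    case (elim n)
    have "fraction n (\<lambda>k. z n k > 1 - \<epsilon>') \<le> fraction n (\<lambda>k. z n k \<ge> 1 - \<epsilon>)"
      by (rule fraction_mono) (use \<epsilon>' in auto)
    then show ?case
      using average_H_bounds(1)[OF \<epsilon>'(1,2), of n] C\<epsilon> elim by (simp add: C_def)
  qed
qed

lemma fast_polarization_low:
  assumes "0 < \<beta>" "\<beta> < 1 / 2" "0 < \<eta>"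
  shows "eventually (\<lambda>n. fraction n (\<lambda>k. z n k \<le> \<delta> \<beta> n) \<ge> 1 - obs_sum H_fun p - \<eta>) sequentially"
proof (rule fast_polarization[where c = 1])
  show "z (Suc n) k \<le> (z n (k div 2))\<^sup>2" if "k < 2 ^ Suc n" "k mod 2 = 1" for n k
    using Z_polar_law_odd[of "k div 2" n] parity_child[OF that(1)] that(2) by simp
  show "z (Suc n) k \<le> 2 * z n (k div 2)" if "k < 2 ^ Suc n" "k mod 2 \<noteq> 1" for n k
  proof -
    have "z (Suc n) k \<le> 2 * z n (k div 2) - (z n (k div 2))\<^sup>2"
      using Z_polar_law_even[of "k div 2" n] parity_child[OF that(1)] that(2) by simp
    then show ?thesis by (smt (verit) zero_le_power2)
  qed
qed (use assms slow_polarization(1) Z_nonneg in auto)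

lemma fast_polarization_high:
  assumes "0 < \<beta>" "\<beta> < 1 / 2" "0 < \<eta>"
  shows "eventually (\<lambda>n. fraction n (\<lambda>k. z n k \<ge> 1 - \<delta> \<beta> n) \<ge> obs_sum H_fun p - \<eta>) sequentially"
proof -
  have "eventually (\<lambda>n. fraction n (\<lambda>k. t n k \<le> \<delta> \<beta> n) \<ge> obs_sum H_fun p - \<eta>) sequentially"
  proof (rule fast_polarization[where c = 0])
    show "t (Suc n) k \<le> (t n (k div 2))\<^sup>2" if "k < 2 ^ Suc n" "k mod 2 = 0" for n k
      using T_polar_law_even[of "k div 2" n] parity_child[OF that(1)] that(2) by simp
    show "t (Suc n) k \<le> 2 * t n (k div 2)" if "k < 2 ^ Suc n" "k mod 2 \<noteq> 0" for n k
      using T_polar_law_odd[of "k div 2" n] parity_child[OF that(1)] that(2) by simp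
    fix \<epsilon> \<eta> :: real assume \<epsilon>: "\<epsilon> > 0" and \<eta>: "\<eta> > 0"
    \<comment> \<open>\<open>Z \<ge> 1 - \<epsilon>^2 / 2\<close> gives
      \<open>T \<le> sqrt (2 * \<epsilon>^2 / 2) = \<epsilon>\<close>.\<close>
    have "\<epsilon>\<^sup>2 / 2 > 0" using \<epsilon> by simp
    from slow_polarization(2)[OF this \<eta>]
    show "eventually (\<lambda>n. fraction n (\<lambda>k. t n k \<le> \<epsilon>) \<ge> obs_sum H_fun p - \<eta>) sequentially"
    proof eventually_elim
      case (elim n)
      have "fraction n (\<lambda>k. z n k \<ge> 1 - \<epsilon>\<^sup>2 / 2) \<le> fraction n (\<lambda>k. t n k \<le> \<epsilon>)"
      proof (rule fraction_mono)
        fix k assume "1 - \<epsilon>\<^sup>2 / 2 \<le> z n k"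
        then have "sqrt (2 * (1 - z n k)) \<le> sqrt (\<epsilon>\<^sup>2)" by (intro real_sqrt_le_mono) simp
        then show "t n k \<le> \<epsilon>" using T_le_sqrt_Z[OF finite_law, of n k] \<epsilon> by simp
      qed
      with elim show ?case by simp
    qed
  qed (use assms T_nonneg in auto)
  then show ?thesis
  proof eventually_elim
    case (elim n)
    have "fraction n (\<lambda>k. t n k \<le> \<delta> \<beta> n) \<le> fraction n (\<lambda>k. z n k \<ge> 1 - \<delta> \<beta> n)"
    proof (rule fraction_mono)
      fix k assume "t n k \<le> \<delta> \<beta> n"
      then show "1 - \<delta> \<beta> n \<le> z n k" using one_minus_Z_le_T[OF finite_law, of n k] by simp
    qed
    with elim show ?case by simp
  qed
qed

text \<open>Lower bounds suffice: the two limits add up to 1 and the two sets are disjoint once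
  \<open>\<delta> < 1 / 2\<close>, so neither fraction can exceed its limit by a fixed
  amount.\<close>

theorem source_polarization:
  assumes \<beta>: "0 < \<beta>" "\<beta> < 1 / 2"
  shows "(\<lambda>n. real (card (low_cond_set \<beta> n p)) / 2 ^ n) \<longlonglongrightarrow> 1 - obs_sum H_fun p"
    and "(\<lambda>n. real (card (high_cond_set \<beta> n p)) / 2 ^ n) \<longlonglongrightarrow> obs_sum H_fun p"
proof -
  let ?a = "\<lambda>n. fraction n (\<lambda>k. z n k \<le> \<delta> \<beta> n)" and ?b = "\<lambda>n. fraction n (\<lambda>k. z n k \<ge> 1 - \<delta> \<beta> n)"
  let ?H = "obs_sum H_fun p"
  have eqs: "(\<lambda>n. real (card (low_cond_set \<beta> n p)) / 2 ^ n) = ?a"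
    "(\<lambda>n. real (card (high_cond_set \<beta> n p)) / 2 ^ n) = ?b"
    by (simp_all add: fraction_def low_cond_set_def high_cond_set_def polar_cond_Z_eq[OF fin])
  have sum: "eventually (\<lambda>n. ?a n + ?b n \<le> 1) sequentially"
    using eventually_ge_at_top[of 1]
  proof eventually_elim
    case (elim n)
    have "?a n + ?b n = fraction n (\<lambda>k. z n k \<le> \<delta> \<beta> n \<or> z n k \<ge> 1 - \<delta> \<beta> n)"
      by (rule fraction_disjoint_add) (use \<delta>_less_half[OF \<beta>(1) elim] in auto)
    then show ?case using fraction_le_1 by simp
  qed
  have a: "eventually (\<lambda>n. ?a n \<ge> 1 - ?H - \<eta>) sequentially"
    and b: "eventually (\<lambda>n. ?b n \<ge> ?H - \<eta>) sequentially" if "\<eta> > 0" for \<eta>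
    using fast_polarization_low[OF \<beta> that] fast_polarization_high[OF \<beta> that] by simp_all
  have dist: "eventually (\<lambda>n. dist (?a n) (1 - ?H) < \<eta> \<and> dist (?b n) ?H < \<eta>) sequentially"
    if "\<eta> > 0" for \<eta>
  proof -
    have "\<eta> / 2 > 0" using that by simp
    from sum a[OF this] b[OF this] show ?thesis
    proof eventually_elim
      case (elim n)
      then show ?case using that unfolding dist_real_def by linarith
    qed
  qed
  show "(\<lambda>n. real (card (low_cond_set \<beta> n p)) / 2 ^ n) \<longlonglongrightarrow> 1 - ?H"
    unfolding eqs by (rule tendstoI, rule eventually_mono[OF dist]) auto
  show "(\<lambda>n. real (card (high_cond_set \<beta> n p)) / 2 ^ n) \<longlonglongrightarrow> ?H"
    unfolding eqs by (rule tendstoI, rule eventually_mono[OF dist]) auto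
qed

end

section \<open>Total variation\<close>

lemma integrable_unit_bounded:
  fixes g :: "'a \<Rightarrow> real"
  assumes "\<forall>x. 0 \<le> g x \<and> g x \<le> 1"
  shows "integrable (measure_pmf p) g"
  by (rule measure_pmf.integrable_const_bound[where B = 1]) (use assms in auto)

lemma expectation_unit_bounded:
  fixes g :: "'a \<Rightarrow> real"
  assumes "\<forall>x. 0 \<le> g x \<and> g x \<le> 1"
  shows "0 \<le> measure_pmf.expectation p g" "measure_pmf.expectation p g \<le> 1"
proof -
  show "0 \<le> measure_pmf.expectation p g" by (rule integral_nonneg_AE) (use assms in auto)
  have "measure_pmf.expectation p g \<le> measure_pmf.expectation p (\<lambda>_. 1)"
    by (rule integral_mono) (use assms integrable_unit_bounded in auto)
  then show "measure_pmf.expectation p g \<le> 1" by simp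
qed

lemma expectation_bind_unit_bounded:
  fixes g :: "'b \<Rightarrow> real"
  assumes g: "\<forall>x. 0 \<le> g x \<and> g x \<le> 1"
  shows "measure_pmf.expectation (bind_pmf p f) g =
    measure_pmf.expectation p (\<lambda>x. measure_pmf.expectation (f x) g)"
proof -
  have nn: "(\<integral>\<^sup>+x. ennreal (g' x) \<partial>measure_pmf q) = ennreal (measure_pmf.expectation q g')"
    if "\<forall>x. 0 \<le> g' x \<and> g' x \<le> 1" for g' :: "'c \<Rightarrow> real" and q
    by (rule nn_integral_eq_integral[OF integrable_unit_bounded[OF that]]) (use that in auto)
  have E: "\<forall>x. 0 \<le> measure_pmf.expectation (f x) g \<and> measure_pmf.expectation (f x) g \<le> 1"
    using expectation_unit_bounded[OF g] by blast
  have "ennreal (measure_pmf.expectation (bind_pmf p f) g) =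
      (\<integral>\<^sup>+x. \<integral>\<^sup>+y. ennreal (g y) \<partial>f x \<partial>p)"
    by (subst nn[OF g, symmetric]) simp
  also have "\<dots> = (\<integral>\<^sup>+x. ennreal (measure_pmf.expectation (f x) g) \<partial>p)"
    by (simp add: nn[OF g])
  also have "\<dots> = ennreal (measure_pmf.expectation p (\<lambda>x. measure_pmf.expectation (f x) g))"
    by (rule nn[OF E])
  finally show ?thesis
    using expectation_unit_bounded[OF g] expectation_unit_bounded[OF E] by (subst (asm) ennreal_inj) auto
qed

text \<open>Test functions with values in the unit interval are used instead of events because they
  are stable under kernels: averaging a test function over a kernel gives another one, and a bound
  on the input passes through a bind.\<close>

definition tv_le :: "real \<Rightarrow> 'a pmf \<Rightarrow> 'a pmf \<Rightarrow> bool" where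
  "tv_le \<epsilon> p q \<longleftrightarrow> (\<forall>g. (\<forall>x. 0 \<le> g x \<and> g x \<le> 1) \<longrightarrow>
     \<bar>measure_pmf.expectation p g - measure_pmf.expectation q g\<bar> \<le> \<epsilon>)"

lemma tv_leI:
  assumes "\<And>g. \<forall>x. 0 \<le> g x \<and> g x \<le> 1 \<Longrightarrow>
    \<bar>measure_pmf.expectation p g - measure_pmf.expectation q g\<bar> \<le> \<epsilon>"
  shows "tv_le \<epsilon> p q"
  using assms by (simp add: tv_le_def)

lemma tv_leD:
  assumes "tv_le \<epsilon> p q" "\<forall>x. 0 \<le> g x \<and> g x \<le> 1"
  shows "\<bar>measure_pmf.expectation p g - measure_pmf.expectation q g\<bar> \<le> \<epsilon>"
  using assms by (auto simp: tv_le_def)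

lemma tv_le_refl: "0 \<le> \<epsilon> \<Longrightarrow> tv_le \<epsilon> p p"
  by (simp add: tv_le_def)

lemma tv_le_mono: "tv_le \<epsilon> p q \<Longrightarrow> \<epsilon> \<le> \<epsilon>' \<Longrightarrow> tv_le \<epsilon>' p q"
  unfolding tv_le_def by (meson order_trans)

lemma tv_le_trans:
  assumes "tv_le \<epsilon> p q" "tv_le \<epsilon>' q r"
  shows "tv_le (\<epsilon> + \<epsilon>') p r"
proof (rule tv_leI)
  fix g :: "'a \<Rightarrow> real" assume g: "\<forall>x. 0 \<le> g x \<and> g x \<le> 1"
  show "\<bar>measure_pmf.expectation p g - measure_pmf.expectation r g\<bar> \<le> \<epsilon> + \<epsilon>'"
    using tv_leD[OF assms(1) g] tv_leD[OF assms(2) g] by linarith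
qed

lemma tv_le_bind:
  assumes "tv_le \<epsilon> p q"
  shows "tv_le \<epsilon> (bind_pmf p f) (bind_pmf q f)"
proof (rule tv_leI)
  fix g :: "'b \<Rightarrow> real" assume g: "\<forall>x. 0 \<le> g x \<and> g x \<le> 1"
  show "\<bar>measure_pmf.expectation (p \<bind> f) g - measure_pmf.expectation (q \<bind> f) g\<bar> \<le> \<epsilon>"
    unfolding expectation_bind_unit_bounded[OF g]
    by (rule tv_leD[OF assms]) (use expectation_unit_bounded[OF g] in blast)
qed

lemma tv_le_map: "tv_le \<epsilon> p q \<Longrightarrow> tv_le \<epsilon> (map_pmf f p) (map_pmf f q)"
  unfolding map_pmf_def by (rule tv_le_bind)

text \<open>The error may depend on the input and only its mean has to be small, which is all that a
  bound on \<open>Z\<close> or \<open>T\<close> provides.\<close>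

lemma tv_le_bind_kernel:
  assumes fin: "finite (set_pmf p)"
    and tv: "\<And>x. x \<in> set_pmf p \<Longrightarrow> tv_le (e x) (f x) (f' x)"
    and e: "measure_pmf.expectation p e \<le> \<epsilon>"
  shows "tv_le \<epsilon> (bind_pmf p f) (bind_pmf p f')"
proof (rule tv_leI)
  fix g :: "'b \<Rightarrow> real" assume g: "\<forall>x. 0 \<le> g x \<and> g x \<le> 1"
  let ?E = "\<lambda>f x. measure_pmf.expectation (f x) g"
  note int = integrable_measure_pmf_finite[OF fin]
  have "\<bar>measure_pmf.expectation p (?E f) - measure_pmf.expectation p (?E f')\<bar> =
      \<bar>measure_pmf.expectation p (\<lambda>x. ?E f x - ?E f' x)\<bar>"
    by (simp add: int)
  also have "\<dots> \<le> measure_pmf.expectation p (\<lambda>x. \<bar>?E f x - ?E f' x\<bar>)"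
    by (rule integral_abs_bound)
  also have "\<dots> \<le> measure_pmf.expectation p e"
    by (rule integral_mono_AE) (use tv_leD[OF tv g] int in \<open>auto simp: AE_measure_pmf_iff\<close>)
  finally show "\<bar>measure_pmf.expectation (p \<bind> f) g - measure_pmf.expectation (p \<bind> f') g\<bar> \<le> \<epsilon>"
    unfolding expectation_bind_unit_bounded[OF g] using e by linarith
qed

lemma tv_le_return: "tv_le (1 - pmf p x) p (return_pmf x)"
proof (rule tv_leI)
  fix g :: "'a \<Rightarrow> real" assume g: "\<forall>x. 0 \<le> g x \<and> g x \<le> 1"
  note int = integrable_unit_bounded[OF g]
  have "\<bar>measure_pmf.expectation p g - g x\<bar> = \<bar>measure_pmf.expectation p (\<lambda>y. g y - g x)\<bar>"
    using int by simp
  also have "\<dots> \<le> measure_pmf.expectation p (\<lambda>y. \<bar>g y - g x\<bar>)"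
    by (rule integral_abs_bound)
  also have "\<dots> \<le> measure_pmf.expectation p (\<lambda>y. 1 - indicator {x} y)"
  proof (rule integral_mono)
    show "integrable p (\<lambda>y. \<bar>g y - g x\<bar>)" using int by simp
    show "integrable p (\<lambda>y. 1 - indicator {x} y :: real)"
      by (rule integrable_unit_bounded) (auto simp: indicator_def)
    show "\<bar>g y - g x\<bar> \<le> 1 - indicator {x} y" for y
      using spec[OF g, of y] spec[OF g, of x] by (auto simp: indicator_def)
  qed
  also have "\<dots> = 1 - pmf p x"
    by (subst Bochner_Integration.integral_diff)
       (auto simp: measure_pmf_single intro!: integrable_unit_bounded)
  finally show "\<bar>measure_pmf.expectation p g - measure_pmf.expectation (return_pmf x) g\<bar> \<le> 1 - pmf p x"
    by simp
qed

lemma tv_le_prob: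
  assumes "tv_le \<epsilon> p q"
  shows "measure_pmf.prob p A \<ge> measure_pmf.prob q A - \<epsilon>"
  using tv_leD[OF assms, of "indicator A"] by (simp add: indicator_def abs_le_iff)

lemma pmf_bit_1: "pmf p (1::bit) = 1 - pmf p 0"
proof -
  have "(\<Sum>b\<in>{0, 1}. pmf p b) = 1" by (rule sum_pmf_eq_1) (use UNIV_bit in auto)
  then show ?thesis by simp
qed

lemma tv_le_bit: "tv_le \<bar>pmf p (0::bit) - pmf q 0\<bar> p q"
proof (rule tv_leI)
  fix g :: "bit \<Rightarrow> real" assume g: "\<forall>x. 0 \<le> g x \<and> g x \<le> 1"
  have E: "measure_pmf.expectation r g = g 0 * pmf r 0 + g 1 * (1 - pmf r 0)" for r
  proof -
    have "measure_pmf.expectation r g = (\<Sum>b\<in>{0, 1}. g b * pmf r b)"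
      by (rule integral_measure_pmf_real) (simp, metis bit.exhaust insertCI)
    then show ?thesis by (simp add: pmf_bit_1)
  qed
  have "measure_pmf.expectation p g - measure_pmf.expectation q g = (pmf p 0 - pmf q 0) * (g 0 - g 1)"
    unfolding E by (simp add: algebra_simps)
  also have "\<bar>\<dots>\<bar> \<le> \<bar>pmf p 0 - pmf q 0\<bar> * 1"
    unfolding abs_mult using spec[OF g, of 0] spec[OF g, of 1] by (intro mult_left_mono) auto
  finally show "\<bar>measure_pmf.expectation p g - measure_pmf.expectation q g\<bar> \<le> \<bar>pmf p 0 - pmf q 0\<bar>"
    by simp
qed

section \<open>Conditional laws\<close>

lemma pmf_bind_Pair: "pmf (bind_pmf p (\<lambda>x. map_pmf (Pair x) (f x))) (x, y) = pmf p x * pmf (f x) y"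
proof -
  have "pmf (map_pmf (Pair x') (f x')) (x, y) = indicator {x} x' * pmf (f x) y" for x'
  proof (cases "x' = x")
    case True
    then show ?thesis using pmf_map_inj'[of "Pair x" "f x" y] by (simp add: inj_on_def)
  next
    case False
    then have "(x, y) \<notin> set_pmf (map_pmf (Pair x') (f x'))" by auto
    then show ?thesis using False by (simp add: pmf_eq_0_set_pmf)
  qed
  then show ?thesis by (simp add: pmf_bind measure_pmf_single)
qed

lemma pmf_bind_ge: "pmf p x * pmf (f x) y \<le> pmf (bind_pmf p f) y"
proof -
  have "pmf p x * pmf (f x) y = measure_pmf.expectation p (\<lambda>x'. indicator {x} x' * pmf (f x) y)"
    by (simp add: measure_pmf_single)
  also have "\<dots> \<le> measure_pmf.expectation p (\<lambda>x'. pmf (f x') y)"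
    by (rule integral_mono)
       (auto simp: indicator_def pmf_le_1 mult_le_one intro!: integrable_unit_bounded)
  finally show ?thesis by (simp add: pmf_bind)
qed

lemma pmf_cond_law:
  assumes "v \<in> snd ` set_pmf R"
  shows "pmf (cond_law R d v) t = pmf R (t, v) / pmf (map_pmf snd R) v"
proof -
  have ne: "set_pmf R \<inter> {z. snd z = v} \<noteq> {}" using assms by auto
  have "fst -` {t} \<inter> {z. snd z = v} = {(t, v)}" by auto
  have "pmf (map_pmf fst (cond_pmf R {z. snd z = v})) t =
      measure_pmf.prob (cond_pmf R {z. snd z = v}) (fst -` {t} \<inter> set_pmf (cond_pmf R {z. snd z = v}))"
    by (simp add: pmf_map measure_Int_set_pmf)
  also have "\<dots> = measure_pmf.prob (cond_pmf R {z. snd z = v}) ({(t, v)} \<inter> set_pmf (cond_pmf R {z. snd z = v}))"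
    by (rule arg_cong[where f = "measure_pmf.prob _"]) (use ne in \<open>auto simp: set_cond_pmf\<close>)
  also have "\<dots> = pmf R (t, v) / measure_pmf.prob R {z. snd z = v}"
    by (simp add: measure_Int_set_pmf measure_pmf_single pmf_cond[OF ne])
  finally show ?thesis using assms by (simp add: cond_law_def pmf_map vimage_def)
qed

text \<open>
  \<open>\<alpha>\<close> is the whole past and \<open>\<phi> \<alpha>\<close> the part of it on which the law of \<open>v\<close> depends: the conditional
  law of \<open>\<tau> v\<close> given \<open>h v\<close> and \<open>\<alpha>\<close> is then the one given \<open>h v\<close> and \<open>\<phi> \<alpha>\<close>.
\<close>
lemma cond_law_conditionally_independent:
  fixes \<mu> :: "'a pmf" and \<phi> :: "'a \<Rightarrow> 'y" and K :: "'y \<Rightarrow> 'u pmf" and h :: "'u \<Rightarrow> 'h" and \<tau> :: "'u \<Rightarrow> 't"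
  assumes R: "R = bind_pmf \<mu> (\<lambda>\<alpha>. map_pmf (Pair \<alpha>) (K (\<phi> \<alpha>)))"
  shows "map_pmf (\<lambda>(\<alpha>, v). ((\<alpha>, h v), \<tau> v)) R =
    bind_pmf (map_pmf (\<lambda>(\<alpha>, v). (\<alpha>, h v)) R) (\<lambda>(\<alpha>, w). map_pmf (Pair (\<alpha>, w))
      (cond_law (map_pmf (\<lambda>(\<alpha>, v). (\<tau> v, (h v, \<phi> \<alpha>))) R) d (w, \<phi> \<alpha>)))"
    (is "?lhs = bind_pmf ?p _")
proof (rule pmf_eqI)
  fix z :: "('a \<times> 'h) \<times> 't"
  obtain \<alpha> w b where z: "z = ((\<alpha>, w), b)" by (metis prod.exhaust)
  let ?R' = "map_pmf (\<lambda>(\<alpha>, v). (\<tau> v, (h v, \<phi> \<alpha>))) R"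
  let ?A = "{v. h v = w \<and> \<tau> v = b}" and ?B = "{v. h v = w}"
  have map: "pmf (map_pmf f R) y = measure_pmf.expectation \<mu> (\<lambda>\<alpha>'. measure_pmf.prob (K (\<phi> \<alpha>')) {v. f (\<alpha>', v) = y})"
    for f :: "'a \<times> 'u \<Rightarrow> 'c" and y
  proof -
    have "map_pmf f R = bind_pmf \<mu> (\<lambda>\<alpha>'. map_pmf (\<lambda>v. f (\<alpha>', v)) (K (\<phi> \<alpha>')))"
      by (simp add: R map_bind_pmf pmf.map_comp o_def)
    then show ?thesis by (simp add: pmf_bind pmf_map vimage_def)
  qed
  \<comment> \<open>On the event \<open>P\<close> the kernel is the fixed one at
    \<open>\<phi> \<alpha>\<close>, so it leaves the expectation as a constant factor.\<close>
  have ind: "measure_pmf.expectation \<mu> (\<lambda>\<alpha>'. measure_pmf.prob (K (\<phi> \<alpha>')) {v. P \<alpha>' \<and> v \<in> S}) =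
      measure_pmf.prob \<mu> {\<alpha>'. P \<alpha>'} * measure_pmf.prob (K (\<phi> \<alpha>)) S"
    if "\<And>\<alpha>'. P \<alpha>' \<Longrightarrow> \<phi> \<alpha>' = \<phi> \<alpha>" for P S
  proof -
    have "measure_pmf.prob (K (\<phi> \<alpha>')) {v. P \<alpha>' \<and> v \<in> S} =
        indicator {\<alpha>'. P \<alpha>'} \<alpha>' * measure_pmf.prob (K (\<phi> \<alpha>)) S" for \<alpha>'
      using that[of \<alpha>'] by (auto simp: indicator_def)
    then show ?thesis by simp
  qed
  have lhs: "pmf ?lhs z = pmf \<mu> \<alpha> * measure_pmf.prob (K (\<phi> \<alpha>)) ?A"
    unfolding map z using ind[of "\<lambda>\<alpha>'. \<alpha>' = \<alpha>" ?A]
    by (simp add: case_prod_beta measure_pmf_single conj_assoc)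
  have p: "pmf ?p (\<alpha>, w) = pmf \<mu> \<alpha> * measure_pmf.prob (K (\<phi> \<alpha>)) ?B"
    unfolding map using ind[of "\<lambda>\<alpha>'. \<alpha>' = \<alpha>" ?B]
    by (simp add: case_prod_beta measure_pmf_single conj_assoc)
  have kernel: "(\<lambda>(\<alpha>, w). map_pmf (Pair (\<alpha>, w)) (cond_law ?R' d (w, \<phi> \<alpha>))) =
      (\<lambda>aw. map_pmf (Pair aw) (cond_law ?R' d (snd aw, \<phi> (fst aw))))"
  proof (rule ext)
    fix aw :: "'a \<times> 'h"
    show "(case aw of (\<alpha>, w) \<Rightarrow> map_pmf (Pair (\<alpha>, w)) (cond_law ?R' d (w, \<phi> \<alpha>))) =
      map_pmf (Pair aw) (cond_law ?R' d (snd aw, \<phi> (fst aw)))" by (cases aw) simp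
  qed
  have "pmf (bind_pmf ?p (\<lambda>(\<alpha>, w). map_pmf (Pair (\<alpha>, w)) (cond_law ?R' d (w, \<phi> \<alpha>)))) z =
      pmf (bind_pmf ?p (\<lambda>aw. map_pmf (Pair aw) (cond_law ?R' d (snd aw, \<phi> (fst aw))))) ((\<alpha>, w), b)"
    unfolding z kernel ..
  also have "\<dots> = pmf ?p (\<alpha>, w) * pmf (cond_law ?R' d (w, \<phi> \<alpha>)) b"
    by (simp only: pmf_bind_Pair fst_conv snd_conv)
  also have "\<dots> = pmf ?lhs z"
  proof (cases "(\<alpha>, w) \<in> set_pmf ?p")
    case True
    let ?m = "measure_pmf.prob \<mu> {\<alpha>'. \<phi> \<alpha>' = \<phi> \<alpha>}"
    have "(w, \<phi> \<alpha>) \<in> snd ` set_pmf ?R'" using True by force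
    then have "pmf (cond_law ?R' d (w, \<phi> \<alpha>)) b = pmf ?R' (b, (w, \<phi> \<alpha>)) / pmf (map_pmf snd ?R') (w, \<phi> \<alpha>)"
      by (rule pmf_cond_law)
    also have "pmf ?R' (b, (w, \<phi> \<alpha>)) = ?m * measure_pmf.prob (K (\<phi> \<alpha>)) ?A"
    proof -
      have "{v. \<tau> v = b \<and> h v = w \<and> \<phi> \<alpha>' = \<phi> \<alpha>} = {v. \<phi> \<alpha>' = \<phi> \<alpha> \<and> v \<in> ?A}" for \<alpha>' by auto
      then show ?thesis unfolding map using ind[of "\<lambda>\<alpha>'. \<phi> \<alpha>' = \<phi> \<alpha>" ?A] by (simp add: case_prod_beta)
    qed
    also have "pmf (map_pmf snd ?R') (w, \<phi> \<alpha>) = ?m * measure_pmf.prob (K (\<phi> \<alpha>)) ?B"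
    proof -
      have "{v. h v = w \<and> \<phi> \<alpha>' = \<phi> \<alpha>} = {v. \<phi> \<alpha>' = \<phi> \<alpha> \<and> v \<in> ?B}" for \<alpha>' by auto
      then show ?thesis unfolding pmf.map_comp map using ind[of "\<lambda>\<alpha>'. \<phi> \<alpha>' = \<phi> \<alpha>" ?B]
        by (simp add: case_prod_beta)
    qed
    finally have cond: "pmf (cond_law ?R' d (w, \<phi> \<alpha>)) b =
        ?m * measure_pmf.prob (K (\<phi> \<alpha>)) ?A / (?m * measure_pmf.prob (K (\<phi> \<alpha>)) ?B)" .
    have pos: "pmf \<mu> \<alpha> * measure_pmf.prob (K (\<phi> \<alpha>)) ?B \<noteq> 0"
      using True p by (metis pmf_eq_0_set_pmf)
    have "pmf \<mu> \<alpha> \<le> ?m"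
      unfolding measure_pmf_single[symmetric] by (rule measure_pmf.finite_measure_mono) auto
    moreover have "pmf \<mu> \<alpha> > 0" using pos by (simp add: pmf_positive_iff pmf_eq_0_set_pmf)
    ultimately have "?m \<noteq> 0" by linarith
    moreover have "x * y * (m' * z' / (m' * y)) = x * z'" if "m' \<noteq> 0" "x * y \<noteq> 0" for x y z' m' :: real
      using that by simp
    ultimately show ?thesis using pos unfolding lhs p cond by blast
  next
    case False
    then have "pmf ?p (\<alpha>, w) = 0" by (simp add: pmf_eq_0_set_pmf)
    moreover have "measure_pmf.prob (K (\<phi> \<alpha>)) ?A \<le> measure_pmf.prob (K (\<phi> \<alpha>)) ?B"
      by (rule measure_pmf.finite_measure_mono) auto
    ultimately have "pmf \<mu> \<alpha> * measure_pmf.prob (K (\<phi> \<alpha>)) ?A = 0"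
      unfolding p by (auto simp: measure_le_0_iff)
    with \<open>pmf ?p (\<alpha>, w) = 0\<close> show ?thesis unfolding lhs by simp
  qed
  finally show "pmf ?lhs z = pmf (bind_pmf ?p (\<lambda>(\<alpha>, w). map_pmf (Pair (\<alpha>, w)) (cond_law ?R' d (w, \<phi> \<alpha>)))) z"
    by simp
qed

lemma expectation_bit_law:
  fixes R :: "(bit \<times> 'v) pmf" and g :: "bit \<times> 'v \<Rightarrow> real"
  assumes fin: "finite (set_pmf R)"
  shows "measure_pmf.expectation R g =
    (\<Sum>v\<in>snd ` set_pmf R. g (0, v) * pmf R (0, v) + g (1, v) * pmf R (1, v))"
proof -
  have "measure_pmf.expectation R g = (\<Sum>z\<in>{0, 1} \<times> snd ` set_pmf R. g z * pmf R z)"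
    by (rule integral_measure_pmf_real) (use fin UNIV_bit in force)+
  then show ?thesis by (simp add: sum.cartesian_product' sum.distrib)
qed

text \<open>A sample from the posterior misses the true bit with mass
  \<open>2 * a * b / (a + b) = Z^2 / (2 * (a + b))\<close>, and
  \<open>Z \<le> a + b\<close>.\<close>

lemma expectation_mismatch_le_Z:
  assumes fin: "finite (set_pmf R)"
  shows "measure_pmf.expectation R (\<lambda>(t, v). 1 - pmf (cond_law R d v) t) \<le> obs_sum Z_fun R"
proof -
  have "(1 - pmf (cond_law R d v) 0) * pmf R (0, v) + (1 - pmf (cond_law R d v) 1) * pmf R (1, v) \<le>
      Z_fun (pmf R (0, v)) (pmf R (1, v))" if v: "v \<in> snd ` set_pmf R" for v
  proof -
    let ?a = "pmf R (0, v)" and ?b = "pmf R (1, v)"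
    have c: "?a + ?b > 0"
      using v pmf_positive[of v "map_pmf snd R"] by (simp add: pmf_snd_bit)
    have "1 - ?a / (?a + ?b) = ?b / (?a + ?b)" "1 - ?b / (?a + ?b) = ?a / (?a + ?b)"
      using c by (simp_all add: field_simps)
    then have "(1 - pmf (cond_law R d v) 0) * ?a + (1 - pmf (cond_law R d v) 1) * ?b =
        2 * (?a * ?b) / (?a + ?b)"
      by (simp only: pmf_cond_law[OF v] pmf_snd_bit) (simp add: add_divide_distrib[symmetric] mult.commute)
    also have "2 * (?a * ?b) = Z_fun ?a ?b * (Z_fun ?a ?b / 2)"
      using Z_fun_square[of ?a ?b] by (simp add: power2_eq_square)
    also have "\<dots> \<le> Z_fun ?a ?b * (?a + ?b)"
      using Z_fun_le[of ?a ?b] Z_fun_nonneg[of ?a ?b] by (intro mult_left_mono) auto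
    finally show ?thesis using c by (simp add: divide_right_mono)
  qed
  then show ?thesis
    unfolding expectation_bit_law[OF fin] obs_sum_def by (intro sum_mono) simp
qed

text \<open>Weighted with its mass \<open>a + b\<close>, the bias of the posterior is
  \<open>\<bar>a - b\<bar> / 2\<close>.\<close>

lemma expectation_bias_le_T:
  assumes fin: "finite (set_pmf R)"
  shows "measure_pmf.expectation R (\<lambda>(t, v). \<bar>1 / 2 - pmf (cond_law R d v) 0\<bar>) \<le> obs_sum T_fun R"
proof -
  have "\<bar>1 / 2 - pmf (cond_law R d v) 0\<bar> * pmf R (0, v) + \<bar>1 / 2 - pmf (cond_law R d v) 0\<bar> * pmf R (1, v) \<le>
      T_fun (pmf R (0, v)) (pmf R (1, v))" if v: "v \<in> snd ` set_pmf R" for v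
  proof -
    let ?a = "pmf R (0, v)" and ?b = "pmf R (1, v)"
    have c: "?a + ?b > 0"
      using v pmf_positive[of v "map_pmf snd R"] by (simp add: pmf_snd_bit)
    have "1 / 2 - ?a / (?a + ?b) = (?b - ?a) / (2 * (?a + ?b))" using c by (simp add: field_simps)
    then have bias: "\<bar>1 / 2 - pmf (cond_law R d v) 0\<bar> = \<bar>?b - ?a\<bar> / (2 * (?a + ?b))"
      using c by (simp add: pmf_cond_law[OF v] pmf_snd_bit)
    have half: "x / (2 * (?a + ?b)) * ?a + x / (2 * (?a + ?b)) * ?b = x / 2" for x
    proof -
      have "x / (2 * c) * c = x / 2" if "c > 0" for c :: real using that by simp
      from this[OF c] show ?thesis by (simp only: distrib_left)
    qed
    show ?thesis unfolding bias half T_fun_def abs_minus_commute[of ?b ?a] by simp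
  qed
  then show ?thesis
    unfolding expectation_bit_law[OF fin] obs_sum_def by (intro sum_mono) simp
qed

section \<open>Successive generation\<close>

text \<open>A hybrid argument over the positions: once the prefix has been replaced by the ideal
  one, the next step is compared under the ideal prefix law only, and \<open>\<alpha>\<close> is
  carried along so that the joint law with the past is compared.\<close>

lemma tv_le_generate:
  fixes R :: "('a \<times> (nat \<Rightarrow> bit)) pmf"
  assumes step: "\<And>k. k < K \<Longrightarrow> tv_le (e k)
    (bind_pmf (map_pmf (\<lambda>(\<alpha>, v). (\<alpha>, restrict v {..<k})) R) (\<lambda>(\<alpha>, w). map_pmf (Pair (\<alpha>, w)) (\<kappa> \<alpha> k w)))
    (map_pmf (\<lambda>(\<alpha>, v). ((\<alpha>, restrict v {..<k}), v k)) R)"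
  shows "tv_le (\<Sum>k<K. e k) (bind_pmf (map_pmf fst R) (\<lambda>\<alpha>. map_pmf (Pair \<alpha>) (generate (\<kappa> \<alpha>) K)))
    (map_pmf (\<lambda>(\<alpha>, v). (\<alpha>, restrict v {..<K})) R)"
  using step
proof (induction K)
  case 0
  have eq: "bind_pmf (map_pmf fst R) (\<lambda>\<alpha>. map_pmf (Pair \<alpha>) (generate (\<kappa> \<alpha>) 0)) =
      map_pmf (\<lambda>(\<alpha>, v). (\<alpha>, restrict v {..<0})) R"
    by (simp add: map_pmf_def bind_assoc_pmf bind_return_pmf case_prod_beta restrict_def)
  show ?case by (simp only: eq lessThan_0 sum.empty tv_le_refl order_refl)
next
  case (Suc K)
  let ?G = "\<lambda>K. bind_pmf (map_pmf fst R) (\<lambda>\<alpha>. map_pmf (Pair \<alpha>) (generate (\<kappa> \<alpha>) K))"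
  let ?J = "\<lambda>k. map_pmf (\<lambda>(\<alpha>, v). (\<alpha>, restrict v {..<k})) R"
  let ?S = "\<lambda>(\<alpha>, w). map_pmf (Pair (\<alpha>, w)) (\<kappa> \<alpha> K w)"
  let ?u = "\<lambda>((\<alpha>, w), b). (\<alpha>, w(K := b))"
  have G: "?G (Suc K) = map_pmf ?u (bind_pmf (?G K) ?S)"
    by (simp add: map_pmf_def bind_assoc_pmf bind_return_pmf)
  have J: "?J (Suc K) = map_pmf ?u (map_pmf (\<lambda>(\<alpha>, v). ((\<alpha>, restrict v {..<K}), v K)) R)"
    unfolding pmf.map_comp by (intro map_pmf_cong refl) (auto simp: restrict_lessThan_Suc fun_eq_iff)
  have "tv_le (\<Sum>k<K. e k) (bind_pmf (?G K) ?S) (bind_pmf (?J K) ?S)"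
    by (rule tv_le_bind[OF Suc.IH]) (use Suc.prems in auto)
  from tv_le_trans[OF this Suc.prems[OF lessI]] show ?case
    unfolding G J sum.lessThan_Suc by (rule tv_le_map)
qed

text \<open>A union bound over the positions. To reproduce \<open>w\<close> every draw must hit, so
  each kernel is evaluated at the true prefix of \<open>w\<close>.\<close>

lemma mismatch_generate:
  assumes "w \<in> extensional {..<K}"
  shows "1 - pmf (generate \<kappa> K) w \<le> (\<Sum>k<K. 1 - pmf (\<kappa> k (restrict w {..<k})) (w k))"
proof -
  have "1 - pmf (generate \<kappa> K) (restrict w {..<K}) \<le> (\<Sum>k<K. 1 - pmf (\<kappa> k (restrict w {..<k})) (w k))"
  proof (induction K)
    case 0
    then show ?case by (simp add: restrict_def)
  next
    case (Suc K)
    let ?r = "restrict w {..<K}"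
    have "pmf (\<kappa> K ?r) (w K) * 1 \<le> pmf (\<kappa> K ?r \<bind> (\<lambda>b. return_pmf (?r(K := b)))) (?r(K := w K))"
      using pmf_bind_ge[of "\<kappa> K ?r" "w K" "\<lambda>b. return_pmf (?r(K := b))" "?r(K := w K)"] by simp
    then have "pmf (generate \<kappa> K) ?r * pmf (\<kappa> K ?r) (w K) \<le>
        pmf (generate \<kappa> K) ?r * pmf (\<kappa> K ?r \<bind> (\<lambda>b. return_pmf (?r(K := b)))) (?r(K := w K))"
      by (intro mult_left_mono) auto
    also have "\<dots> \<le> pmf (generate \<kappa> (Suc K)) (?r(K := w K))"
      using pmf_bind_ge[of "generate \<kappa> K" ?r "\<lambda>v. \<kappa> K v \<bind> (\<lambda>b. return_pmf (v(K := b)))"] by simp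
    finally have "pmf (generate \<kappa> K) ?r * pmf (\<kappa> K ?r) (w K) \<le>
        pmf (generate \<kappa> (Suc K)) (restrict w {..<Suc K})"
      by (simp only: restrict_lessThan_Suc)
    moreover have "1 - x * y \<le> (1 - x) + (1 - y)" if "x \<le> 1" "y \<le> 1" for x y :: real
    proof -
      have "0 \<le> (1 - x) * (1 - y)" using that by simp
      then show ?thesis by (simp add: algebra_simps)
    qed
    note this[OF pmf_le_1 pmf_le_1, of "generate \<kappa> K" ?r "\<kappa> K ?r" "w K"]
    ultimately show ?case unfolding sum.lessThan_Suc using Suc.IH by linarith
  qed
  then show ?thesis using assms by (simp add: extensional_restrict)
qed

lemma one_minus_prod_le_sum:
  fixes f :: "'a \<Rightarrow> real"
  assumes "finite A" "\<And>a. a \<in> A \<Longrightarrow> 0 \<le> f a" "\<And>a. a \<in> A \<Longrightarrow> f a \<le> 1"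
  shows "1 - (\<Prod>a\<in>A. f a) \<le> (\<Sum>a\<in>A. 1 - f a)"
  using assms
proof (induction A rule: finite_induct)
  case (insert a A)
  have "prod f A \<le> 1" by (rule prod_le_1) (use insert.prems in auto)
  then have "0 \<le> (1 - f a) * (1 - prod f A)" using insert.prems by simp
  moreover have "1 - prod f A \<le> (\<Sum>a\<in>A. 1 - f a)" using insert by simp
  ultimately show ?case using insert.hyps by (simp add: algebra_simps)
qed simp

section \<open>Blocks of the ideal distribution\<close>

lemma iid_map:
  "iid n (map_pmf q p) = map_pmf (\<lambda>s l. if l < 2 ^ n then q (s l) else undefined) (iid n p)"
proof -
  let ?A = "{..<2 ^ n} :: nat set"
  \<comment> \<open>Mapping the letters also maps the default value, so the product is first taken
    with default \<open>q undefined\<close> and the default is reset afterwards.\<close>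
  have "iid n (map_pmf q p) = map_pmf (\<lambda>f x. if x \<in> ?A then f x else undefined)
      (Pi_pmf ?A (q undefined) (\<lambda>_. map_pmf q p))"
    unfolding iid_def by (rule Pi_pmf_default_swap[symmetric]) simp
  also have "Pi_pmf ?A (q undefined) (\<lambda>_. map_pmf q p) = map_pmf (\<lambda>h. q \<circ> h) (iid n p)"
    unfolding iid_def by (rule Pi_pmf_map) auto
  finally show ?thesis by (simp add: pmf.map_comp o_def)
qed

lemma iid_bind_Pair:
  "iid n (bind_pmf p (\<lambda>a. map_pmf (Pair a) (\<kappa> a))) =
    bind_pmf (iid n p) (\<lambda>a. map_pmf (\<lambda>b l. if l < 2 ^ n then (a l, b l) else undefined)
      (Pi_pmf {..<2 ^ n} undefined (\<lambda>l. \<kappa> (a l))))"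
proof -
  let ?A = "{..<2 ^ n} :: nat set"
  have "Pi_pmf ?A undefined (\<lambda>l. map_pmf (Pair (a l)) (\<kappa> (a l))) =
      map_pmf (\<lambda>b l. if l < 2 ^ n then (a l, b l) else undefined) (Pi_pmf ?A undefined (\<lambda>l. \<kappa> (a l)))" for a
    unfolding map_pmf_def by (subst Pi_pmf_bind[where d' = undefined]) simp_all
  then show ?thesis
    unfolding iid_def by (subst Pi_pmf_bind[where d' = undefined]) simp_all
qed

text \<open>Holds the symbols of all source terminals, since a round has to keep the joint law with
  every source; \<open>own_past\<close> is the part that a broadcaster conditions on.\<close>

definition past :: "nat \<Rightarrow> nat \<Rightarrow> (nat \<Rightarrow> 'x source) \<Rightarrow> (nat \<Rightarrow> nat \<Rightarrow> 'x) \<times> (nat \<Rightarrow> nat \<Rightarrow> bit)" where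
  "past n i s = (\<lambda>k\<in>{..<2 ^ n}. fst (s k), tuple {1..<i} (U_block n) s)"

definition own_past :: "nat \<Rightarrow> nat \<Rightarrow> (nat \<Rightarrow> nat \<Rightarrow> 'x) \<times> (nat \<Rightarrow> nat \<Rightarrow> bit) \<Rightarrow>
    (nat \<Rightarrow> 'x) \<times> (nat \<Rightarrow> nat \<Rightarrow> bit)" where
  "own_past n j \<alpha> = ((\<lambda>k\<in>{..<2 ^ n}. fst \<alpha> k j), snd \<alpha>)"

lemma own_past_past: "own_past n j (past n i s) = (X_block n j s, tuple {1..<i} (U_block n) s)"
  by (auto simp: own_past_def past_def X_block_def fun_eq_iff)

definition past_law :: "nat \<Rightarrow> 'x source pmf \<Rightarrow> nat \<Rightarrow>
    (((nat \<Rightarrow> nat \<Rightarrow> 'x) \<times> (nat \<Rightarrow> nat \<Rightarrow> bit)) \<times> (nat \<Rightarrow> bit)) pmf" where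
  "past_law n Q i = map_pmf (\<lambda>s. (past n i s, V_block n i s)) (iid n Q)"

text \<open>Lifts the single-letter Markov property to blocks: given the past, the letters of the
  new sequence are independent, each drawn from the matching letters of the broadcaster's source and
  of the earlier sequences.\<close>

lemma past_law_kernel:
  assumes K: "map_pmf (\<lambda>(x, u). ((x, restrict u {1..<i}), u i)) Q =
    bind_pmf (map_pmf (\<lambda>(x, u). (x, restrict u {1..<i})) Q) (\<lambda>a. map_pmf (Pair a) (K (fst a j, snd a)))"
  shows "past_law n Q i = bind_pmf (map_pmf (past n i) (iid n Q)) (\<lambda>\<alpha>. map_pmf (Pair \<alpha>)
    ((\<lambda>(x, u). map_pmf (polar n) (Pi_pmf {..<2 ^ n} undefined (\<lambda>l. K (x l, \<lambda>i'\<in>{1..<i}. u i' l))))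
      (own_past n j \<alpha>)))"
proof -
  let ?q = "\<lambda>(x, u). ((x, restrict u {1..<i}), u i)" and ?q' = "\<lambda>(x, u). (x, restrict u {1..<i})"
  let ?P = "\<lambda>a. Pi_pmf {..<2 ^ n} undefined (\<lambda>l. K (fst (a l) j, snd (a l)))"
  define asm :: "(nat \<Rightarrow> (nat \<Rightarrow> 'a) \<times> (nat \<Rightarrow> bit)) \<Rightarrow> (nat \<Rightarrow> nat \<Rightarrow> 'a) \<times> (nat \<Rightarrow> nat \<Rightarrow> bit)"
    where "asm a = (\<lambda>k\<in>{..<2 ^ n}. fst (a k), \<lambda>i'\<in>{1..<i}. \<lambda>k\<in>{..<2 ^ n}. snd (a k) i')" for a
  have asm_past: "asm (\<lambda>l. fst (if l < 2 ^ n then ?q (s l) else undefined)) = past n i s"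
    "asm (\<lambda>l. if l < 2 ^ n then ?q' (s l) else undefined) = past n i s" for s
    by (auto simp: asm_def past_def U_block_def fun_eq_iff case_prod_beta)
  have V: "polar n (\<lambda>l. snd (if l < 2 ^ n then ?q (s l) else undefined)) = V_block n i s" for s :: "nat \<Rightarrow> 'a source"
    unfolding V_block_def by (rule polar_cong) (simp add: U_block_def case_prod_beta)
  have asm_Pair: "asm (\<lambda>l. fst (if l < 2 ^ n then (a l, b l) else undefined)) = asm a" for a and b :: "nat \<Rightarrow> bit"
    by (auto simp: asm_def fun_eq_iff)
  have polar_Pair: "polar n (\<lambda>l. snd (if l < 2 ^ n then (a l, b l) else undefined)) = polar n b"
    for a :: "nat \<Rightarrow> (nat \<Rightarrow> 'a) \<times> (nat \<Rightarrow> bit)" and b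
    by (rule polar_cong) simp
  have "past_law n Q i = map_pmf (\<lambda>r. (asm (\<lambda>l. fst (r l)), polar n (\<lambda>l. snd (r l)))) (iid n (map_pmf ?q Q))"
    unfolding iid_map pmf.map_comp o_def asm_past V past_law_def ..
  also have "\<dots> = bind_pmf (iid n (map_pmf ?q' Q)) (\<lambda>a. map_pmf (Pair (asm a)) (map_pmf (polar n) (?P a)))"
    unfolding K iid_bind_Pair map_bind_pmf pmf.map_comp o_def asm_Pair polar_Pair ..
  also have "\<dots> = bind_pmf (iid n (map_pmf ?q' Q)) (\<lambda>a. map_pmf (Pair (asm a))
      ((\<lambda>(x, u). map_pmf (polar n) (Pi_pmf {..<2 ^ n} undefined (\<lambda>l. K (x l, \<lambda>i'\<in>{1..<i}. u i' l))))
        (own_past n j (asm a))))"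
  \<comment> \<open>The kernel sees the earlier letters restricted to \<open>{1..<i}\<close> once
    more; this changes nothing on the support, where they are extensional.\<close>
  proof (rule bind_pmf_cong[OF refl])
    fix a assume "a \<in> set_pmf (iid n (map_pmf ?q' Q))"
    then have "a l \<in> ?q' ` set_pmf Q" if "l < 2 ^ n" for l
      using that by (auto simp: iid_def set_Pi_pmf PiE_dflt_def)
    then have "snd (a l) \<in> extensional {1..<i}" if "l < 2 ^ n" for l using that by fastforce
    then have "(\<lambda>i'\<in>{1..<i}. snd (a l) i') = snd (a l)" if "l < 2 ^ n" for l
      using that extensional_restrict by blast
    then have "?P a = (\<lambda>(x, u). Pi_pmf {..<2 ^ n} undefined (\<lambda>l. K (x l, \<lambda>i'\<in>{1..<i}. u i' l)))
        (own_past n j (asm a))"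
      by (auto simp: own_past_def asm_def cong: restrict_cong intro!: Pi_pmf_cong)
    then show "map_pmf (Pair (asm a)) (map_pmf (polar n) (?P a)) = map_pmf (Pair (asm a))
      ((\<lambda>(x, u). map_pmf (polar n) (Pi_pmf {..<2 ^ n} undefined (\<lambda>l. K (x l, \<lambda>i'\<in>{1..<i}. u i' l))))
        (own_past n j (asm a)))"
      by (simp add: case_prod_beta)
  qed
  also have "\<dots> = bind_pmf (map_pmf asm (iid n (map_pmf ?q' Q))) (\<lambda>\<alpha>. map_pmf (Pair \<alpha>)
      ((\<lambda>(x, u). map_pmf (polar n) (Pi_pmf {..<2 ^ n} undefined (\<lambda>l. K (x l, \<lambda>i'\<in>{1..<i}. u i' l))))
        (own_past n j \<alpha>)))"
    by (simp add: bind_map_pmf)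
  also have "map_pmf asm (iid n (map_pmf ?q' Q)) = map_pmf (past n i) (iid n Q)"
    unfolding iid_map pmf.map_comp o_def asm_past ..
  finally show ?thesis .
qed

section \<open>The conditional laws of the protocol and its index sets\<close>

definition law_V :: "nat \<Rightarrow> 'x source pmf \<Rightarrow> nat \<Rightarrow> nat \<Rightarrow> (bit \<times> (nat \<Rightarrow> bit)) pmf" where
  "law_V n Q i k = map_pmf (\<lambda>s. (V_block n i s k, restrict (V_block n i s) {..<k})) (iid n Q)"

definition law_VU :: "nat \<Rightarrow> 'x source pmf \<Rightarrow> nat \<Rightarrow> nat \<Rightarrow>
    (bit \<times> (nat \<Rightarrow> bit) \<times> (nat \<Rightarrow> nat \<Rightarrow> bit)) pmf" where
  "law_VU n Q i k = map_pmf (\<lambda>s. (V_block n i s k, restrict (V_block n i s) {..<k},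
     tuple {1..<i} (U_block n) s)) (iid n Q)"

definition law_VXU :: "nat \<Rightarrow> 'x source pmf \<Rightarrow> nat \<Rightarrow> nat \<Rightarrow> nat \<Rightarrow>
    (bit \<times> (nat \<Rightarrow> bit) \<times> (nat \<Rightarrow> 'x) \<times> (nat \<Rightarrow> nat \<Rightarrow> bit)) pmf" where
  "law_VXU n Q j i k = map_pmf (\<lambda>s. (V_block n i s k, restrict (V_block n i s) {..<k},
     X_block n j s, tuple {1..<i} (U_block n) s)) (iid n Q)"

lemma V_block_eq: "V_block n i s = polar n (\<lambda>l. snd (s l) i)"
  unfolding V_block_def by (rule polar_cong) (simp add: U_block_def)

lemma V_block_extensional: "V_block n i s \<in> extensional {..<2 ^ n}"
  by (simp add: V_block_def)

context
  fixes Q :: "'x source pmf"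
  assumes fin: "finite (set_pmf Q)"
begin

private lemmas finite_iid = finite_set_iid[OF fin]

lemma finite_laws:
  "finite (set_pmf (law_V n Q i k))" "finite (set_pmf (law_VU n Q i k))" "finite (set_pmf (law_VXU n Q j i k))"
  by (simp_all add: law_V_def law_VU_def law_VXU_def finite_iid)

lemma polar_Z_law_V: "polar_Z n (map_pmf (\<lambda>(x, u). u i) Q) k = obs_sum Z_fun (law_V n Q i k)"
proof -
  have "polar n (\<lambda>l. if l < 2 ^ n then (case s l of (x, u) \<Rightarrow> u i) else undefined) = V_block n i s"
    for s :: "nat \<Rightarrow> 'x source"
    unfolding V_block_eq by (rule polar_cong) (simp add: case_prod_beta)
  then have "polar_Z n (map_pmf (\<lambda>(x, u). u i) Q) k = bhattacharyya (law_V n Q i k)"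
    unfolding polar_Z_def law_V_def iid_map pmf.map_comp o_def by simp
  then show ?thesis by (simp add: bhattacharyya_eq_obs_sum finite_laws)
qed

lemma polar_law_side:
  "polar_law n (map_pmf (\<lambda>(x, u). (u i, h x u)) Q) k =
    map_pmf (\<lambda>s. (V_block n i s k, restrict (V_block n i s) {..<k},
      \<lambda>l\<in>{..<2 ^ n}. h (fst (s l)) (snd (s l)))) (iid n Q)"
proof -
  have "polar n (\<lambda>l. fst (if l < 2 ^ n then (case s l of (x, u) \<Rightarrow> (u i, h x u)) else undefined)) = V_block n i s"
    for s :: "nat \<Rightarrow> 'x source"
    unfolding V_block_eq by (rule polar_cong) (simp add: case_prod_beta)
  moreover have "(\<lambda>l\<in>{..<2 ^ n}. snd (if l < 2 ^ n then (case s l of (x, u) \<Rightarrow> (u i, h x u)) else undefined)) =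
      (\<lambda>l\<in>{..<2 ^ n}. h (fst (s l)) (snd (s l)))" for s :: "nat \<Rightarrow> 'x source"
    by (auto simp: fun_eq_iff case_prod_beta)
  ultimately show ?thesis
    unfolding polar_law_def iid_map pmf.map_comp o_def Let_def by simp
qed

text \<open>The index sets are defined with a block of tuples as side information, the sampling laws
  with a tuple of blocks. The transposition between the two is injective on extensional
  functions.\<close>

lemma polar_cond_Z_law_VU:
  "polar_cond_Z n (map_pmf (\<lambda>(x, u). (u i, restrict u {1..<i})) Q) k = obs_sum Z_fun (law_VU n Q i k)"
proof -
  let ?p = "map_pmf (\<lambda>(x, u). (u i, restrict u {1..<i})) Q"
  let ?f = "\<lambda>(v, w :: nat \<Rightarrow> nat \<Rightarrow> bit). (v, \<lambda>i'\<in>{1..<i}. \<lambda>l\<in>{..<2 ^ n}. w l i')"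
  let ?S = "{(v :: nat \<Rightarrow> bit, w :: nat \<Rightarrow> nat \<Rightarrow> bit). w \<in> extensional {..<2 ^ n} \<and> (\<forall>l<2 ^ n. w l \<in> extensional {1..<i})}"
  note law = polar_law_side[where h = "\<lambda>x u. restrict u {1..<i}"]
  have "law_VU n Q i k = map_pmf (\<lambda>(t, v). (t, ?f v)) (polar_law n ?p k)"
    unfolding law law_VU_def pmf.map_comp o_def
    by (intro map_pmf_cong refl) (auto simp: U_block_def fun_eq_iff)
  moreover have "inj_on ?f ?S"
  proof (rule inj_onI, clarify)
    fix v :: "nat \<Rightarrow> bit" and w w' :: "nat \<Rightarrow> nat \<Rightarrow> bit"
    assume ext: "w \<in> extensional {..<2 ^ n}" "w' \<in> extensional {..<2 ^ n}"
      "\<forall>l<2 ^ n. w l \<in> extensional {1..<i}" "\<forall>l<2 ^ n. w' l \<in> extensional {1..<i}"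
      and eq: "(\<lambda>i'\<in>{1..<i}. \<lambda>l\<in>{..<2 ^ n}. w l i') = (\<lambda>i'\<in>{1..<i}. \<lambda>l\<in>{..<2 ^ n}. w' l i')"
    have w: "w l i' = w' l i'" if "l < 2 ^ n" "i' \<in> {1..<i}" for l i'
      using fun_cong[OF fun_cong[OF eq, of i'], of l] that by simp
    have wl: "w l = w' l" if "l < 2 ^ n" for l
      by (rule extensionalityI[where A = "{1..<i}"]) (use ext that w in auto)
    have "w = w'" by (rule extensionalityI[OF ext(1,2)]) (use wl in simp)
    then show "v = v \<and> w = w'" by simp
  qed
  then have "inj_on ?f (snd ` set_pmf (polar_law n ?p k))"
    by (rule inj_on_subset) (auto simp: law simp del: One_nat_def)
  ultimately have "obs_sum Z_fun (law_VU n Q i k) = obs_sum Z_fun (polar_law n ?p k)"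
    by (simp only: obs_sum_relabel[where \<phi> = Z_fun] obs_fun_0)
  then show ?thesis by (simp add: polar_cond_Z_eq fin)
qed

lemma polar_cond_Z_law_VXU:
  "polar_cond_Z n (map_pmf (\<lambda>(x, u). (u i, (x j, restrict u {1..<i}))) Q) k =
    obs_sum Z_fun (law_VXU n Q j i k)"
proof -
  let ?p = "map_pmf (\<lambda>(x, u). (u i, (x j, restrict u {1..<i}))) Q"
  let ?f = "\<lambda>(v, w :: nat \<Rightarrow> 'x \<times> (nat \<Rightarrow> bit)).
    (v, \<lambda>l\<in>{..<2 ^ n}. fst (w l), \<lambda>i'\<in>{1..<i}. \<lambda>l\<in>{..<2 ^ n}. snd (w l) i')"
  let ?S = "{(v :: nat \<Rightarrow> bit, w :: nat \<Rightarrow> 'x \<times> (nat \<Rightarrow> bit)). w \<in> extensional {..<2 ^ n} \<and> (\<forall>l<2 ^ n. snd (w l) \<in> extensional {1..<i})}"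
  note law = polar_law_side[where h = "\<lambda>x u. (x j, restrict u {1..<i})"]
  have "law_VXU n Q j i k = map_pmf (\<lambda>(t, v). (t, ?f v)) (polar_law n ?p k)"
    unfolding law law_VXU_def pmf.map_comp o_def
    by (intro map_pmf_cong refl) (auto simp: U_block_def X_block_def fun_eq_iff)
  moreover have "inj_on ?f ?S"
  proof (rule inj_onI, clarify)
    fix v :: "nat \<Rightarrow> bit" and w w' :: "nat \<Rightarrow> 'x \<times> (nat \<Rightarrow> bit)"
    assume ext: "w \<in> extensional {..<2 ^ n}" "w' \<in> extensional {..<2 ^ n}"
      "\<forall>l<2 ^ n. snd (w l) \<in> extensional {1..<i}" "\<forall>l<2 ^ n. snd (w' l) \<in> extensional {1..<i}"
      and eq: "(\<lambda>i'\<in>{1..<i}. \<lambda>l\<in>{..<2 ^ n}. snd (w l) i') = (\<lambda>i'\<in>{1..<i}. \<lambda>l\<in>{..<2 ^ n}. snd (w' l) i')"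
      and eq': "(\<lambda>l\<in>{..<2 ^ n}. fst (w l)) = (\<lambda>l\<in>{..<2 ^ n}. fst (w' l))"
    have w: "snd (w l) i' = snd (w' l) i'" if "l < 2 ^ n" "i' \<in> {1..<i}" for l i'
      using fun_cong[OF fun_cong[OF eq, of i'], of l] that by simp
    have snd: "snd (w l) = snd (w' l)" if "l < 2 ^ n" for l
      by (rule extensionalityI[where A = "{1..<i}"]) (use ext that w in auto)
    have fst: "fst (w l) = fst (w' l)" if "l < 2 ^ n" for l
      using fun_cong[OF eq', of l] that by simp
    have wl: "w l = w' l" if "l < 2 ^ n" for l by (rule prod_eqI) (use fst snd that in auto)
    have "w = w'" by (rule extensionalityI[OF ext(1,2)]) (use wl in simp)
    then show "v = v \<and> w = w'" by simp
  qed
  then have "inj_on ?f (snd ` set_pmf (polar_law n ?p k))"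
    by (rule inj_on_subset) (auto simp: law simp del: One_nat_def)
  ultimately have "obs_sum Z_fun (law_VXU n Q j i k) = obs_sum Z_fun (polar_law n ?p k)"
    by (simp only: obs_sum_relabel[where \<phi> = Z_fun] obs_fun_0)
  then show ?thesis by (simp add: polar_cond_Z_eq fin)
qed

lemma mem_L_U: "k \<in> L_U \<beta> n Q i \<longleftrightarrow> k < 2 ^ n \<and> obs_sum Z_fun (law_V n Q i k) \<le> \<delta> \<beta> n"
  by (simp add: L_U_def low_set_def polar_Z_law_V)

lemma mem_L_UU: "k \<in> L_UU \<beta> n Q i \<longleftrightarrow> k < 2 ^ n \<and> obs_sum Z_fun (law_VU n Q i k) \<le> \<delta> \<beta> n"
  unfolding L_UU_def low_cond_set_def polar_cond_Z_law_VU by simp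

lemma mem_H_UXU: "k \<in> H_UXU \<beta> n Q j i \<longleftrightarrow> k < 2 ^ n \<and> obs_sum Z_fun (law_VXU n Q j i k) \<ge> 1 - \<delta> \<beta> n"
  unfolding H_UXU_def high_cond_set_def polar_cond_Z_law_VXU by simp

lemma Z_law_VU_le: "obs_sum Z_fun (law_VU n Q i k) \<le> obs_sum Z_fun (law_V n Q i k)"
proof -
  have "law_V n Q i k = map_pmf (\<lambda>(t, v). (t, fst v)) (law_VU n Q i k)"
    by (simp add: law_V_def law_VU_def pmf.map_comp o_def)
  then show ?thesis using obs_sum_coarsen_Z[OF finite_laws(2)] by metis
qed

lemma Z_law_VXU_le: "obs_sum Z_fun (law_VXU n Q j i k) \<le> obs_sum Z_fun (law_VU n Q i k)"
proof -
  have "law_VU n Q i k = map_pmf (\<lambda>(t, v). (t, (\<lambda>(v, x, u). (v, u)) v)) (law_VXU n Q j i k)"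
    by (simp add: law_VXU_def law_VU_def pmf.map_comp o_def)
  then show ?thesis using obs_sum_coarsen_Z[OF finite_laws(3)] by metis
qed

text \<open>Conditioning lowers \<open>Z\<close>. Hence \<open>L_U\<close> lies in
  \<open>L_UU\<close>, and the broadcast positions are the complement of \<open>L_UU\<close> and
  \<open>H_UXU\<close>; these two are disjoint because \<open>\<delta> < 1 / 2\<close>.\<close>

lemma broadcast_rate_eq:
  assumes "\<beta> > 0" "n \<ge> 1"
  shows "broadcast_rate \<beta> n m Q i = 1 - real (card (L_UU \<beta> n Q i)) / 2 ^ n
    - real (card (H_UXU \<beta> n Q (broadcaster m i) i)) / 2 ^ n"
proof -
  let ?L = "L_UU \<beta> n Q i" and ?H = "H_UXU \<beta> n Q (broadcaster m i) i" and ?N = "{..<2 ^ n} :: nat set"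
  have sub: "?L \<subseteq> ?N" "?H \<subseteq> ?N" by (auto simp: mem_L_UU mem_H_UXU)
  have fin_LH: "finite ?L" "finite ?H" using sub finite_subset by blast+
  have "L_U \<beta> n Q i \<subseteq> ?L" by (auto simp: mem_L_U mem_L_UU intro: order_trans[OF Z_law_VU_le])
  then have I': "I'_set \<beta> n m Q i = ?N - (?L \<union> ?H)" by (auto simp: I'_set_def I_set_def)
  have disj: "?L \<inter> ?H = {}"
  proof (rule ccontr)
    assume "?L \<inter> ?H \<noteq> {}"
    then obtain k where "k \<in> ?L" "k \<in> ?H" by blast
    then have "1 - \<delta> \<beta> n \<le> \<delta> \<beta> n"
      using Z_law_VXU_le[of n "broadcaster m i" i k] unfolding mem_L_UU mem_H_UXU by linarith
    then show False using \<delta>_less_half[OF assms] by linarith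
  qed
  have "card (I'_set \<beta> n m Q i) + (card ?L + card ?H) = card ?N"
    unfolding I' card_Un_disjoint[OF fin_LH disj, symmetric]
    by (subst card_Diff_subset) (use sub fin_LH card_mono[of ?N "?L \<union> ?H"] in auto)
  then have "real (card (I'_set \<beta> n m Q i)) + (real (card ?L) + real (card ?H)) = 2 ^ n"
    by (simp add: of_nat_add[symmetric] del: of_nat_add)
  then have "real (card (I'_set \<beta> n m Q i)) = 2 ^ n - real (card ?L) - real (card ?H)" by linarith
  then show ?thesis by (simp add: broadcast_rate_def diff_divide_distrib)
qed

end

section \<open>One round of the protocol\<close>

text \<open>One bound for all positions of the broadcaster: a uniform bit costs at most
  \<open>sqrt (2 * \<delta>)\<close>, a bit sampled without regard to source and past at most
  \<delta>, and a bit of \<open>I_set\<close> nothing.\<close>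

definition step_error :: "real \<Rightarrow> nat \<Rightarrow> real" where
  "step_error \<beta> n = sqrt (2 * \<delta> \<beta> n) + \<delta> \<beta> n"

text \<open>
  Terminals \<open>a > m\<close> do not exist, but a \<^typ>\<open>state\<close> assigns them junk that has to be matched.
\<close>
definition ideal_state :: "nat \<Rightarrow> nat \<Rightarrow> nat \<Rightarrow> (nat \<Rightarrow> nat \<Rightarrow> bit) \<Rightarrow> state" where
  "ideal_state n m i u = (\<lambda>a l. if l \<in> {1..i} then (if a \<le> m then u l else polar n undefined) else undefined)"

lemma restrict_ideal_state: "a \<le> m \<Longrightarrow> restrict (ideal_state n m i u a) {1..<Suc i} = restrict u {1..<Suc i}"
  by (auto simp: ideal_state_def fun_eq_iff)

lemma ideal_state_restrict: "ideal_state n m i (restrict u {1..<Suc i}) = ideal_state n m i u"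
  by (auto simp: ideal_state_def fun_eq_iff)

lemma ideal_state_Suc:
  "(\<lambda>a. (ideal_state n m i u a)(Suc i := if a \<le> m then u (Suc i) else polar n undefined)) =
    ideal_state n m (Suc i) u"
  by (auto simp: ideal_state_def fun_eq_iff)

lemma polar_V_block: "polar n (V_block n i s) = U_block n i s"
  unfolding V_block_def by (rule polar_polar) (simp add: U_block_def)

lemma receiver_step_restrict:
  "restrict u {1..<i} = restrict u' {1..<i} \<Longrightarrow>
    receiver_step \<beta> n m Q d i w u = receiver_step \<beta> n m Q d i w u'"
  by (intro ext) (simp add: receiver_step_def del: One_nat_def)

lemma broadcaster_step_restrict:
  "restrict u {1..<i} = restrict u' {1..<i} \<Longrightarrow>
    broadcaster_step \<beta> n m Q d i x u = broadcaster_step \<beta> n m Q d i x u'"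
  by (intro ext) (simp add: broadcaster_step_def del: One_nat_def)

lemma broadcaster_le: "m \<ge> 1 \<Longrightarrow> broadcaster m i \<le> m"
  using mod_less_divisor[of m "i - 1"] unfolding broadcaster_def by linarith

context
  fixes Q :: "'x source pmf" and K :: "'x \<times> (nat \<Rightarrow> bit) \<Rightarrow> bit pmf"
    and \<beta> :: real and n m i :: nat and d :: "'x null_choice"
  assumes fin: "finite (set_pmf Q)"
    and K: "map_pmf (\<lambda>(x, u). ((x, restrict u {1..<i}), u i)) Q =
      bind_pmf (map_pmf (\<lambda>(x, u). (x, restrict u {1..<i})) Q)
        (\<lambda>a. map_pmf (Pair a) (K (fst a (broadcaster m i), snd a)))"
begin

private abbreviation "j \<equiv> broadcaster m i"
private abbreviation "R \<equiv> past_law n Q i"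

lemma finite_past_law: "finite (set_pmf R)"
  by (simp add: past_law_def finite_set_iid fin)

lemma laws_past_law:
  "law_V n Q i k = map_pmf (\<lambda>(\<alpha>, v). (v k, restrict v {..<k})) R"
  "law_VXU n Q j i k = map_pmf (\<lambda>(\<alpha>, v). (v k, (restrict v {..<k}, own_past n j \<alpha>))) R"
  by (simp_all add: law_V_def law_VXU_def past_law_def pmf.map_comp o_def own_past_past)

lemma expectation_laws:
  fixes g :: "_ \<Rightarrow> real"
  shows "measure_pmf.expectation (law_VXU n Q j i k) g =
      measure_pmf.expectation R (\<lambda>z. g (snd z k, (restrict (snd z) {..<k}, own_past n j (fst z))))"
    and "measure_pmf.expectation (law_V n Q i k) g' =
      measure_pmf.expectation R (\<lambda>z. g' (snd z k, restrict (snd z) {..<k}) :: real)"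
  by (simp_all add: laws_past_law case_prod_beta)

lemma P_V_eq: "P_V n Q i k = cond_law (law_V n Q i k)"
  and P_VU_eq: "P_VU n Q i k = cond_law (law_VU n Q i k)"
  and P_VXU_eq: "P_VXU n Q j i k = cond_law (law_VXU n Q j i k)"
  by (simp_all add: P_V_def P_VU_def P_VXU_def law_V_def law_VU_def law_VXU_def)

text \<open>The Markov property in the form used by the protocol: given the whole past, the next bit
  follows the law conditioned on the broadcaster's own knowledge. The choice \<open>d'\<close> at
  null events is arbitrary, so it can be matched to that of the protocol.\<close>

lemma ideal_step:
  "map_pmf (\<lambda>(\<alpha>, v). ((\<alpha>, restrict v {..<k}), v k)) R =
    bind_pmf (map_pmf (\<lambda>(\<alpha>, v). (\<alpha>, restrict v {..<k})) R)
      (\<lambda>(\<alpha>, w). map_pmf (Pair (\<alpha>, w)) (P_VXU n Q j i k d' (w, own_past n j \<alpha>)))"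
proof -
  define K' where "K' = (\<lambda>(x, u). map_pmf (polar n)
    (Pi_pmf {..<2 ^ n} undefined (\<lambda>l. K (x l, \<lambda>i'\<in>{1..<i}. u i' l))))"
  have K': "R = bind_pmf (map_pmf (past n i) (iid n Q)) (\<lambda>\<alpha>. map_pmf (Pair \<alpha>) (K' (own_past n j \<alpha>)))"
    unfolding K'_def by (rule past_law_kernel[OF K])
  show ?thesis
    unfolding P_VXU_eq laws_past_law
    by (rule cond_law_conditionally_independent[where \<phi> = "own_past n j" and K = K' and R = R, OF K'])
qed

lemma tv_le_broadcaster_step:
  assumes k: "k < 2 ^ n"
  shows "tv_le (step_error \<beta> n)
    (bind_pmf (map_pmf (\<lambda>(\<alpha>, v). (\<alpha>, restrict v {..<k})) R) (\<lambda>(\<alpha>, w). map_pmf (Pair (\<alpha>, w))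
      (broadcaster_step \<beta> n m Q d i (fst (own_past n j \<alpha>)) (snd \<alpha>) k w)))
    (map_pmf (\<lambda>(\<alpha>, v). ((\<alpha>, restrict v {..<k}), v k)) R)"
proof -
  let ?J = "map_pmf (\<lambda>(\<alpha>, v). (\<alpha>, restrict v {..<k})) R"
  let ?b = "\<lambda>\<alpha> w. broadcaster_step \<beta> n m Q d i (fst (own_past n j \<alpha>)) (snd \<alpha>) k w"
  have \<delta>: "0 \<le> \<delta> \<beta> n" using \<delta>_pos less_imp_le by blast
  consider (r) "k \<in> F_r \<beta> n m Q i" | (d) "k \<notin> F_r \<beta> n m Q i" "k \<in> F_d \<beta> n Q i"
    | (i) "k \<notin> F_r \<beta> n m Q i" "k \<notin> F_d \<beta> n Q i" by blast
  then show ?thesis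
  proof cases
    \<comment> \<open>The uniform bit is compared with the true conditional law, whose mean bias is
      at most \<open>T \<le> sqrt (2 * (1 - Z)) \<le> sqrt (2 * \<delta>)\<close>.\<close>
    case r
    let ?L = "law_VXU n Q j i k"
    let ?c = "cond_law ?L undefined"
    have "tv_le (step_error \<beta> n) (bind_pmf ?J (\<lambda>z. map_pmf (Pair z) (pmf_of_set {0, 1})))
      (bind_pmf ?J (\<lambda>z. map_pmf (Pair z) (?c (snd z, own_past n j (fst z)))))"
    proof (rule tv_le_bind_kernel)
      show "finite (set_pmf ?J)" by (simp add: finite_past_law)
      fix z :: "((nat \<Rightarrow> nat \<Rightarrow> 'x) \<times> (nat \<Rightarrow> nat \<Rightarrow> bit)) \<times> (nat \<Rightarrow> bit)"
      show "tv_le \<bar>1 / 2 - pmf (?c (snd z, own_past n j (fst z))) 0\<bar>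
        (map_pmf (Pair z) (pmf_of_set {0, 1})) (map_pmf (Pair z) (?c (snd z, own_past n j (fst z))))"
        using tv_le_map[OF tv_le_bit[of "pmf_of_set {0, 1}" "?c (snd z, own_past n j (fst z))"], of "Pair z"]
        by simp
    next
      have "measure_pmf.expectation ?J (\<lambda>z. \<bar>1 / 2 - pmf (?c (snd z, own_past n j (fst z))) 0\<bar>) =
          measure_pmf.expectation ?L (\<lambda>(t, v). \<bar>1 / 2 - pmf (?c v) 0\<bar>)"
        by (simp add: expectation_laws case_prod_beta)
      also have "\<dots> \<le> obs_sum T_fun ?L"
        by (rule expectation_bias_le_T[OF finite_laws(3)[OF fin]])
      also have "\<dots> \<le> sqrt (2 * (1 - obs_sum Z_fun ?L))"
        by (rule T_le_sqrt_Z[OF finite_laws(3)[OF fin]])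
      also have "\<dots> \<le> sqrt (2 * \<delta> \<beta> n)"
        using r by (simp add: F_r_def mem_H_UXU[OF fin])
      finally show "measure_pmf.expectation ?J (\<lambda>z. \<bar>1 / 2 - pmf (?c (snd z, own_past n j (fst z))) 0\<bar>) \<le>
          step_error \<beta> n" using \<delta> by (simp add: step_error_def add_increasing)
    qed
    then show ?thesis
      using r unfolding ideal_step[where d' = undefined] P_VXU_eq
      by (simp add: broadcaster_step_def case_prod_beta')
  next
    \<comment> \<open>This law ignores the source and the earlier rounds, so it is compared with the
      true bit itself, as a point mass, instead of the full conditional law: the prefix alone almost
      determines the bit.\<close>
    case d
    let ?L = "law_V n Q i k"
    let ?c = "cond_law ?L (null_V d n i k)"
    have "tv_le (step_error \<beta> n)
      (bind_pmf R (\<lambda>z. map_pmf (Pair (fst z, restrict (snd z) {..<k})) (?c (restrict (snd z) {..<k}))))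
      (bind_pmf R (\<lambda>z. return_pmf ((fst z, restrict (snd z) {..<k}), snd z k)))"
    proof (rule tv_le_bind_kernel[OF finite_past_law])
      fix z :: "((nat \<Rightarrow> nat \<Rightarrow> 'x) \<times> (nat \<Rightarrow> nat \<Rightarrow> bit)) \<times> (nat \<Rightarrow> bit)"
      let ?w = "(fst z, restrict (snd z) {..<k})"
      have "inj (Pair ?w :: bit \<Rightarrow> _)" by (simp add: inj_on_def)
      then show "tv_le (1 - pmf (?c (restrict (snd z) {..<k})) (snd z k))
        (map_pmf (Pair ?w) (?c (restrict (snd z) {..<k}))) (return_pmf (?w, snd z k))"
        using tv_le_return[of "map_pmf (Pair ?w) (?c (restrict (snd z) {..<k}))" "(?w, snd z k)"]
        by (simp add: pmf_map_inj')
    next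
      have "measure_pmf.expectation R (\<lambda>z. 1 - pmf (?c (restrict (snd z) {..<k})) (snd z k)) =
          measure_pmf.expectation ?L (\<lambda>(t, v). 1 - pmf (?c v) t)"
        by (simp add: expectation_laws)
      also have "\<dots> \<le> obs_sum Z_fun ?L"
        by (rule expectation_mismatch_le_Z[OF finite_laws(1)[OF fin]])
      also have "\<dots> \<le> \<delta> \<beta> n"
        using d by (simp add: F_d_def mem_L_U[OF fin])
      finally show "measure_pmf.expectation R (\<lambda>z. 1 - pmf (?c (restrict (snd z) {..<k})) (snd z k)) \<le>
          step_error \<beta> n" using \<delta> by (simp add: step_error_def add_increasing)
    qed
    then show ?thesis
      using d by (simp add: broadcaster_step_def P_V_eq bind_map_pmf map_pmf_def[of _ R] case_prod_beta'
        bind_assoc_pmf bind_return_pmf)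
  next
    case i
    have "bind_pmf ?J (\<lambda>(\<alpha>, w). map_pmf (Pair (\<alpha>, w)) (?b \<alpha> w)) =
        map_pmf (\<lambda>(\<alpha>, v). ((\<alpha>, restrict v {..<k}), v k)) R"
      unfolding ideal_step[where d' = "null_VXU d n i k"]
    proof (rule bind_pmf_cong[OF refl])
      fix z assume "z \<in> set_pmf ?J"
      then obtain s where "z = (past n i s, restrict (V_block n i s) {..<k})"
        by (auto simp: past_law_def)
      then show "(case z of (\<alpha>, w) \<Rightarrow> map_pmf (Pair (\<alpha>, w)) (?b \<alpha> w)) =
        (case z of (\<alpha>, w) \<Rightarrow> map_pmf (Pair (\<alpha>, w)) (P_VXU n Q j i k (null_VXU d n i k) (w, own_past n j \<alpha>)))"
        using i by (simp add: broadcaster_step_def own_past_past) (simp add: past_def)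
    qed
    then show ?thesis using \<delta> by (simp add: tv_le_refl step_error_def)
  qed
qed

text \<open>The receiver is examined in the ideal situation, with correct earlier sequences, correct
  prefix and correct broadcast. Only its private samples can then go wrong.\<close>

lemma expectation_receiver_mismatch:
  assumes k: "k < 2 ^ n"
  shows "measure_pmf.expectation (iid n Q) (\<lambda>s. 1 - pmf (receiver_step \<beta> n m Q d i (V_block n i s)
    (tuple {1..<i} (U_block n) s) k (restrict (V_block n i s) {..<k})) (V_block n i s k)) \<le> \<delta> \<beta> n"
    (is "measure_pmf.expectation _ ?f \<le> _")
proof -
  consider (c) "k \<in> I'_set \<beta> n m Q i \<or> k \<in> F_r \<beta> n m Q i"
    | (d) "k \<notin> I'_set \<beta> n m Q i" "k \<notin> F_r \<beta> n m Q i" "k \<in> F_d \<beta> n Q i"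
    | (u) "k \<notin> I'_set \<beta> n m Q i" "k \<notin> F_r \<beta> n m Q i" "k \<notin> F_d \<beta> n Q i" by blast
  then show ?thesis
  proof cases
    case c
    then show ?thesis using \<delta>_pos[of \<beta> n] by (simp add: receiver_step_def)
  next
    case d
    let ?L = "law_V n Q i k"
    have "measure_pmf.expectation (iid n Q) ?f =
        measure_pmf.expectation ?L (\<lambda>(t, v). 1 - pmf (cond_law ?L (null_V d n i k) v) t)"
      using d by (simp add: receiver_step_def P_V_eq expectation_laws past_law_def)
    also have "\<dots> \<le> obs_sum Z_fun ?L"
      by (rule expectation_mismatch_le_Z[OF finite_laws(1)[OF fin]])
    also have "\<dots> \<le> \<delta> \<beta> n" using d by (simp add: F_d_def mem_L_U[OF fin])
    finally show ?thesis .
  next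
    case u
    let ?L = "law_VU n Q i k"
    have "measure_pmf.expectation (iid n Q) ?f =
        measure_pmf.expectation ?L (\<lambda>(t, v). 1 - pmf (cond_law ?L (null_VU d n i k) v) t)"
    proof -
      have "measure_pmf.expectation ?L g = measure_pmf.expectation (iid n Q)
          (\<lambda>s. g (V_block n i s k, restrict (V_block n i s) {..<k}, tuple {1..<i} (U_block n) s))"
        for g :: "_ \<Rightarrow> real" by (simp add: law_VU_def)
      then show ?thesis using u by (simp add: receiver_step_def P_VU_eq)
    qed
    also have "\<dots> \<le> obs_sum Z_fun ?L"
      by (rule expectation_mismatch_le_Z[OF finite_laws(2)[OF fin]])
    also have "\<dots> \<le> \<delta> \<beta> n"
    proof -
      \<comment> \<open>A position of \<open>I_set\<close> that is not broadcast was removed exactly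
        because it lies in \<open>L_UU\<close>.\<close>
      have "k \<in> L_UU \<beta> n Q i" using u k by (auto simp: I'_set_def I_set_def F_r_def F_d_def)
      then show ?thesis by (simp add: mem_L_UU[OF fin])
    qed
    finally show ?thesis .
  qed
qed

end

text \<open>\<open>N\<close> positions of the broadcaster, then \<open>N\<close> positions at each
  of the \<open>m + 1\<close> terminals including the sink.\<close>

definition round_error :: "real \<Rightarrow> nat \<Rightarrow> nat \<Rightarrow> real" where
  "round_error \<beta> n m = 2 ^ n * step_error \<beta> n + (real m + 1) * (2 ^ n * \<delta> \<beta> n)"

definition ideal_law :: "nat \<Rightarrow> nat \<Rightarrow> 'x source pmf \<Rightarrow> nat \<Rightarrow> ((nat \<Rightarrow> nat \<Rightarrow> 'x) \<times> state) pmf" where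
  "ideal_law n m Q i =
     map_pmf (\<lambda>s. (\<lambda>k\<in>{..<2 ^ n}. fst (s k), ideal_state n m i (\<lambda>l. U_block n l s))) (iid n Q)"

text \<open>Two exchanges: the broadcaster's sequence is replaced by the ideal one, jointly with the
  past, and then every other terminal's version by that same sequence.\<close>

lemma tv_le_round:
  fixes Q :: "'x source pmf" and K :: "'x \<times> (nat \<Rightarrow> bit) \<Rightarrow> bit pmf"
  assumes fin: "finite (set_pmf Q)" and m: "m \<ge> 1"
    and K: "map_pmf (\<lambda>(x, u). ((x, restrict u {1..<Suc i}), u (Suc i))) Q =
      bind_pmf (map_pmf (\<lambda>(x, u). (x, restrict u {1..<Suc i})) Q)
        (\<lambda>a. map_pmf (Pair a) (K (fst a (broadcaster m (Suc i)), snd a)))"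
  shows "tv_le (round_error \<beta> n m)
    (bind_pmf (ideal_law n m Q i) (\<lambda>(x, st). map_pmf (Pair x) (play_round \<beta> n m Q d x (Suc i) st))) (ideal_law n m Q (Suc i))"
proof -
  let ?i = "Suc i" and ?N = "2 ^ n :: nat"
  let ?j = "broadcaster m ?i"
  have j: "?j \<le> m" using m by (rule broadcaster_le)
  let ?st = "\<lambda>\<alpha>. ideal_state n m i (snd \<alpha>)"
  let ?b = "\<lambda>\<alpha>. broadcaster_step \<beta> n m Q d ?i (fst (own_past n ?j \<alpha>)) (snd \<alpha>)"
  let ?r = "\<lambda>\<alpha> w. Pi_pmf {0..m} undefined (\<lambda>a. if a = ?j then return_pmf w
    else generate (receiver_step \<beta> n m Q d ?i w (?st \<alpha> a)) ?N)"
  let ?u = "\<lambda>\<alpha> v. (fst \<alpha>, \<lambda>a. (?st \<alpha> a)(?i := polar n (v a)))"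
  let ?after = "\<lambda>(\<alpha>, w). map_pmf (?u \<alpha>) (?r \<alpha> w)"
  let ?V = "V_block n ?i"
  let ?past = "past n ?i :: (nat \<Rightarrow> 'x source) \<Rightarrow> _"
  have st_past: "?st (?past s) = ideal_state n m i (\<lambda>l. U_block n l s)" for s
    unfolding past_def snd_conv by (rule ideal_state_restrict)
  have "bind_pmf (ideal_law n m Q i) (\<lambda>(x, st). map_pmf (Pair x) (play_round \<beta> n m Q d x ?i st)) =
      bind_pmf (iid n Q) (\<lambda>s. bind_pmf (generate (?b (?past s)) ?N) (\<lambda>w. ?after (?past s, w)))"
    unfolding ideal_law_def bind_map_pmf
  proof (rule bind_pmf_cong[OF refl])
    fix s :: "nat \<Rightarrow> 'x source"
    have "restrict (?st (?past s) ?j) {1..<?i} = restrict (snd (?past s)) {1..<?i}"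
      by (rule restrict_ideal_state[OF j])
    then have "broadcaster_step \<beta> n m Q d ?i (fst (own_past n ?j (?past s))) (?st (?past s) ?j) = ?b (?past s)"
      by (rule broadcaster_step_restrict)
    note step = this
    have x: "(\<lambda>k\<in>{..<2 ^ n}. fst (s k)) = fst (?past s)" by (simp add: past_def)
    have own: "(\<lambda>k\<in>{..<2 ^ n}. fst (?past s) k ?j) = fst (own_past n ?j (?past s))"
      by (simp add: own_past_def)
    show "(case (\<lambda>k\<in>{..<2 ^ n}. fst (s k), ideal_state n m i (\<lambda>l. U_block n l s)) of
        (x, st) \<Rightarrow> map_pmf (Pair x) (play_round \<beta> n m Q d x ?i st)) =
      bind_pmf (generate (?b (?past s)) ?N) (\<lambda>w. ?after (?past s, w))"
      unfolding x st_past[symmetric] prod.case play_round_def Let_def own step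
      by (simp add: map_pmf_def bind_assoc_pmf bind_return_pmf)
  qed
  also have "\<dots> = bind_pmf (bind_pmf (map_pmf fst (past_law n Q ?i))
      (\<lambda>\<alpha>. map_pmf (Pair \<alpha>) (generate (?b \<alpha>) ?N))) ?after"
    by (simp add: past_law_def pmf.map_comp o_def bind_map_pmf bind_assoc_pmf)
  finally have protocol: "bind_pmf (ideal_law n m Q i) (\<lambda>(x, st). map_pmf (Pair x) (play_round \<beta> n m Q d x ?i st)) = \<dots>" .
  have "tv_le (\<Sum>k<?N. step_error \<beta> n)
      (bind_pmf (map_pmf fst (past_law n Q ?i)) (\<lambda>\<alpha>. map_pmf (Pair \<alpha>) (generate (?b \<alpha>) ?N)))
      (map_pmf (\<lambda>(\<alpha>, v). (\<alpha>, restrict v {..<?N})) (past_law n Q ?i))"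
    by (rule tv_le_generate) (rule tv_le_broadcaster_step[OF fin K])
  then have broadcaster: "tv_le (2 ^ n * step_error \<beta> n)
      (bind_pmf (ideal_law n m Q i) (\<lambda>(x, st). map_pmf (Pair x) (play_round \<beta> n m Q d x ?i st)))
      (bind_pmf (map_pmf (\<lambda>(\<alpha>, v). (\<alpha>, restrict v {..<?N})) (past_law n Q ?i)) ?after)"
    unfolding protocol by (intro tv_le_bind) simp
  have ideal: "bind_pmf (map_pmf (\<lambda>(\<alpha>, v). (\<alpha>, restrict v {..<?N})) (past_law n Q ?i)) ?after =
      bind_pmf (iid n Q) (\<lambda>s. map_pmf (?u (?past s)) (?r (?past s) (?V s)))"
    by (simp add: past_law_def bind_map_pmf pmf.map_comp o_def extensional_restrict[OF V_block_extensional])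
  let ?mis = "\<lambda>k s. 1 - pmf (receiver_step \<beta> n m Q d ?i (?V s) (tuple {1..<?i} (U_block n) s) k
    (restrict (?V s) {..<k})) (?V s k)"
  have mis: "measure_pmf.expectation (iid n Q) (\<lambda>s. (real m + 1) * (\<Sum>k<?N. ?mis k s)) \<le> (real m + 1) * (2 ^ n * \<delta> \<beta> n)"
  proof -
    have "measure_pmf.expectation (iid n Q) (\<lambda>s. \<Sum>k<?N. ?mis k s) =
        (\<Sum>k<?N. measure_pmf.expectation (iid n Q) (?mis k))"
      by (rule Bochner_Integration.integral_sum) (rule integrable_measure_pmf_finite[OF finite_set_iid[OF fin]])
    also have "\<dots> \<le> (\<Sum>k<?N. \<delta> \<beta> n)"
      by (intro sum_mono expectation_receiver_mismatch[OF fin K]) simp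
    finally show ?thesis by (simp add: mult_left_mono)
  qed
  \<comment> \<open>The target is the point mass where all terminals hold the ideal sequence;
    \<open>undefined\<close> beyond \<open>m\<close> is the default value of the product
    law.\<close>
  have "tv_le ((real m + 1) * (2 ^ n * \<delta> \<beta> n))
      (bind_pmf (iid n Q) (\<lambda>s. map_pmf (?u (?past s)) (?r (?past s) (?V s))))
      (bind_pmf (iid n Q) (\<lambda>s. map_pmf (?u (?past s)) (return_pmf (\<lambda>a. if a \<le> m then ?V s else undefined))))"
  proof (rule tv_le_bind_kernel[OF finite_set_iid[OF fin] _ mis])
    fix s :: "nat \<Rightarrow> 'x source"
    let ?f = "\<lambda>a. if a = ?j then return_pmf (?V s)
      else generate (receiver_step \<beta> n m Q d ?i (?V s) (?st (?past s) a)) ?N"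
    have mis_nonneg: "0 \<le> ?mis k s" for k by (simp add: pmf_le_1)
    have a: "1 - pmf (?f a) (?V s) \<le> (\<Sum>k<?N. ?mis k s)" if "a \<in> {0..m}" for a
    proof (cases "a = ?j")
      case True
      then show ?thesis using sum_nonneg[of "{..<?N}" "\<lambda>k. ?mis k s"] mis_nonneg by simp
    next
      case False
      have past: "snd (?past s) = tuple {1..<?i} (U_block n) s" by (simp add: past_def)
      have "restrict (?st (?past s) a) {1..<?i} = restrict (tuple {1..<?i} (U_block n) s) {1..<?i}"
        unfolding past[symmetric] by (rule restrict_ideal_state) (use that in simp)
      then have "receiver_step \<beta> n m Q d ?i (?V s) (?st (?past s) a) =
          receiver_step \<beta> n m Q d ?i (?V s) (tuple {1..<?i} (U_block n) s)"
        by (rule receiver_step_restrict)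
      then show ?thesis using False mismatch_generate[OF V_block_extensional[of n ?i s]] by simp
    qed
    \<comment> \<open>Given the broadcast sequence the terminals sample independently, so the
      probability of full agreement is a product, and the failure probabilities add up.\<close>
    have prod: "pmf (?r (?past s) (?V s)) (\<lambda>a. if a \<le> m then ?V s else undefined) = (\<Prod>a\<in>{0..m}. pmf (?f a) (?V s))"
      by (subst pmf_Pi') (auto intro!: prod.cong)
    have "1 - pmf (?r (?past s) (?V s)) (\<lambda>a. if a \<le> m then ?V s else undefined) \<le>
        (\<Sum>a\<in>{0..m}. 1 - pmf (?f a) (?V s))"
      unfolding prod by (rule one_minus_prod_le_sum) (simp_all only: finite_atLeastAtMost pmf_le_1 pmf_nonneg)
    also have "\<dots> \<le> (\<Sum>a\<in>{0..m}. \<Sum>k<?N. ?mis k s)" by (rule sum_mono) (rule a)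
    also have "\<dots> = (real m + 1) * (\<Sum>k<?N. ?mis k s)" by simp
    finally show "tv_le ((real m + 1) * (\<Sum>k<?N. ?mis k s)) (map_pmf (?u (?past s)) (?r (?past s) (?V s)))
      (map_pmf (?u (?past s)) (return_pmf (\<lambda>a. if a \<le> m then ?V s else undefined)))"
      by (intro tv_le_map tv_le_mono[OF tv_le_return])
  qed
  moreover have "bind_pmf (iid n Q) (\<lambda>s. map_pmf (?u (?past s)) (return_pmf (\<lambda>a. if a \<le> m then ?V s else undefined))) =
      ideal_law n m Q ?i"
  proof -
    have "?u (?past s) (\<lambda>a. if a \<le> m then ?V s else undefined) =
        (\<lambda>k\<in>{..<2 ^ n}. fst (s k), ideal_state n m ?i (\<lambda>l. U_block n l s))" for s
      unfolding st_past ideal_state_Suc[symmetric]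
      by (auto simp: past_def fun_eq_iff polar_V_block)
    then show ?thesis unfolding ideal_law_def by (simp add: map_pmf_def bind_return_pmf)
  qed
  ultimately have receivers: "tv_le ((real m + 1) * (2 ^ n * \<delta> \<beta> n))
      (bind_pmf (iid n Q) (\<lambda>s. map_pmf (?u (?past s)) (?r (?past s) (?V s)))) (ideal_law n m Q ?i)"
    by (simp only:)
  show ?thesis
    unfolding round_error_def by (rule tv_le_trans[OF broadcaster[unfolded ideal] receivers])
qed

text \<open>Running a round on nearly ideal input costs nothing extra, so only the error of one
  ideally started round is added each time.\<close>

lemma tv_le_protocol:
  fixes Q :: "'x source pmf"
  assumes fin: "finite (set_pmf Q)" and m: "m \<ge> 1"
    and K: "\<And>i. i \<in> {1..t} \<Longrightarrow> \<exists>K. map_pmf (\<lambda>(x, u). ((x, restrict u {1..<i}), u i)) Q =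
      bind_pmf (map_pmf (\<lambda>(x, u). (x, restrict u {1..<i})) Q)
        (\<lambda>a. map_pmf (Pair a) (K (fst a (broadcaster m i), snd a)))"
  shows "i \<le> t \<Longrightarrow> tv_le (i * round_error \<beta> n m) (protocol \<beta> n m i Q d)
    (ideal_law n m Q i)"
proof (induction i)
  case 0
  have "iid n (map_pmf fst Q) = map_pmf (\<lambda>s. \<lambda>k\<in>{..<2 ^ n}. fst (s k)) (iid n Q)"
    unfolding iid_map by (intro map_pmf_cong refl) (auto simp: fun_eq_iff)
  then have "protocol \<beta> n m 0 Q d = ideal_law n m Q 0"
    by (simp add: ideal_law_def protocol_def bind_return_pmf map_pmf_def bind_assoc_pmf ideal_state_def)
  then show ?case by (simp add: tv_le_refl)
next
  case (Suc i)
  let ?I = "ideal_law n m Q"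
  let ?R = "\<lambda>(x, st). map_pmf (Pair x) (play_round \<beta> n m Q d x (Suc i) st)"
  obtain K where "map_pmf (\<lambda>(x, u). ((x, restrict u {1..<Suc i}), u (Suc i))) Q =
      bind_pmf (map_pmf (\<lambda>(x, u). (x, restrict u {1..<Suc i})) Q)
        (\<lambda>a. map_pmf (Pair a) (K (fst a (broadcaster m (Suc i)), snd a)))"
    using K[of "Suc i"] Suc.prems by auto
  then have round: "tv_le (round_error \<beta> n m) (bind_pmf (?I i) ?R) (?I (Suc i))"
    by (rule tv_le_round[OF fin m])
  have "protocol \<beta> n m (Suc i) Q d = bind_pmf (protocol \<beta> n m i Q d) ?R"
    by (simp add: protocol_def map_pmf_def bind_assoc_pmf bind_return_pmf)
  moreover have "tv_le (i * round_error \<beta> n m) (bind_pmf (protocol \<beta> n m i Q d) ?R) (bind_pmf (?I i) ?R)"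
    by (rule tv_le_bind[OF Suc.IH]) (use Suc.prems in simp)
  moreover have "Suc i * round_error \<beta> n m = i * round_error \<beta> n m + round_error \<beta> n m"
    by (simp add: algebra_simps)
  ultimately show ?case using tv_le_trans[OF _ round] by (simp only:)
qed

lemma round_error_tendsto_0:
  assumes "\<beta> > 0"
  shows "(\<lambda>n. round_error \<beta> n m) \<longlonglongrightarrow> 0"
proof -
  have "(\<lambda>n. 2 ^ n * \<delta> \<beta> n) \<longlonglongrightarrow> 0" "(\<lambda>n. 2 ^ n * sqrt (2 * \<delta> \<beta> n)) \<longlonglongrightarrow> 0"
    unfolding \<delta>_def using assms by real_asymp+
  then have "(\<lambda>n. 2 ^ n * sqrt (2 * \<delta> \<beta> n) + 2 ^ n * \<delta> \<beta> n + (real m + 1) * (2 ^ n * \<delta> \<beta> n)) \<longlonglongrightarrow>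
      0 + 0 + (real m + 1) * 0"
    by (intro tendsto_add tendsto_mult tendsto_const)
  then show ?thesis by (simp add: round_error_def step_error_def distrib_left add.commute)
qed

section \<open>Laws of simple random variables\<close>

lemma set_law_subset:
  assumes M: "prob_space M" and sf: "simple_function M Y"
  shows "set_pmf (law M Y) \<subseteq> Y ` space M"
proof
  interpret prob_space M by fact
  fix y assume "y \<in> set_pmf (law M Y)"
  then have "prob {\<omega> \<in> space M. Y \<omega> = y} \<noteq> 0"
    using pmf_law[OF M sf, of y] by (simp add: set_pmf_iff)
  then have "{\<omega> \<in> space M. Y \<omega> = y} \<noteq> {}" by (metis measure_empty)
  then show "y \<in> Y ` space M" by auto
qed

lemma prob_law:
  assumes M: "prob_space M" and sf: "simple_function M Y"
  shows "measure_pmf.prob (law M Y) E = \<P>(\<omega> in M. Y \<omega> \<in> E)"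
proof -
  interpret prob_space M by fact
  have fin: "finite (Y ` space M)" using sf by (rule simple_functionD(1))
  have sets: "{\<omega> \<in> space M. Y \<omega> = z} \<in> events" for z
    using simple_functionD(2)[OF sf, of "{z}"] by (simp add: vimage_def Int_def conj_commute)
  have "set_pmf (law M Y) \<subseteq> Y ` space M" by (rule set_law_subset[OF M sf])
  then have "measure_pmf.prob (law M Y) E = measure_pmf.prob (law M Y) (E \<inter> Y ` space M)"
    by (intro measure_prob_cong_0) (auto simp: set_pmf_iff subset_iff)
  also have "\<dots> = (\<Sum>y\<in>E \<inter> Y ` space M. prob {\<omega> \<in> space M. Y \<omega> = y})"
    using fin by (simp add: measure_measure_pmf_finite pmf_law[OF M sf])
  also have "\<dots> = prob (\<Union>y\<in>E \<inter> Y ` space M. {\<omega> \<in> space M. Y \<omega> = y})"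
    by (rule finite_measure_finite_Union[symmetric])
       (use fin sets in \<open>auto simp: disjoint_family_on_def\<close>)
  also have "(\<Union>y\<in>E \<inter> Y ` space M. {\<omega> \<in> space M. Y \<omega> = y}) = {\<omega> \<in> space M. Y \<omega> \<in> E}" by auto
  finally show ?thesis .
qed

lemma map_law:
  assumes M: "prob_space M" and sf: "simple_function M Y"
  shows "map_pmf g (law M Y) = law M (\<lambda>\<omega>. g (Y \<omega>))"
proof (rule pmf_eqI)
  fix z
  have "simple_function M (\<lambda>\<omega>. g (Y \<omega>))" using sf by (rule simple_function_compose1)
  then show "pmf (map_pmf g (law M Y)) z = pmf (law M (\<lambda>\<omega>. g (Y \<omega>))) z"
    by (simp add: pmf_map prob_law[OF M sf] pmf_law[OF M] vimage_def)
qed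

lemma simple_function_law_sum:
  fixes g :: "'a \<Rightarrow> real"
  assumes M: "prob_space M" and sf: "simple_function M Y"
  shows "(\<Sum>y\<in>Y ` space M. pmf (law M Y) y * g y) = measure_pmf.expectation (law M Y) g"
  by (subst integral_measure_pmf_real[of "Y ` space M"])
     (use set_law_subset[OF M sf] simple_functionD(1)[OF sf] in \<open>auto simp: mult.commute\<close>)

section \<open>Shannon information measures in terms of laws\<close>

definition pmf_entropy :: "'a pmf \<Rightarrow> real" where
  "pmf_entropy R = - measure_pmf.expectation R (\<lambda>x. log 2 (pmf R x))"

lemma pmf_entropy_map_inj: "inj g \<Longrightarrow> pmf_entropy (map_pmf g R) = pmf_entropy R"
  by (simp add: pmf_entropy_def pmf_map_inj')

lemma obs_sum_H:
  assumes fin: "finite (set_pmf R)"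
  shows "obs_sum H_fun R = pmf_entropy R - pmf_entropy (map_pmf snd R)"
proof -
  have "measure_pmf.expectation (map_pmf snd R) (\<lambda>v. log 2 (pmf (map_pmf snd R) v)) =
      (\<Sum>v\<in>snd ` set_pmf R. log 2 (pmf (map_pmf snd R) v) * pmf (map_pmf snd R) v)"
    by (rule integral_measure_pmf_real) (use fin in auto)
  moreover have "measure_pmf.expectation R (\<lambda>x. log 2 (pmf R x)) = (\<Sum>v\<in>snd ` set_pmf R.
      log 2 (pmf R (0, v)) * pmf R (0, v) + log 2 (pmf R (1, v)) * pmf R (1, v))"
    by (rule expectation_bit_law[OF fin])
  ultimately show ?thesis
    by (simp add: pmf_entropy_def obs_sum_def H_fun_def \<eta>_fun_def pmf_snd_bit sum_negf[symmetric]
      sum.distrib[symmetric] sum_subtractf[symmetric] algebra_simps)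
qed

text \<open>In terms of joint entropies the information becomes comparable with a difference of two
  values of \<open>obs_sum_H\<close>: the limits of the index set fractions.\<close>

lemma conditional_mutual_information_law:
  assumes M: "prob_space M"
    and X: "simple_function M X" and Y: "simple_function M Y" and Z: "simple_function M Z"
  shows "information_space.conditional_mutual_information_Pow M 2 X Y Z =
    pmf_entropy (law M (\<lambda>\<omega>. (X \<omega>, Z \<omega>))) + pmf_entropy (law M (\<lambda>\<omega>. (Y \<omega>, Z \<omega>)))
    - pmf_entropy (law M (\<lambda>\<omega>. (X \<omega>, Y \<omega>, Z \<omega>))) - pmf_entropy (law M Z)"
proof -
  interpret prob_space M by fact
  interpret information_space M 2 by standard simp
  note YZ = simple_function_Pair[OF Y Z] and XZ = simple_function_Pair[OF X Z]
  note XYZ = simple_function_Pair[OF X YZ]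
  have sd: "simple_distributed M W (pmf (law M W))" if "simple_function M W" for W :: "'a \<Rightarrow> 'w"
    using that by (rule simple_distributedI)
      (auto simp: pmf_law[OF M that] intro!: arg_cong[where f = prob])
  let ?L = "law M (\<lambda>\<omega>. (X \<omega>, Y \<omega>, Z \<omega>))"
  let ?Z = "law M Z" and ?XZ = "law M (\<lambda>\<omega>. (X \<omega>, Z \<omega>))" and ?YZ = "law M (\<lambda>\<omega>. (Y \<omega>, Z \<omega>))"
  have marg: "?Z = map_pmf (\<lambda>(x, y, z). z) ?L" "?XZ = map_pmf (\<lambda>(x, y, z). (x, z)) ?L"
    "?YZ = map_pmf (\<lambda>(x, y, z). (y, z)) ?L"
    by (simp_all add: map_law[OF M XYZ])
  have fin: "finite (set_pmf ?L)"
    using set_law_subset[OF M XYZ] simple_functionD(1)[OF XYZ] by (rule finite_subset)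
  note int = integrable_measure_pmf_finite[OF fin]
  have entropy_marg: "pmf_entropy R' = - measure_pmf.expectation ?L (\<lambda>v. log 2 (pmf R' (g v)))"
    if "R' = map_pmf g ?L" for R' :: "'e pmf" and g
  proof -
    have "measure_pmf.expectation (map_pmf g ?L) h = measure_pmf.expectation ?L (\<lambda>v. h (g v))"
      for h :: "'e \<Rightarrow> real" by simp
    then show ?thesis unfolding that[symmetric] pmf_entropy_def by simp
  qed
  have "information_space.conditional_mutual_information_Pow M 2 X Y Z = (\<Sum>(x, y, z)\<in>(\<lambda>x. (X x, Y x, Z x)) ` space M.
      pmf ?L (x, y, z) * log 2 (pmf ?L (x, y, z) / (pmf ?XZ (x, z) * (pmf ?YZ (y, z) / pmf ?Z z))))"
    by (rule conditional_mutual_information_eq[OF sd[OF Z] sd[OF YZ] sd[OF XZ] sd[OF XYZ]])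
  also have "\<dots> = measure_pmf.expectation ?L (\<lambda>(x, y, z).
      log 2 (pmf ?L (x, y, z) / (pmf ?XZ (x, z) * (pmf ?YZ (y, z) / pmf ?Z z))))"
    unfolding simple_function_law_sum[OF M XYZ, symmetric] by (rule sum.cong) auto
  also have "\<dots> = measure_pmf.expectation ?L (\<lambda>(x, y, z).
      log 2 (pmf ?L (x, y, z)) - log 2 (pmf ?XZ (x, z)) - log 2 (pmf ?YZ (y, z)) + log 2 (pmf ?Z z))"
  proof (rule integral_cong_AE)
    show "AE v in measure_pmf ?L. (case v of (x, y, z) \<Rightarrow>
        log 2 (pmf ?L (x, y, z) / (pmf ?XZ (x, z) * (pmf ?YZ (y, z) / pmf ?Z z)))) =
      (case v of (x, y, z) \<Rightarrow>
        log 2 (pmf ?L (x, y, z)) - log 2 (pmf ?XZ (x, z)) - log 2 (pmf ?YZ (y, z)) + log 2 (pmf ?Z z))"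
    proof (simp only: AE_measure_pmf_iff, clarify)
      fix x y z assume xyz: "(x, y, z) \<in> set_pmf ?L"
      have "z \<in> set_pmf ?Z" "(x, z) \<in> set_pmf ?XZ" "(y, z) \<in> set_pmf ?YZ"
        unfolding marg using xyz by force+
      then have "pmf ?L (x, y, z) > 0" "pmf ?XZ (x, z) > 0" "pmf ?YZ (y, z) > 0" "pmf ?Z z > 0"
        using xyz by (simp_all only: pmf_positive)
      then show "log 2 (pmf ?L (x, y, z) / (pmf ?XZ (x, z) * (pmf ?YZ (y, z) / pmf ?Z z))) =
        log 2 (pmf ?L (x, y, z)) - log 2 (pmf ?XZ (x, z)) - log 2 (pmf ?YZ (y, z)) + log 2 (pmf ?Z z)"
        by (simp add: log_divide_pos log_mult_pos)
    qed
  qed auto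
  also have "\<dots> = measure_pmf.expectation ?L (\<lambda>v. log 2 (pmf ?L v))
      - measure_pmf.expectation ?L (\<lambda>(x, y, z). log 2 (pmf ?XZ (x, z)))
      - measure_pmf.expectation ?L (\<lambda>(x, y, z). log 2 (pmf ?YZ (y, z)))
      + measure_pmf.expectation ?L (\<lambda>(x, y, z). log 2 (pmf ?Z z))"
    unfolding case_prod_beta' prod.collapse by (simp add: int)
  also have "measure_pmf.expectation ?L (\<lambda>(x, y, z). log 2 (pmf ?Z z)) = - pmf_entropy ?Z"
    unfolding entropy_marg[OF marg(1)] by (simp add: case_prod_beta')
  also have "measure_pmf.expectation ?L (\<lambda>(x, y, z). log 2 (pmf ?XZ (x, z))) = - pmf_entropy ?XZ"
    unfolding entropy_marg[OF marg(2)] by (simp add: case_prod_beta')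
  also have "measure_pmf.expectation ?L (\<lambda>(x, y, z). log 2 (pmf ?YZ (y, z))) = - pmf_entropy ?YZ"
    unfolding entropy_marg[OF marg(3)] by (simp add: case_prod_beta')
  finally show ?thesis by (simp add: pmf_entropy_def)
qed

text \<open>All summands of the conditional entropy have the same sign, so each vanishes. A value
  \<open>x\<close> that is possible with \<open>y\<close> then carries the whole mass of
  \<open>y\<close>, leaving none for \<open>x'\<close>.\<close>

lemma conditional_entropy_0_law:
  assumes M: "prob_space M" and X: "simple_function M X" and Y: "simple_function M Y"
    and 0: "information_space.conditional_entropy_Pow M 2 X Y = 0"
    and xy: "(x, y) \<in> set_pmf (law M (\<lambda>\<omega>. (X \<omega>, Y \<omega>)))" "(x', y) \<in> set_pmf (law M (\<lambda>\<omega>. (X \<omega>, Y \<omega>)))"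
  shows "x = x'"
proof (rule ccontr)
  assume ne: "x \<noteq> x'"
  interpret prob_space M by fact
  interpret information_space M 2 by standard simp
  note XY = simple_function_Pair[OF X Y]
  let ?L = "law M (\<lambda>\<omega>. (X \<omega>, Y \<omega>))" and ?Y = "law M Y"
  have marg: "?Y = map_pmf snd ?L" by (simp add: map_law[OF M XY])
  have sd: "simple_distributed M W (pmf (law M W))" if "simple_function M W" for W :: "'a \<Rightarrow> 'w"
    using that by (rule simple_distributedI)
      (auto simp: pmf_law[OF M that] intro!: arg_cong[where f = prob])
  have le: "pmf ?L (a, b) \<le> pmf ?Y b" for a b
  proof -
    have "measure_pmf.prob ?L {(a, b)} \<le> measure_pmf.prob ?L (snd -` {b})"
      by (rule measure_pmf.finite_measure_mono) auto
    then show ?thesis by (simp add: marg pmf_map measure_pmf_single)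
  qed
  let ?g = "\<lambda>(a, b). pmf ?L (a, b) * log 2 (pmf ?L (a, b) / pmf ?Y b)"
  have g: "?g z \<le> 0" for z
  proof (cases z)
    case (Pair a b)
    have "pmf ?L (a, b) * log 2 (pmf ?L (a, b) / pmf ?Y b) \<le> 0" if "pmf ?L (a, b) > 0"
    proof -
      have "pmf ?Y b > 0" using that le[of a b] by linarith
      then have "log 2 (pmf ?L (a, b) / pmf ?Y b) \<le> 0" using that le[of a b] by simp
      then show ?thesis using that by (simp add: mult_nonneg_nonpos)
    qed
    then show ?thesis using Pair pmf_nonneg[of ?L "(a, b)"] by (cases "pmf ?L (a, b) = 0") auto
  qed
  have "(\<Sum>z\<in>(\<lambda>\<omega>. (X \<omega>, Y \<omega>)) ` space M. - ?g z) = 0"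
    using 0 unfolding conditional_entropy_eq[OF sd[OF Y] sd[OF XY]] by (simp add: sum_negf)
  moreover have "(x, y) \<in> (\<lambda>\<omega>. (X \<omega>, Y \<omega>)) ` space M" using set_law_subset[OF M XY] xy(1) by blast
  ultimately have "- ?g (x, y) = 0"
    using sum_nonneg_eq_0_iff[OF simple_functionD(1)[OF XY], of "\<lambda>z. - ?g z"] g by auto
  moreover have pos: "pmf ?L (x, y) > 0" "pmf ?L (x', y) > 0" using xy by (simp_all only: pmf_positive)
  ultimately have log: "log 2 (pmf ?L (x, y) / pmf ?Y y) = 0" by simp
  have "pmf ?Y y > 0" using pos le[of x y] by linarith
  then have "pmf ?L (x, y) / pmf ?Y y > 0" using pos by simp
  then have "2 powr log 2 (pmf ?L (x, y) / pmf ?Y y) = pmf ?L (x, y) / pmf ?Y y"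
    by (intro powr_log_cancel) simp_all
  with \<open>pmf ?Y y > 0\<close> have "pmf ?L (x, y) = pmf ?Y y" unfolding log by simp
  moreover have "pmf ?L (x, y) + pmf ?L (x', y) \<le> pmf ?Y y"
  proof -
    have "pmf ?L (x, y) + pmf ?L (x', y) = measure_pmf.prob ?L {(x, y), (x', y)}"
      using ne by (simp add: measure_measure_pmf_finite)
    also have "\<dots> \<le> pmf ?Y y"
      unfolding marg pmf_map by (rule measure_pmf.finite_measure_mono) auto
    finally show ?thesis .
  qed
  ultimately show False using pos by linarith
qed

text \<open>\<open>V\<close> is the whole past, \<open>\<phi> (V \<omega>)\<close> the conditioning
  variable and \<open>W\<close> the remaining sources; \<psi> and \<rho> say that \<open>V\<close>
  and the pair of the other two encode each other. This turns the product form of the Markov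
  property into a kernel that depends on \<open>\<phi> v\<close> only.\<close>

lemma markov_chain_law:
  fixes A :: "'w \<Rightarrow> 'a" and V :: "'w \<Rightarrow> 'v" and \<phi> :: "'v \<Rightarrow> 'b"
  assumes M: "prob_space M" and A: "simple_function M A" and V: "simple_function M V"
    and W: "simple_function M W"
    and markov: "markov_chain M A (\<lambda>\<omega>. \<phi> (V \<omega>)) W"
    and V_eq: "\<And>\<omega>. \<omega> \<in> space M \<Longrightarrow> V \<omega> = \<psi> (\<phi> (V \<omega>), W \<omega>)"
    and W_eq: "\<And>\<omega>. \<omega> \<in> space M \<Longrightarrow> W \<omega> = \<rho> (V \<omega>)"
  shows "law M (\<lambda>\<omega>. (V \<omega>, A \<omega>)) = bind_pmf (law M V) (\<lambda>v. map_pmf (Pair v)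
    (cond_law (law M (\<lambda>\<omega>. (A \<omega>, \<phi> (V \<omega>)))) undefined (\<phi> v)))"
proof (rule pmf_eqI)
  interpret prob_space M by fact
  fix z :: "'v \<times> 'a"
  obtain v a where z: "z = (v, a)" by (cases z)
  let ?K = "cond_law (law M (\<lambda>\<omega>. (A \<omega>, \<phi> (V \<omega>)))) undefined"
  note VA = simple_function_Pair[OF V A]
  have \<phi>V: "simple_function M (\<lambda>\<omega>. \<phi> (V \<omega>))" using V by (rule simple_function_compose1)
  note A\<phi>V = simple_function_Pair[OF A \<phi>V]
  show "pmf (law M (\<lambda>\<omega>. (V \<omega>, A \<omega>))) z = pmf (bind_pmf (law M V) (\<lambda>v. map_pmf (Pair v) (?K (\<phi> v)))) z"
  proof (cases "v \<in> set_pmf (law M V)")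
    case False
    have "law M V = map_pmf fst (law M (\<lambda>\<omega>. (V \<omega>, A \<omega>)))" by (simp add: map_law[OF M VA])
    then have "set_pmf (law M V) = fst ` set_pmf (law M (\<lambda>\<omega>. (V \<omega>, A \<omega>)))" by simp
    then have "z \<notin> set_pmf (law M (\<lambda>\<omega>. (V \<omega>, A \<omega>)))" using False z by force
    then have "pmf (law M (\<lambda>\<omega>. (V \<omega>, A \<omega>))) z = 0" by (simp add: pmf_eq_0_set_pmf)
    moreover have "pmf (law M V) v = 0" using False by (simp add: pmf_eq_0_set_pmf)
    ultimately show ?thesis unfolding z pmf_bind_Pair by simp
  next
    case True
    let ?b = "\<phi> v" and ?c = "\<rho> v"
    obtain \<omega>' where \<omega>': "\<omega>' \<in> space M" "V \<omega>' = v" using True set_law_subset[OF M V] by blast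
    have v_eq: "v = \<psi> (?b, ?c)" using V_eq[OF \<omega>'(1)] unfolding W_eq[OF \<omega>'(1)] \<omega>'(2) .
    have v: "V \<omega> = v \<longleftrightarrow> W \<omega> = ?c \<and> \<phi> (V \<omega>) = ?b" if "\<omega> \<in> space M" for \<omega>
    proof
      assume "V \<omega> = v"
      then show "W \<omega> = ?c \<and> \<phi> (V \<omega>) = ?b" using W_eq[OF that] by simp
    next
      assume "W \<omega> = ?c \<and> \<phi> (V \<omega>) = ?b"
      then have "\<psi> (\<phi> (V \<omega>), W \<omega>) = v" unfolding v_eq[symmetric] by (simp add: v_eq[symmetric])
      then show "V \<omega> = v" using V_eq[OF that] by (rule trans[rotated])
    qed
    have pV: "pmf (law M V) v = prob {\<omega> \<in> space M. W \<omega> = ?c \<and> \<phi> (V \<omega>) = ?b}"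
      unfolding pmf_law[OF M V] by (rule arg_cong[where f = prob]) (use v in auto)
    have pVA: "pmf (law M (\<lambda>\<omega>. (V \<omega>, A \<omega>))) (v, a) =
        prob {\<omega> \<in> space M. (A \<omega> = a \<and> W \<omega> = ?c) \<and> \<phi> (V \<omega>) = ?b}"
      unfolding pmf_law[OF M VA] by (rule arg_cong[where f = prob]) (use v in auto)
    have pA: "pmf (law M (\<lambda>\<omega>. (A \<omega>, \<phi> (V \<omega>)))) (a, ?b) = prob {\<omega> \<in> space M. A \<omega> = a \<and> \<phi> (V \<omega>) = ?b}"
      unfolding pmf_law[OF M A\<phi>V] by (rule arg_cong[where f = prob]) auto
    have marg: "map_pmf snd (law M (\<lambda>\<omega>. (A \<omega>, \<phi> (V \<omega>)))) = law M (\<lambda>\<omega>. \<phi> (V \<omega>))"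
      by (simp add: map_law[OF M A\<phi>V])
    have pb: "pmf (law M (\<lambda>\<omega>. \<phi> (V \<omega>))) ?b = prob {\<omega> \<in> space M. \<phi> (V \<omega>) = ?b}"
      by (rule pmf_law[OF M \<phi>V])
    have b: "?b \<in> snd ` set_pmf (law M (\<lambda>\<omega>. (A \<omega>, \<phi> (V \<omega>))))"
    proof -
      have "?b \<in> set_pmf (map_pmf \<phi> (law M V))" using True by simp
      then show ?thesis unfolding map_law[OF M V] marg[symmetric] by simp
    qed
    then have "prob {\<omega> \<in> space M. \<phi> (V \<omega>) = ?b} > 0"
      unfolding pb[symmetric] marg[symmetric] by (intro pmf_positive) simp
    moreover have "\<P>(\<omega> in M. A \<omega> = a \<and> W \<omega> = ?c \<bar> \<phi> (V \<omega>) = ?b) =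
        \<P>(\<omega> in M. A \<omega> = a \<bar> \<phi> (V \<omega>) = ?b) * \<P>(\<omega> in M. W \<omega> = ?c \<bar> \<phi> (V \<omega>) = ?b)"
      using markov unfolding markov_chain_def by blast
    ultimately have "prob {\<omega> \<in> space M. (A \<omega> = a \<and> W \<omega> = ?c) \<and> \<phi> (V \<omega>) = ?b} =
        prob {\<omega> \<in> space M. W \<omega> = ?c \<and> \<phi> (V \<omega>) = ?b} *
        (prob {\<omega> \<in> space M. A \<omega> = a \<and> \<phi> (V \<omega>) = ?b} / prob {\<omega> \<in> space M. \<phi> (V \<omega>) = ?b})"
      unfolding cond_prob_def by (simp add: field_simps)
    then show ?thesis
      unfolding z pmf_bind_Pair pmf_cond_law[OF b] marg pVA pV pA pb .
  qed
qed

theorem mainTheorem2: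
  fixes M :: "'w measure"
    and m t :: nat
    and \<X> :: "nat \<Rightarrow> 'x set"
    and X :: "nat \<Rightarrow> 'w \<Rightarrow> 'x"
    and U :: "nat \<Rightarrow> 'w \<Rightarrow> bit"
    and f :: "(nat \<Rightarrow> 'x) \<Rightarrow> 'z"
    and \<beta> :: real
    and d :: "'x null_choice"
  defines "Q \<equiv> law M (\<lambda>\<omega>. (tuple {1..m} X \<omega>, tuple {1..t} U \<omega>))"
  assumes M: "prob_space M"
    and m: "m \<ge> 1"
    and t: "t \<ge> 1"
    and \<beta>: "0 < \<beta>" "\<beta> < 1 / 2"
    and finite: "\<And>j. j \<in> {1..m} \<Longrightarrow> finite (\<X> j)"
    and indep: "prob_space.indep_vars M (\<lambda>j. count_space (\<X> j)) X {1..m}"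
    and U: "\<And>i. i \<in> {1..t} \<Longrightarrow> U i \<in> M \<rightarrow>\<^sub>M count_space UNIV"
    and entropy: "information_space.conditional_entropy_Pow M 2
      (\<lambda>\<omega>. f (tuple {1..m} X \<omega>)) (tuple {1..t} U) = 0"
    and markov: "\<And>i j. i \<in> {1..t} \<Longrightarrow> j = (i - 1) mod m + 1 \<Longrightarrow>
      markov_chain M (U i) (\<lambda>\<omega>. (tuple {1..<i} U \<omega>, X j \<omega>)) (tuple ({1..m} - {j}) X)"
  shows "(\<forall>i\<in>{1..t}. \<forall>j. j = (i - 1) mod m + 1 \<longrightarrow>
      (\<lambda>n. broadcast_rate \<beta> n m Q i) \<longlonglongrightarrow>
        information_space.conditional_mutual_information_Pow M 2 (X j) (U i) (tuple {1..<i} U)) \<and>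
    (\<exists>g :: nat \<Rightarrow> (nat \<Rightarrow> nat \<Rightarrow> bit) \<Rightarrow> nat \<Rightarrow> 'z.
      (\<lambda>n. measure_pmf.prob (protocol \<beta> n m t Q d)
        {(x, st). \<forall>k<2 ^ n. g n (restrict (st sink) {1..t}) k = f (\<lambda>j\<in>{1..m}. x k j)}) \<longlonglongrightarrow> 1)"
proof -
  interpret prob_space M by (fact M)
  let ?X = "tuple {1..m} X" and ?U = "tuple {1..t} U"
  have sfX: "simple_function M (X j)" if "j \<in> {1..m}" for j
  proof -
    have meas: "X j \<in> M \<rightarrow>\<^sub>M count_space (\<X> j)" using indep that by (simp add: indep_vars_def)
    show ?thesis unfolding simple_function_def
    proof (intro conjI ballI)
      have "X j ` space M \<subseteq> \<X> j" using measurable_space[OF meas] by auto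
      then show "finite (X j ` space M)" using finite[OF that] by (rule finite_subset)
      fix x assume "x \<in> X j ` space M"
      then have "{x} \<in> sets (count_space (\<X> j))" using measurable_space[OF meas] by auto
      then show "X j -` {x} \<inter> space M \<in> sets M" by (rule measurable_sets[OF meas])
    qed
  qed
  have sfU: "simple_function M (U i)" if "i \<in> {1..t}" for i
    unfolding simple_function_def
    using measurable_sets[OF U[OF that]] by auto
  have sf_tuple: "simple_function M (tuple I Y)"
    if "finite I" "\<And>i. i \<in> I \<Longrightarrow> simple_function M (Y i)" for I :: "nat set" and Y :: "nat \<Rightarrow> 'w \<Rightarrow> 'e"
    using that
  proof (induction I rule: finite_induct)
    case empty
    then show ?case by simp
  next
    case (insert i I)
    have eq: "tuple (insert i I) Y = (\<lambda>\<omega>. (tuple I Y \<omega>)(i := Y i \<omega>))"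
      by (auto simp: fun_eq_iff)
    have "simple_function M (\<lambda>\<omega>. (\<lambda>(f, y). f(i := y)) (tuple I Y \<omega>, Y i \<omega>))"
      by (rule simple_function_compose1[OF simple_function_Pair]) (use insert in auto)
    then show ?case unfolding eq by (simp only: prod.case)
  qed
  have sf: "simple_function M ?X" "simple_function M ?U"
    by (rule sf_tuple; simp add: sfX sfU)+
  note XU = simple_function_Pair[OF sf]
  have Q: "map_pmf g Q = law M (\<lambda>\<omega>. g (?X \<omega>, ?U \<omega>))" for g :: "'x source \<Rightarrow> 'e"
    unfolding Q_def by (rule map_law[OF M XU])
  have finQ: "finite (set_pmf Q)"
    unfolding Q_def using set_law_subset[OF M XU] simple_functionD(1)[OF XU] by (rule finite_subset)
  have restrict_U: "restrict (?U \<omega>) {1..<i} = tuple {1..<i} U \<omega>" if "i \<in> {1..t}" for i \<omega>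
    using that by (auto simp: fun_eq_iff)
  have bm: "broadcaster m i \<in> {1..m}" for i
    using broadcaster_le[OF m, of i] by (simp add: broadcaster_def)
  have rate: "(\<lambda>n. broadcast_rate \<beta> n m Q i) \<longlonglongrightarrow>
      information_space.conditional_mutual_information_Pow M 2 (X j) (U i) (tuple {1..<i} U)"
    if i: "i \<in> {1..t}" and j: "j = (i - 1) mod m + 1" for i j
  proof -
    have j': "j = broadcaster m i" "j \<in> {1..m}" using j bm[of i] by (simp_all add: broadcaster_def)
    let ?p = "map_pmf (\<lambda>(x, u). (u i, restrict u {1..<i})) Q"
    let ?q = "map_pmf (\<lambda>(x, u). (u i, (x j, restrict u {1..<i}))) Q"
    let ?Z = "tuple {1..<i} U"
    have fin: "finite (set_pmf ?p)" "finite (set_pmf ?q)" using finQ by simp_all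
    have "(\<lambda>n. 1 - real (card (L_UU \<beta> n Q i)) / 2 ^ n - real (card (H_UXU \<beta> n Q j i)) / 2 ^ n) \<longlonglongrightarrow>
        1 - (1 - obs_sum H_fun ?p) - obs_sum H_fun ?q"
      unfolding L_UU_def H_UXU_def
      by (intro tendsto_diff tendsto_const source_polarization[OF fin(1) \<beta>] source_polarization[OF fin(2) \<beta>])
    moreover have "eventually (\<lambda>n. 1 - real (card (L_UU \<beta> n Q i)) / 2 ^ n - real (card (H_UXU \<beta> n Q j i)) / 2 ^ n =
        broadcast_rate \<beta> n m Q i) sequentially"
      using eventually_ge_at_top[of 1]
      by eventually_elim (simp add: broadcast_rate_eq[OF finQ \<beta>(1)] j'(1))
    ultimately have lim: "(\<lambda>n. broadcast_rate \<beta> n m Q i) \<longlonglongrightarrow> obs_sum H_fun ?p - obs_sum H_fun ?q"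
      by (simp add: tendsto_cong)
    have sfZ: "simple_function M ?Z" by (rule sf_tuple) (use i sfU in auto)
    have p1: "?p = law M (\<lambda>\<omega>. (U i \<omega>, ?Z \<omega>))"
      unfolding Q using i restrict_U[OF i] by simp
    have q1: "?q = law M (\<lambda>\<omega>. (U i \<omega>, (X j \<omega>, ?Z \<omega>)))"
      unfolding Q using i j'(2) restrict_U[OF i] by simp
    note p_law = map_law[OF M simple_function_Pair[OF sfU[OF i] sfZ]]
    note q_law = map_law[OF M simple_function_Pair[OF sfU[OF i] simple_function_Pair[OF sfX[OF j'(2)] sfZ]]]
    have p: "?p = law M (\<lambda>\<omega>. (U i \<omega>, ?Z \<omega>))" "map_pmf snd ?p = law M ?Z"
      unfolding p1 p_law by simp_all
    have q: "map_pmf (\<lambda>(a, b, c). (b, a, c)) ?q = law M (\<lambda>\<omega>. (X j \<omega>, U i \<omega>, ?Z \<omega>))"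
      "map_pmf snd ?q = law M (\<lambda>\<omega>. (X j \<omega>, ?Z \<omega>))"
      unfolding q1 q_law by simp_all
    \<comment> \<open>The mutual information lists the source first, the polarized law the bit;
      entropy is insensitive to the order.\<close>
    have swap: "pmf_entropy (map_pmf (\<lambda>(a, b, c). (b, a, c)) ?q) = pmf_entropy ?q"
      by (rule pmf_entropy_map_inj) (auto simp: inj_on_def)
    have "information_space.conditional_mutual_information_Pow M 2 (X j) (U i) ?Z =
        obs_sum H_fun ?p - obs_sum H_fun ?q"
      unfolding obs_sum_H[OF fin(1)] obs_sum_H[OF fin(2)] swap[symmetric]
      unfolding p(2) q unfolding p(1)
      by (subst conditional_mutual_information_law[OF M sfX[OF j'(2)] sfU[OF i] sf_tuple])
         (use i sfU in auto)
    with lim show ?thesis by simp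
  qed
  have kernel: "\<exists>K. map_pmf (\<lambda>(x, u). ((x, restrict u {1..<i}), u i)) Q =
      bind_pmf (map_pmf (\<lambda>(x, u). (x, restrict u {1..<i})) Q)
        (\<lambda>a. map_pmf (Pair a) (K (fst a (broadcaster m i), snd a)))" if i: "i \<in> {1..t}" for i
  proof -
    let ?j = "broadcaster m i"
    let ?V = "\<lambda>\<omega>. (?X \<omega>, tuple {1..<i} U \<omega>)" and ?W = "tuple ({1..m} - {?j}) X"
    let ?\<phi> = "\<lambda>v :: (nat \<Rightarrow> 'x) \<times> (nat \<Rightarrow> bit). (snd v, fst v ?j)"
    have sfZ: "simple_function M (tuple {1..<i} U)" by (rule sf_tuple) (use i sfU in auto)
    have sfW: "simple_function M ?W" by (rule sf_tuple) (use sfX in auto)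
    have \<phi>: "?\<phi> (?V \<omega>) = (tuple {1..<i} U \<omega>, X ?j \<omega>)" for \<omega>
      unfolding fst_conv snd_conv using bm[of i] by (simp only: restrict_apply')
    have "markov_chain M (U i) (\<lambda>\<omega>. ?\<phi> (?V \<omega>)) ?W"
      unfolding \<phi> by (rule markov[OF i broadcaster_def])
    then have "law M (\<lambda>\<omega>. (?V \<omega>, U i \<omega>)) = bind_pmf (law M ?V) (\<lambda>v. map_pmf (Pair v)
        (cond_law (law M (\<lambda>\<omega>. (U i \<omega>, ?\<phi> (?V \<omega>)))) undefined (?\<phi> v)))"
    proof (rule markov_chain_law[OF M sfU[OF i] simple_function_Pair[OF sf(1) sfZ] sfW])
      \<comment> \<open>The tuple of all sources is rebuilt by inserting the broadcaster's symbol
        into the tuple of the others.\<close>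
      show "?V \<omega> = (\<lambda>((u, y), w). (w(?j := y), u)) (?\<phi> (?V \<omega>), ?W \<omega>)" for \<omega>
        using bm[of i] by (auto simp: fun_eq_iff)
      show "?W \<omega> = (\<lambda>v. restrict (fst v) ({1..m} - {?j})) (?V \<omega>)" for \<omega>
        by (auto simp: fun_eq_iff)
    qed
    moreover have "map_pmf (\<lambda>(x, u). ((x, restrict u {1..<i}), u i)) Q = law M (\<lambda>\<omega>. (?V \<omega>, U i \<omega>))"
      "map_pmf (\<lambda>(x, u). (x, restrict u {1..<i})) Q = law M ?V"
      unfolding Q using i restrict_U[OF i] by simp_all
    ultimately show ?thesis
      by (intro exI[of _ "\<lambda>(y, u). cond_law (law M (\<lambda>\<omega>. (U i \<omega>, ?\<phi> (?V \<omega>)))) undefined (u, y)"]) simp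
  qed
  have determined: "f x = f x'" if "(x, u) \<in> set_pmf Q" "(x', u) \<in> set_pmf Q" for x x' u
  proof (rule conditional_entropy_0_law[OF M _ sf(2) entropy])
    show "simple_function M (\<lambda>\<omega>. f (?X \<omega>))" using sf(1) by (rule simple_function_compose1)
    have "map_pmf (\<lambda>(x, u). (f x, u)) Q = law M (\<lambda>\<omega>. (f (?X \<omega>), ?U \<omega>))" unfolding Q by simp
    then have "set_pmf (law M (\<lambda>\<omega>. (f (?X \<omega>), ?U \<omega>))) = (\<lambda>(x, u). (f x, u)) ` set_pmf Q"
      by (simp flip: set_map_pmf)
    then show "(f x, u) \<in> set_pmf (law M (\<lambda>\<omega>. (f (?X \<omega>), ?U \<omega>)))"
      "(f x', u) \<in> set_pmf (law M (\<lambda>\<omega>. (f (?X \<omega>), ?U \<omega>)))" using that by force+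
  qed
  have ext: "x \<in> extensional {1..m}" "u \<in> extensional {1..t}" if "(x, u) \<in> set_pmf Q" for x u
    using that set_law_subset[OF M XU] unfolding Q_def by auto
  \<comment> \<open>The sink evaluates \<open>f\<close> at any source letter compatible with the
    letters it holds. By \<open>determined\<close> the choice does not affect the value.\<close>
  define g :: "nat \<Rightarrow> (nat \<Rightarrow> nat \<Rightarrow> bit) \<Rightarrow> nat \<Rightarrow> 'z" where
    "g n u k = f (SOME x. (x, \<lambda>i\<in>{1..t}. u i k) \<in> set_pmf Q)" for n u k
  let ?good = "\<lambda>n. {(x, st :: state). \<forall>k<2 ^ n. g n (restrict (st sink) {1..t}) k = f (\<lambda>j\<in>{1..m}. x k j)}"
  have "measure_pmf.prob (protocol \<beta> n m t Q d) (?good n) \<ge> 1 - t * round_error \<beta> n m" for n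
  proof -
    have "set_pmf (ideal_law n m Q t) \<subseteq> ?good n"
    proof (clarsimp simp: ideal_law_def)
      fix s k assume s: "s \<in> set_pmf (iid n Q)" and k: "k < (2::nat) ^ n"
      have sk: "s k \<in> set_pmf Q" using s k by (auto simp: iid_def set_Pi_pmf PiE_dflt_def)
      obtain x u where xu: "s k = (x, u)" by (cases "s k")
      note ext = ext[OF sk[unfolded xu]]
      have "(\<lambda>i\<in>{1..t}. restrict (ideal_state n m t (\<lambda>l. U_block n l s) sink) {1..t} i k) = restrict u {1..t}"
        using k xu by (auto simp: ideal_state_def U_block_def fun_eq_iff)
      also have "\<dots> = u" using ext(2) by (rule extensional_restrict)
      finally have u: "(\<lambda>i\<in>{1..t}. restrict (ideal_state n m t (\<lambda>l. U_block n l s) sink) {1..t} i k) = u" .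
      have "(SOME x. (x, u) \<in> set_pmf Q, u) \<in> set_pmf Q" by (rule someI[of _ x]) (use sk xu in simp)
      then have "f (SOME x. (x, u) \<in> set_pmf Q) = f x" by (rule determined) (use sk xu in simp)
      then have "g n (restrict (ideal_state n m t (\<lambda>l. U_block n l s) sink) {1..t}) k = f x"
        unfolding g_def u .
      also have "x = restrict (fst (s k)) {1..m}" using ext(1) xu by (simp add: extensional_restrict)
      finally show "g n (restrict (ideal_state n m t (\<lambda>l. U_block n l s) sink) {Suc 0..t}) k =
        f (restrict (fst (s k)) {Suc 0..m})" by (simp only: One_nat_def)
    qed
    then have ideal: "measure_pmf.prob (ideal_law n m Q t) (?good n) = 1"
      by (simp add: measure_pmf.prob_eq_1 AE_measure_pmf_iff subset_eq)
    have tv: "tv_le (t * round_error \<beta> n m) (protocol \<beta> n m t Q d) (ideal_law n m Q t)"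
      by (rule tv_le_protocol[OF finQ m _ order_refl]) (rule kernel)
    show ?thesis using tv_le_prob[OF tv, where A = "?good n"] unfolding ideal .
  qed
  note lower = this
  have "(\<lambda>n. 1 - t * round_error \<beta> n m) \<longlonglongrightarrow> 1 - real t * 0"
    by (intro tendsto_diff tendsto_const tendsto_mult round_error_tendsto_0[OF \<beta>(1)])
  then have lim: "(\<lambda>n. 1 - t * round_error \<beta> n m) \<longlonglongrightarrow> 1" by simp
  have "(\<lambda>n. measure_pmf.prob (protocol \<beta> n m t Q d) (?good n)) \<longlonglongrightarrow> 1"
    by (rule tendsto_sandwich[OF _ _ lim tendsto_const]) (use lower in auto)
  then show ?thesis using rate by (intro conjI ballI allI impI exI[of _ g])
qed

end
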